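(* Let $n\ge3$ and let $\Omega\subset\mathbb{R}^n$ be a bounded domain that satisfies an exterior ball condition at each of the distinct points $a_1,\dots,a_m\in\partial\Omega$. Then there exist a positive constant $c=c(n,m)$ depending only on $n$ and $m$ and a positive constant $\lambda$ such that $$\lambda\int_\Omega u^2dx+\int_\Omega|\nabla u|^2dx\ \ge\ \frac{n^2}{4}\sum_{k=1}^m\int_\Omega\frac{u^2}{|x-a_k|^2}dx+c\Big(\int_\Omega|u|^{\frac{2n}{n-2}}W\,dx\Big)^{\frac{n-2}{n}},\qquad u\in C_c^\infty(\Omega),$$ where $$W(x)=\prod_{k=1}^mX_1^{\frac{2n-2}{n-2}}\Big(\frac{|x-a_k|}{D}\Big),\qquad D=\max_{k=1,\dots,m}\ \sup_{x\in\Omega}|x-a_k|.$$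
   Context: Exterior ball condition at $a\in\partial\Omega$: there exists an open ball $B\subset\mathbb{R}^n\setminus\overline\Omega$ with $a\in\partial B$. $X_1(t)=\frac1{1-\ln t}$ for $t\in(0,1)$. *)

theory Defs
  imports "HOL-Analysis.Analysis"
begin

definition bounded_domain :: "'a::real_normed_vector set \<Rightarrow> bool" where
  "bounded_domain \<Omega> \<longleftrightarrow> open \<Omega> \<and> connected \<Omega> \<and> \<Omega> \<noteq> {} \<and> bounded \<Omega>"

definition exterior_ball_at :: "'a::real_normed_vector set \<Rightarrow> 'a \<Rightarrow> bool" where
  "exterior_ball_at \<Omega> a \<longleftrightarrow>
     (\<exists>y r. r > 0 \<and> ball y r \<subseteq> - closure \<Omega> \<and> a \<in> frontier (ball y r))"

definition partial_deriv :: "'n::finite \<Rightarrow> (real ^ 'n \<Rightarrow> real) \<Rightarrow> real ^ 'n \<Rightarrow> real" where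
  "partial_deriv i u x = frechet_derivative u (at x) (axis i 1)"

definition gradient :: "(real ^ 'n::finite \<Rightarrow> real) \<Rightarrow> real ^ 'n \<Rightarrow> real ^ 'n" where
  "gradient u x = (\<chi> i. partial_deriv i u x)"

text \<open>In the successor case the explicit differentiability requirement is needed because
  \<^const>\<open>frechet_derivative\<close> is total and takes an unspecified value where no derivative exists.\<close>

primrec C_k :: "nat \<Rightarrow> (real ^ 'n::finite \<Rightarrow> real) \<Rightarrow> bool" where
  "C_k 0 u \<longleftrightarrow> continuous_on UNIV u"
| "C_k (Suc k) u \<longleftrightarrow> (\<forall>x. u differentiable (at x)) \<and> (\<forall>i. C_k k (partial_deriv i u))"

text \<open>Elements of $C_c^\infty(\Omega)$ are represented by their extension by zero to the whole
  space, which is again smooth.\<close>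

definition test_function :: "(real ^ 'n::finite) set \<Rightarrow> (real ^ 'n \<Rightarrow> real) \<Rightarrow> bool" where
  "test_function \<Omega> u \<longleftrightarrow>
     (\<forall>k. C_k k u) \<and> compact (closure {x. u x \<noteq> 0}) \<and> closure {x. u x \<noteq> 0} \<subseteq> \<Omega>"

definition X1 :: "real \<Rightarrow> real" where
  "X1 t = 1 / (1 - ln t)"

definition max_dist :: "nat \<Rightarrow> (nat \<Rightarrow> 'a::metric_space) \<Rightarrow> 'a set \<Rightarrow> real" where
  "max_dist m a \<Omega> = (MAX k\<in>{1..m}. SUP x\<in>\<Omega>. dist x (a k))"

text \<open>For \<open>x\<close> in the bounded open set \<open>\<Omega>\<close> and each \<open>a k\<close> on its boundary, the argument of
  \<^const>\<open>X1\<close> lies strictly between 0 and 1, because the supremum defining \<^const>\<open>max_dist\<close>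
  is not attained in \<open>\<Omega>\<close>.\<close>

definition log_weight :: "nat \<Rightarrow> (nat \<Rightarrow> real ^ 'n::finite) \<Rightarrow> (real ^ 'n) set \<Rightarrow> real ^ 'n \<Rightarrow> real" where
  "log_weight m a \<Omega> x =
     (\<Prod>k=1..m. X1 (norm (x - a k) / max_dist m a \<Omega>)
        powr ((2 * real CARD('n) - 2) / (real CARD('n) - 2)))"

end

theory Submission
  imports Defs
begin

text \<open>Write \<open>\<rho> = |x - a|\<close> and \<open>t = ln (D/\<rho>)\<close>, so that the weight is \<open>X\<^sub>1 = 1/(1 + t)\<close>,
put \<open>p = n/(n-2)\<close>, so that the Sobolev exponent is \<open>2p\<close> and the exponent of \<open>X\<^sub>1\<close> is
\<open>1 + p\<close>, and let \<open>E(v) = \<integral>|\<nabla>v|\<^sup>2 - n\<^sup>2/4 \<integral>v\<^sup>2/\<rho>\<^sup>2\<close>.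

One point. The domain lies outside a ball \<open>B(y,r)\<close> with \<open>a\<close> on its boundary. There
\<open>s = (|x-y|\<^sup>2 - r\<^sup>2)/(2r)\<close> is positive and behaves like the distance to the ball, and
\<open>\<Phi> = s exp(-ns/r) \<rho> powr (-n/2) h(t)\<close> plays the role that
\<open>x\<^sub>n \<rho> powr (-n/2) h(t)\<close> has on a half space: the factor \<open>exp(-ns/r)\<close> outweighs the
curvature of the sphere. For \<open>G = \<nabla>\<Phi>/\<Phi>\<close> the ground state substitution gives
\<open>E(v) = \<integral>|\<nabla>v - vG|\<^sup>2 + \<integral>P v\<^sup>2\<close> with
\<open>P \<ge> (-h''/h)(t)/\<rho>\<^sup>2 - C/\<rho>\<close> (\<open>ground_state_identity\<close>, \<open>exterior_ball_Hardy\<close>). Any positive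
increasing concave \<open>h\<close> with \<open>h'/h \<le> 1\<close> may be chosen. The choice \<open>h = sqrt (1+t)\<close> yields
\<open>P \<ge> X\<^sub>1\<^sup>2/(8\<rho>\<^sup>2)\<close> close to \<open>a\<close>, which also absorbs the curvature error \<open>C/\<rho>\<close>. A choice of \<open>h\<close>
whose curvature sits near \<open>t = \<tau>\<close> yields \<open>\<integral>v\<^sup>2/\<rho>\<^sup>2 \<le> 18 (1+\<tau>) E(v)\<close> over the slab
\<open>|t-\<tau>| \<le> 1\<close> (\<open>exterior_ball_log_Hardy\<close>).

Both bounds are needed for the sharp power of the weight. Cut \<open>v\<close> into pieces \<open>v\<^sub>j\<close> living on the
slabs \<open>|t-j| \<le> 1\<close>. Since the density of \<open>E\<close> is nonnegative, \<open>\<integral>|\<nabla>v\<^sub>j|\<^sup>2 \<le> F\<^sub>j\<close> for a local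
quantity \<open>F\<^sub>j\<close> with \<open>F\<^sub>j \<le> C (1+j) E(v)\<close> and \<open>\<Sum>F\<^sub>j/(1+j)\<^sup>2 \<le> C E(v)\<close>. The Sobolev inequality
on each slab then gives \<open>\<Sum>(1+j) powr (-1-p) F\<^sub>j powr p \<le> (C E) powr (p-1) \<Sum>F\<^sub>j/(1+j)\<^sup>2\<close>, hence a
constant that depends on \<open>n\<close> only; the geometry is confined to the radius of the
neighbourhood of \<open>a\<close> (\<open>exterior_ball_Hardy_Sobolev\<close>).

Several points. Replace \<open>u\<close> by the two parts \<open>u cos \<theta>\<close> and \<open>u sin \<theta>\<close>, whose squares add up to
\<open>u\<^sup>2\<close>, the first one supported near one point and the second one away from it. The sum of the energies of the two parts exceeds that of \<open>u\<close> by
\<open>\<integral>u\<^sup>2|\<nabla>\<theta>|\<^sup>2\<close>, which is at most a multiple of \<open>\<integral>u\<^sup>2\<close>, and so are all interactions with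
the other points. Induction on \<open>m\<close> pays for these terms with \<open>\<lambda>\<close>; each step replaces the constant
by half the smaller of itself and the one-point constant (\<open>multipolar_Hardy_Sobolev\<close>).

The Sobolev inequality itself comes from a Faber--Krahn inequality, proved by comparing \<open>v\<close> with
its translates, applied to truncations of \<open>v\<close> between consecutive dyadic levels.\<close>

section \<open>Continuously differentiable functions with compact support\<close>

text \<open>Only first derivatives of test functions matter, and truncating or cutting off with a
\<open>C\<^sup>1\<close> function stays inside this class. The gradient is an argument, so that no
default value of a derivative operator interferes.\<close>

definition C1c :: "'a::euclidean_space set \<Rightarrow> ('a \<Rightarrow> real) \<Rightarrow> ('a \<Rightarrow> 'a) \<Rightarrow> bool" where
  "C1c U v g \<longleftrightarrow> (\<forall>x. (v has_derivative (\<lambda>h. g x \<bullet> h)) (at x)) \<and> continuous_on UNIV g \<and>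
     (\<exists>K. compact K \<and> K \<subseteq> U \<and> (\<forall>x. x \<notin> K \<longrightarrow> v x = 0))"

lemma C1c_has_derivative: "C1c U v g \<Longrightarrow> (v has_derivative (\<lambda>h. g x \<bullet> h)) (at x)"
  by (simp add: C1c_def)

lemma C1c_continuous:
  assumes "C1c U v g"
  shows "continuous_on S v" "continuous_on S g"
proof -
  have "continuous (at x) v" for x
    using assms has_derivative_continuous unfolding C1c_def by blast
  then show "continuous_on S v"
    using continuous_at_imp_continuous_on by blast
  show "continuous_on S g"
    using assms continuous_on_subset unfolding C1c_def by blast
qed

lemma C1cE:
  assumes "C1c U v g"
  obtains K where "compact K" "K \<subseteq> U" "\<And>x. x \<notin> K \<Longrightarrow> v x = 0" "\<And>x. x \<notin> K \<Longrightarrow> g x = 0"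
proof -
  obtain K where K: "compact K" "K \<subseteq> U" "\<And>x. x \<notin> K \<Longrightarrow> v x = 0"
    using assms unfolding C1c_def by blast
  have "g x = 0" if "x \<notin> K" for x
  proof -
    have op: "open (- K)" using K(1) by (simp add: compact_imp_closed open_Compl)
    have "((\<lambda>_. 0) has_derivative (\<lambda>h. g x \<bullet> h)) (at x)"
      by (rule has_derivative_transform_within_open[OF C1c_has_derivative[OF assms] op])
         (use that K in auto)
    then have "(\<lambda>h. g x \<bullet> h) = (\<lambda>_. 0)"
      using has_derivative_unique[OF _ has_derivative_const] by blast
    then show "g x = 0" by (metis inner_eq_zero_iff)
  qed
  then show ?thesis using that K by blast
qed

lemma C1c_zero_outside:
  assumes "C1c U v g" "x \<notin> U"
  shows "v x = 0" "g x = 0"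
proof -
  obtain K where "K \<subseteq> U" "\<And>x. x \<notin> K \<Longrightarrow> v x = 0" "\<And>x. x \<notin> K \<Longrightarrow> g x = 0"
    using C1cE[OF assms(1)] by metis
  then show "v x = 0" "g x = 0" using assms(2) by blast+
qed

lemma integrable_compact_support:
  fixes f :: "'a::euclidean_space \<Rightarrow> real"
  assumes "compact K" "continuous_on K f" "\<And>x. x \<notin> K \<Longrightarrow> f x = 0"
  shows "integrable lborel f"
proof -
  have "integrable lborel (\<lambda>x. indicator K x *\<^sub>R f x)"
    using assms by (intro borel_integrable_compact) auto
  moreover have "(\<lambda>x. indicator K x *\<^sub>R f x) = f"
  proof
    show "indicator K x *\<^sub>R f x = f x" for x
      using assms(3)[of x] by (cases "x \<in> K") auto
  qed
  ultimately show ?thesis by simp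
qed

lemma C1c_integrable:
  fixes f :: "'a::euclidean_space \<Rightarrow> real"
  assumes "C1c U v g" "continuous_on U f" "\<And>x. v x = 0 \<Longrightarrow> g x = 0 \<Longrightarrow> f x = 0"
  shows "integrable lborel f"
proof -
  obtain K where K: "compact K" "K \<subseteq> U" "\<And>x. x \<notin> K \<Longrightarrow> v x = 0" "\<And>x. x \<notin> K \<Longrightarrow> g x = 0"
    using C1cE[OF assms(1)] by blast
  show ?thesis
    by (rule integrable_compact_support[OF K(1)])
       (use K assms continuous_on_subset in auto)
qed

text \<open>The factor is differentiable on \<open>U\<close> only, as with \<open>1/|x - a|\<close>. Off the support of \<open>v\<close> the
product vanishes identically near each point, whatever values \<open>f\<close> takes there.\<close>

lemma C1c_mult:
  assumes U: "open U" and v: "C1c U v g"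
    and f: "\<And>x. x \<in> U \<Longrightarrow> (f has_derivative (\<lambda>h. f' x \<bullet> h)) (at x)"
    and f': "continuous_on U f'"
  shows "C1c U (\<lambda>x. f x * v x) (\<lambda>x. f x *\<^sub>R g x + v x *\<^sub>R f' x)"
proof -
  obtain K where K: "compact K" "K \<subseteq> U" "\<And>x. x \<notin> K \<Longrightarrow> v x = 0" "\<And>x. x \<notin> K \<Longrightarrow> g x = 0"
    using C1cE[OF v] by blast
  have op: "open (- K)" using K(1) by (simp add: compact_imp_closed open_Compl)
  let ?G = "\<lambda>x. f x *\<^sub>R g x + v x *\<^sub>R f' x"
  have contf: "continuous_on U f"
    using f has_derivative_continuous continuous_at_imp_continuous_on by metis
  have "((\<lambda>x. f x * v x) has_derivative (\<lambda>h. ?G x \<bullet> h)) (at x)" for x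
  proof (cases "x \<in> U")
    case True
    show ?thesis
      by (rule has_derivative_eq_rhs[OF has_derivative_mult[OF f[OF True] C1c_has_derivative[OF v]]])
         (auto simp: inner_add_left)
  next
    case False
    then have x: "x \<in> - K" using K by auto
    have "((\<lambda>_. 0) has_derivative (\<lambda>h. ?G x \<bullet> h)) (at x)"
      using x K by simp
    then show ?thesis
      by (rule has_derivative_transform_within_open[OF _ op x]) (use K in auto)
  qed
  moreover have "continuous_on (U \<union> - K) ?G"
  proof (rule continuous_on_open_Un[OF U op])
    show "continuous_on U ?G"
      by (intro continuous_intros contf f' C1c_continuous[OF v])
    show "continuous_on (- K) ?G"
      by (rule continuous_on_eq[OF continuous_on_const[of _ 0]]) (use K in auto)
  qed
  moreover have "U \<union> - K = UNIV" using K by auto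
  moreover have "\<exists>K. compact K \<and> K \<subseteq> U \<and> (\<forall>x. x \<notin> K \<longrightarrow> f x * v x = 0)"
    using K by (intro exI[of _ K]) auto
  ultimately show ?thesis unfolding C1c_def by metis
qed

lemma C1c_restrict:
  assumes "C1c U v g" "closed F" "\<And>x. x \<notin> F \<Longrightarrow> v x = 0" "U \<inter> F \<subseteq> V"
  shows "C1c V v g"
proof -
  obtain K where K: "compact K" "K \<subseteq> U" "\<And>x. x \<notin> K \<Longrightarrow> v x = 0"
    using assms(1) unfolding C1c_def by blast
  have "compact (K \<inter> F) \<and> K \<inter> F \<subseteq> V \<and> (\<forall>x. x \<notin> K \<inter> F \<longrightarrow> v x = 0)"
    using K assms by (auto intro: compact_Int_closed)
  then show ?thesis using assms(1) unfolding C1c_def by blast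
qed

lemma C1c_Lipschitz:
  assumes "C1c U v g"
  obtains L where "L \<ge> 0" "\<And>x y. \<bar>v y - v x\<bar> \<le> L * norm (y - x)"
proof -
  obtain K where K: "compact K" "\<And>x. x \<notin> K \<Longrightarrow> g x = 0"
    using C1cE[OF assms] by metis
  have "bounded (g ` K)"
    by (intro compact_imp_bounded compact_continuous_image C1c_continuous[OF assms] K)
  then obtain L where L: "L > 0" "\<And>x. x \<in> K \<Longrightarrow> norm (g x) \<le> L"
    unfolding bounded_pos by auto
  have gL: "norm (g x) \<le> L" for x using L K(2)[of x] by (cases "x \<in> K") auto
  have "norm (v y - v x) \<le> L * norm (y - x)" for x y
  proof (rule differentiable_bound[of UNIV])
    show "(v has_derivative (\<lambda>h. g z \<bullet> h)) (at z within UNIV)" for z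
      using C1c_has_derivative[OF assms] by simp
    show "onorm (\<lambda>h. g z \<bullet> h) \<le> L" for z
    proof (rule onorm_le)
      fix h show "norm (g z \<bullet> h) \<le> L * norm h"
        using Cauchy_Schwarz_ineq2[of "g z" h] gL[of z] mult_right_mono[of "norm (g z)" L "norm h"] by simp
    qed
  qed auto
  then show ?thesis using that[of L] L(1) by simp
qed

lemma lborel_integral_dilate:
  fixes f :: "'a::euclidean_space \<Rightarrow> real"
  assumes "s > 0" and [measurable]: "f \<in> borel_measurable borel"
  shows "(\<integral>x. f (c + s *\<^sub>R (x - c)) \<partial>lborel) = (\<integral>x. f x \<partial>lborel) / s ^ DIM('a)"
proof -
  have "(\<integral>x. f x \<partial>lborel) = (\<integral>x. f x \<partial>density (distr lborel borel (\<lambda>x. (c - s *\<^sub>R c) + s *\<^sub>R x)) (\<lambda>_. \<bar>s ^ DIM('a)\<bar>))"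
    using lborel_affine[of s "c - s *\<^sub>R c"] assms(1) by simp
  also have "\<dots> = s ^ DIM('a) * (\<integral>x. f ((c - s *\<^sub>R c) + s *\<^sub>R x) \<partial>lborel)"
    using assms by (subst integral_density) (auto simp: integral_distr)
  finally show ?thesis using assms(1) by (simp add: algebra_simps divide_simps)
qed

lemma lborel_integral_shift:
  fixes f :: "'a::euclidean_space \<Rightarrow> real"
  assumes [measurable]: "f \<in> borel_measurable borel"
  shows "(\<integral>x. f (x + z) \<partial>lborel) = (\<integral>x. f x \<partial>lborel)"
proof -
  have "(\<integral>x. f x \<partial>lborel) = (\<integral>x. f x \<partial>distr lborel borel ((+) z))"
    by (simp add: lborel_distr_plus)
  also have "\<dots> = (\<integral>x. f (x + z) \<partial>lborel)"
    by (subst integral_distr) (auto simp: add.commute)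
  finally show ?thesis by simp
qed

text \<open>Differentiating the scaling law \<open>\<integral>v(c + s(x-c)) dx = s powr (-n) \<integral>v\<close> at \<open>s = 1\<close> gives the divergence
theorem for the field \<open>v(x)(x - c)\<close>. All vector fields below are combinations of such radial
fields with different centres, so this is the only integration by parts in the proof.\<close>

lemma integral_Euler:
  fixes v :: "'a::euclidean_space \<Rightarrow> real"
  assumes v: "C1c U v g"
  shows "(\<integral>x. g x \<bullet> (x - c) + real DIM('a) * v x \<partial>lborel) = 0"
proof -
  obtain K where K: "compact K" "\<And>x. x \<notin> K \<Longrightarrow> v x = 0"
    using C1cE[OF v] by metis
  obtain R where R: "R > 0" "K \<subseteq> cball c R"
    using bounded_subset_ballD[OF compact_imp_bounded[OF K(1)], of c] ball_subset_cball by blast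
  obtain L where L: "L \<ge> 0" "\<And>x y. \<bar>v y - v x\<bar> \<le> L * norm (y - x)"
    using C1c_Lipschitz[OF v] by metis
  have meas[measurable]: "v \<in> borel_measurable borel" "g \<in> borel_measurable borel"
    using C1c_continuous[OF v] by (auto intro: borel_measurable_continuous_onI)
  have intv: "integrable lborel v"
    using C1c_integrable[OF v C1c_continuous(1)[OF v]] by simp
  have intg: "integrable lborel (\<lambda>x. g x \<bullet> (x - c))"
    by (rule C1c_integrable[OF v]) (auto intro!: continuous_intros C1c_continuous[OF v])
  \<comment> \<open>Difference quotients of the dilation; with factors \<open>1 + s k > 1\<close> the dilated functions are
    all supported in the ball that contains the support of \<open>v\<close>, and the Lipschitz bound dominates.\<close>
  define s where "s k = inverse (real (Suc k))" for k
  have s: "s k > 0" for k by (simp add: s_def)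
  have s0: "filterlim s (at 0) sequentially"
    using LIMSEQ_inverse_real_of_nat s unfolding s_def[abs_def]
    by (auto simp: filterlim_at intro!: always_eventually)
  have outside: "c + (1 + s k) *\<^sub>R (x - c) \<notin> cball c R" if "x \<notin> cball c R" for x k
  proof -
    have "norm (x - c) > R" using that by (simp add: dist_norm norm_minus_commute)
    moreover have "norm (x - c) \<le> (1 + s k) * norm (x - c)"
      using s[of k] by (simp add: algebra_simps)
    ultimately show ?thesis using s[of k] by (simp add: dist_norm)
  qed
  define q where "q k x = (v (c + (1 + s k) *\<^sub>R (x - c)) - v x) / s k" for k x
  have int_shift: "integrable lborel (\<lambda>x. v (c + (1 + s k) *\<^sub>R (x - c)))" for k
  proof (rule integrable_compact_support[of "cball c R"])
    show "continuous_on (cball c R) (\<lambda>x. v (c + (1 + s k) *\<^sub>R (x - c)))"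
      by (intro continuous_on_compose2[OF C1c_continuous(1)[OF v, of UNIV]] continuous_intros) auto
    fix x assume "x \<notin> cball c R"
    then show "v (c + (1 + s k) *\<^sub>R (x - c)) = 0" using outside R K by blast
  qed simp
  have "(\<lambda>k. \<integral>x. q k x \<partial>lborel) \<longlonglongrightarrow> (\<integral>x. g x \<bullet> (x - c) \<partial>lborel)"
  proof (rule integral_dominated_convergence)
    show "integrable lborel (\<lambda>x. indicator (cball c R) x *\<^sub>R (L * norm (x - c)))"
      by (intro borel_integrable_compact continuous_intros) auto
    show "AE x in lborel. (\<lambda>k. q k x) \<longlonglongrightarrow> g x \<bullet> (x - c)"
    proof (rule AE_I2)
      fix x
      have "((\<lambda>\<tau>. v (c + (1 + \<tau>) *\<^sub>R (x - c))) has_derivative (\<lambda>h. g x \<bullet> (h *\<^sub>R (x - c)))) (at 0)"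
      proof (rule has_derivative_compose[where f = "\<lambda>\<tau>. c + (1 + \<tau>) *\<^sub>R (x - c)"])
        show "((\<lambda>\<tau>. c + (1 + \<tau>) *\<^sub>R (x - c)) has_derivative (\<lambda>h. h *\<^sub>R (x - c))) (at 0)"
          by (auto intro!: derivative_eq_intros)
        show "(v has_derivative (\<bullet>) (g x)) (at (c + (1 + 0) *\<^sub>R (x - c)))"
          using C1c_has_derivative[OF v, of x] by simp
      qed
      then have "((\<lambda>\<tau>. v (c + (1 + \<tau>) *\<^sub>R (x - c))) has_real_derivative (g x \<bullet> (x - c))) (at 0)"
        unfolding has_field_derivative_def by (simp add: mult.commute[of _ "g x \<bullet> (x - c)"])
      then have "(\<lambda>\<tau>. (v (c + (1 + \<tau>) *\<^sub>R (x - c)) - v x) / \<tau>) \<midarrow>0\<rightarrow> g x \<bullet> (x - c)"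
        unfolding DERIV_def by simp
      then show "(\<lambda>k. q k x) \<longlonglongrightarrow> g x \<bullet> (x - c)"
        unfolding q_def using filterlim_compose[OF _ s0] by fastforce
    qed
    show "AE x in lborel. norm (q k x) \<le> indicator (cball c R) x *\<^sub>R (L * norm (x - c))" for k
    proof (rule AE_I2)
      fix x
      show "norm (q k x) \<le> indicator (cball c R) x *\<^sub>R (L * norm (x - c))"
      proof (cases "x \<in> cball c R")
        case True
        have "\<bar>v (c + (1 + s k) *\<^sub>R (x - c)) - v x\<bar> \<le> L * norm (s k *\<^sub>R (x - c))"
          using L(2)[of "c + (1 + s k) *\<^sub>R (x - c)" x] by (simp add: algebra_simps)
        moreover have "norm (s k *\<^sub>R (x - c)) = s k * norm (x - c)" using s[of k] by simp
        ultimately have "\<bar>v (c + (1 + s k) *\<^sub>R (x - c)) - v x\<bar> \<le> L * (s k * norm (x - c))" by metis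
        then have "\<bar>v (c + (1 + s k) *\<^sub>R (x - c)) - v x\<bar> / s k \<le> L * norm (x - c)"
          using s[of k] by (simp add: pos_divide_le_eq mult_ac)
        then show ?thesis using True s[of k] by (simp add: q_def)
      next
        case False
        then have "v (c + (1 + s k) *\<^sub>R (x - c)) = 0" "v x = 0" using outside[OF False] R K False by blast+
        then show ?thesis using L(1) by (simp add: q_def)
      qed
    qed
  qed (auto simp: q_def)
  moreover have "(\<integral>x. q k x \<partial>lborel) = (\<integral>x. v x \<partial>lborel) * ((1 / (1 + s k) ^ DIM('a) - 1) / s k)" for k
  proof -
    have "(\<integral>x. q k x \<partial>lborel) = ((\<integral>x. v x \<partial>lborel) / (1 + s k) ^ DIM('a) - (\<integral>x. v x \<partial>lborel)) / s k"
      unfolding q_def using int_shift intv lborel_integral_dilate[of "1 + s k" v c] s[of k] by simp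
    then show ?thesis by (simp add: field_simps)
  qed
  moreover have "(\<lambda>k. (\<integral>x. v x \<partial>lborel) * ((1 / (1 + s k) ^ DIM('a) - 1) / s k)) \<longlonglongrightarrow>
      (\<integral>x. v x \<partial>lborel) * (- real DIM('a))"
  proof (rule tendsto_mult_left)
    have "((\<lambda>\<tau>. 1 / (1 + \<tau>) ^ DIM('a)) has_real_derivative - real DIM('a)) (at 0)"
      by (auto intro!: derivative_eq_intros)
    then have "(\<lambda>\<tau>. (1 / (1 + \<tau>) ^ DIM('a) - 1) / \<tau>) \<midarrow>0\<rightarrow> - real DIM('a)"
      unfolding DERIV_def by simp
    then show "(\<lambda>k. (1 / (1 + s k) ^ DIM('a) - 1) / s k) \<longlonglongrightarrow> - real DIM('a)"
      using filterlim_compose[OF _ s0] by fastforce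
  qed
  ultimately have "(\<integral>x. g x \<bullet> (x - c) \<partial>lborel) = (\<integral>x. v x \<partial>lborel) * (- real DIM('a))"
    using LIMSEQ_unique by fastforce
  then show ?thesis using intv intg by simp
qed

section \<open>The Faber--Krahn inequality\<close>

lemma nn_integral_shift:
  fixes f :: "'a::euclidean_space \<Rightarrow> ennreal"
  assumes [measurable]: "f \<in> borel_measurable borel"
  shows "(\<integral>\<^sup>+x. f (x + z) \<partial>lborel) = (\<integral>\<^sup>+x. f x \<partial>lborel)"
proof -
  have "(\<integral>\<^sup>+x. f x \<partial>lborel) = (\<integral>\<^sup>+x. f x \<partial>distr lborel borel ((+) z))"
    by (simp add: lborel_distr_plus)
  also have "\<dots> = (\<integral>\<^sup>+x. f (x + z) \<partial>lborel)"
    by (subst nn_integral_distr) (auto simp: add.commute)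
  finally show ?thesis by simp
qed

text \<open>The fundamental theorem of calculus along the segment from \<open>x\<close> to \<open>x + z\<close>, followed by the
Cauchy--Schwarz inequality on \<open>[0,1]\<close>. The extended nonnegative form is the one to which Tonelli's
theorem applies.\<close>

lemma square_increment_le:
  fixes v :: "'a::euclidean_space \<Rightarrow> real"
  assumes v: "C1c U v g"
  shows "ennreal ((v (x + z) - v x)\<^sup>2) \<le>
    (\<integral>\<^sup>+s. ennreal ((norm z)\<^sup>2 * (norm (g (x + s *\<^sub>R z)))\<^sup>2) * indicator {0..1::real} s \<partial>lborel)"
proof -
  define f where "f s = g (x + s *\<^sub>R z) \<bullet> z" for s
  define m where "m = v (x + z) - v x"
  have contg: "continuous_on UNIV (\<lambda>s. g (x + s *\<^sub>R z))"
    by (intro continuous_on_compose2[OF C1c_continuous(2)[OF v, of UNIV]] continuous_intros) auto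
  have contf: "continuous_on UNIV f"
    unfolding f_def by (intro continuous_intros contg)
  have der: "DERIV (\<lambda>s. v (x + s *\<^sub>R z)) s :> f s" for s
  proof -
    have "((\<lambda>\<tau>. v (x + \<tau> *\<^sub>R z)) has_derivative (\<lambda>h. g (x + s *\<^sub>R z) \<bullet> (h *\<^sub>R z))) (at s)"
      by (rule has_derivative_compose[where f = "\<lambda>\<tau>. x + \<tau> *\<^sub>R z"])
         (auto intro!: derivative_eq_intros C1c_has_derivative[OF v])
    then show ?thesis
      unfolding has_field_derivative_def f_def by (simp add: mult.commute[of _ "_ \<bullet> z"])
  qed
  have intc: "integrable lborel (\<lambda>s. indicator {0..1::real} s *\<^sub>R h s)" if "continuous_on UNIV h" for h :: "real \<Rightarrow> real"
    using that by (intro borel_integrable_compact) (auto intro: continuous_on_subset)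
  have FTC: "(\<integral>s. indicator {0..1::real} s *\<^sub>R f s \<partial>lborel) = m"
  proof -
    have "(\<integral>s. indicator {0..1::real} s *\<^sub>R f s \<partial>lborel) = v (x + 1 *\<^sub>R z) - v (x + 0 *\<^sub>R z)"
      by (rule integral_FTC_Icc)
         (auto intro: has_vector_derivative_at_within continuous_on_subset[OF contf]
            simp: der[unfolded has_real_derivative_iff_has_vector_derivative])
    then show ?thesis by (simp add: m_def)
  qed
  \<comment> \<open>The variance of \<open>f\<close> on \<open>[0,1]\<close> is nonnegative.\<close>
  have "0 \<le> (\<integral>s. indicator {0..1::real} s *\<^sub>R (f s - m)\<^sup>2 \<partial>lborel)"
    by (intro Bochner_Integration.integral_nonneg) auto
  also have "\<dots> = (\<integral>s. indicator {0..1::real} s *\<^sub>R (f s)\<^sup>2 - 2 * m * (indicator {0..1} s *\<^sub>R f s)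
       + indicator {0..1} s *\<^sub>R m\<^sup>2 \<partial>lborel)"
    by (intro Bochner_Integration.integral_cong) (auto simp: power2_eq_square algebra_simps split: split_indicator)
  also have "\<dots> = (\<integral>s. indicator {0..1::real} s *\<^sub>R (f s)\<^sup>2 \<partial>lborel) - 2 * m * m + m\<^sup>2"
  proof -
    have "integrable lborel (\<lambda>s. indicator {0..1::real} s *\<^sub>R (f s)\<^sup>2)"
         "integrable lborel (\<lambda>s. 2 * m * (indicator {0..1::real} s *\<^sub>R f s))"
         "integrable lborel (\<lambda>s. indicator {0..1::real} s *\<^sub>R m\<^sup>2)"
      by (intro integrable_mult_right intc continuous_intros contf)+
    then show ?thesis using FTC by simp
  qed
  finally have "m\<^sup>2 \<le> (\<integral>s. indicator {0..1::real} s *\<^sub>R (f s)\<^sup>2 \<partial>lborel)"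
    by (simp add: power2_eq_square)
  also have "\<dots> \<le> (\<integral>s. indicator {0..1::real} s *\<^sub>R ((norm z)\<^sup>2 * (norm (g (x + s *\<^sub>R z)))\<^sup>2) \<partial>lborel)"
  proof (rule integral_mono)
    fix s
    have "(f s)\<^sup>2 \<le> (norm z)\<^sup>2 * (norm (g (x + s *\<^sub>R z)))\<^sup>2"
      using power_mono[OF Cauchy_Schwarz_ineq2[of "g (x + s *\<^sub>R z)" z], of 2]
      by (simp add: f_def power_mult_distrib mult.commute)
    then show "indicator {0..1::real} s *\<^sub>R (f s)\<^sup>2 \<le> indicator {0..1} s *\<^sub>R ((norm z)\<^sup>2 * (norm (g (x + s *\<^sub>R z)))\<^sup>2)"
      by (auto split: split_indicator)
  qed (intro intc continuous_intros contf contg)+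
  finally have "ennreal (m\<^sup>2) \<le> ennreal (\<integral>s. indicator {0..1::real} s *\<^sub>R ((norm z)\<^sup>2 * (norm (g (x + s *\<^sub>R z)))\<^sup>2) \<partial>lborel)"
    by (intro ennreal_leI)
  also have "\<dots> = (\<integral>\<^sup>+s. ennreal (indicator {0..1::real} s *\<^sub>R ((norm z)\<^sup>2 * (norm (g (x + s *\<^sub>R z)))\<^sup>2)) \<partial>lborel)"
    by (rule nn_integral_eq_integral[symmetric]) (intro intc continuous_intros contg, auto)
  also have "\<dots> = (\<integral>\<^sup>+s. ennreal ((norm z)\<^sup>2 * (norm (g (x + s *\<^sub>R z)))\<^sup>2) * indicator {0..1::real} s \<partial>lborel)"
    by (intro nn_integral_cong) (auto split: split_indicator)
  finally show ?thesis by (simp add: m_def)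
qed

lemma integral_square_increment_le:
  fixes v :: "'a::euclidean_space \<Rightarrow> real"
  assumes v: "C1c U v g"
  shows "(\<integral>x. (v (x + z) - v x)\<^sup>2 \<partial>lborel) \<le> (norm z)\<^sup>2 * (\<integral>x. (norm (g x))\<^sup>2 \<partial>lborel)"
proof -
  have [measurable]: "v \<in> borel_measurable borel" "g \<in> borel_measurable borel"
    using C1c_continuous[OF v] by (auto intro: borel_measurable_continuous_onI)
  have int: "integrable lborel (\<lambda>x. (norm (g x))\<^sup>2)"
    by (rule C1c_integrable[OF v]) (auto intro!: continuous_intros C1c_continuous[OF v])
  define Q where "Q = (\<integral>x. (norm (g x))\<^sup>2 \<partial>lborel)"
  have Q: "(\<integral>\<^sup>+x. ennreal ((norm (g x))\<^sup>2) \<partial>lborel) = ennreal Q" "0 \<le> Q"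
    unfolding Q_def by (auto intro!: nn_integral_eq_integral int)
  have "(\<integral>\<^sup>+x. ennreal ((v (x + z) - v x)\<^sup>2) \<partial>lborel) \<le>
     (\<integral>\<^sup>+x. (\<integral>\<^sup>+s. ennreal ((norm z)\<^sup>2 * (norm (g (x + s *\<^sub>R z)))\<^sup>2) * indicator {0..1::real} s \<partial>lborel) \<partial>lborel)"
    by (intro nn_integral_mono square_increment_le[OF v])
  also have "\<dots> = (\<integral>\<^sup>+s. (\<integral>\<^sup>+x. ennreal ((norm z)\<^sup>2 * (norm (g (x + s *\<^sub>R z)))\<^sup>2) * indicator {0..1::real} s \<partial>lborel) \<partial>lborel)"
    by (rule lborel_pair.Fubini') measurable
  also have "\<dots> = (\<integral>\<^sup>+s. ennreal ((norm z)\<^sup>2 * Q) * indicator {0..1::real} s \<partial>lborel)"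
  proof (rule nn_integral_cong)
    fix s :: real
    have "(\<integral>\<^sup>+x. ennreal ((norm z)\<^sup>2 * (norm (g (x + s *\<^sub>R z)))\<^sup>2) * indicator {0..1::real} s \<partial>lborel)
      = (\<integral>\<^sup>+x. ennreal ((norm z)\<^sup>2) * ennreal ((norm (g (x + s *\<^sub>R z)))\<^sup>2) \<partial>lborel) * indicator {0..1::real} s"
      by (simp add: nn_integral_multc ennreal_mult)
    also have "(\<integral>\<^sup>+x. ennreal ((norm z)\<^sup>2) * ennreal ((norm (g (x + s *\<^sub>R z)))\<^sup>2) \<partial>lborel)
       = ennreal ((norm z)\<^sup>2) * (\<integral>\<^sup>+x. ennreal ((norm (g (x + s *\<^sub>R z)))\<^sup>2) \<partial>lborel)"
      by (rule nn_integral_cmult) measurable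
    also have "(\<integral>\<^sup>+x. ennreal ((norm (g (x + s *\<^sub>R z)))\<^sup>2) \<partial>lborel) = ennreal Q"
      using nn_integral_shift[of "\<lambda>x. ennreal ((norm (g x))\<^sup>2)" "s *\<^sub>R z"] Q(1) by simp
    finally show "(\<integral>\<^sup>+x. ennreal ((norm z)\<^sup>2 * (norm (g (x + s *\<^sub>R z)))\<^sup>2) * indicator {0..1::real} s \<partial>lborel)
      = ennreal ((norm z)\<^sup>2 * Q) * indicator {0..1::real} s" 
      using Q(2) by (simp add: ennreal_mult)
  qed
  also have "\<dots> = ennreal ((norm z)\<^sup>2 * Q)"
    by (simp add: nn_integral_cmult_indicator)
  finally have "(\<integral>\<^sup>+x. ennreal ((v (x + z) - v x)\<^sup>2) \<partial>lborel) \<le> ennreal ((norm z)\<^sup>2 * Q)" .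
  moreover have "(\<integral>x. (v (x + z) - v x)\<^sup>2 \<partial>lborel) = enn2real (\<integral>\<^sup>+x. ennreal ((v (x + z) - v x)\<^sup>2) \<partial>lborel)"
    by (rule integral_eq_nn_integral) auto
  ultimately show ?thesis
    using Q(2) unfolding Q_def[symmetric] by (simp add: enn2real_leI)
qed

lemma integral_abs_square_le:
  fixes v :: "'a::euclidean_space \<Rightarrow> real"
  assumes i1: "integrable lborel v" and i2: "integrable lborel (\<lambda>x. (v x)\<^sup>2)"
    and A: "A \<in> sets borel" "emeasure lborel A < \<infinity>" "\<And>x. x \<notin> A \<Longrightarrow> v x = 0"
  shows "(\<integral>x. \<bar>v x\<bar> \<partial>lborel)\<^sup>2 \<le> measure lborel A * (\<integral>x. (v x)\<^sup>2 \<partial>lborel)"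
proof -
  define W where "W = (\<integral>x. \<bar>v x\<bar> \<partial>lborel)"
  define V where "V = (\<integral>x. (v x)\<^sup>2 \<partial>lborel)"
  define \<alpha> where "\<alpha> = measure lborel A"
  have W: "W \<ge> 0" unfolding W_def by simp
  have quad: "0 \<le> V - 2 * m * W + m\<^sup>2 * \<alpha>" for m
  proof -
    have "0 \<le> (\<integral>x. (\<bar>v x\<bar> - m * indicator A x)\<^sup>2 \<partial>lborel)" by simp
    also have "\<dots> = (\<integral>x. (v x)\<^sup>2 - 2 * m * \<bar>v x\<bar> + m\<^sup>2 * indicator A x \<partial>lborel)"
    proof (intro Bochner_Integration.integral_cong refl)
      fix x show "(\<bar>v x\<bar> - m * indicator A x)\<^sup>2 = (v x)\<^sup>2 - 2 * m * \<bar>v x\<bar> + m\<^sup>2 * indicator A x"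
        using A(3)[of x] by (cases "x \<in> A") (auto simp: power2_eq_square algebra_simps)
    qed
    also have "\<dots> = V - 2 * m * W + m\<^sup>2 * \<alpha>"
    proof -
      have "integrable lborel (\<lambda>x. 2 * m * \<bar>v x\<bar>)" "integrable lborel (\<lambda>x. m\<^sup>2 * indicator A x)"
        using i1 A by (auto intro!: integrable_mult_right integrable_real_indicator)
      then show ?thesis using i2 i1 A by (simp add: V_def W_def \<alpha>_def)
    qed
    finally show ?thesis .
  qed
  have "W\<^sup>2 \<le> \<alpha> * V"
  proof (cases "\<alpha> > 0")
    case True
    have "0 \<le> V - 2 * (W / \<alpha>) * W + (W / \<alpha>)\<^sup>2 * \<alpha>" using quad .
    also have "\<dots> = V - W\<^sup>2 / \<alpha>" using True by (simp add: field_simps power2_eq_square)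
    finally show ?thesis using True by (simp add: field_simps)
  next
    case False
    then have a0: "\<alpha> = 0" unfolding \<alpha>_def using measure_nonneg[of lborel A] by linarith
    have "W = 0"
    proof (rule ccontr)
      assume "W \<noteq> 0"
      then show False using quad[of "(V + 1) / (2 * W)"] a0 by simp
    qed
    then show ?thesis using a0 by simp
  qed
  then show ?thesis unfolding W_def V_def \<alpha>_def .
qed

text \<open>A function with small support is almost orthogonal to most of its translates. Expanding the square,
\<open>2\<integral>v\<^sup>2 = \<integral>(v(x+y) - v(x))\<^sup>2 dx + 2\<integral>v(x) v(x+y) dx\<close>. The first term is at most
\<open>|y|\<^sup>2 \<integral>|\<nabla>v|\<^sup>2\<close>. Averaged over \<open>|y| < R\<close>, the second one is at most \<open>2(\<integral>|v|)\<^sup>2\<close> divided by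
the volume of the ball, and \<open>(\<integral>|v|)\<^sup>2 \<le> |A| \<integral>v\<^sup>2\<close>. When the ball has at least twice
the volume of \<open>A\<close>, half of the left-hand side absorbs it.\<close>

lemma Faber_Krahn:
  fixes v :: "'a::euclidean_space \<Rightarrow> real"
  assumes v: "C1c U v g" and R: "R > 0"
    and A: "A \<in> sets borel" "emeasure lborel A < \<infinity>" "\<And>x. x \<notin> A \<Longrightarrow> v x = 0"
    and vol: "2 * measure lborel A \<le> measure lborel (ball (0::'a) R)"
  shows "(\<integral>x. (v x)\<^sup>2 \<partial>lborel) \<le> R\<^sup>2 * (\<integral>x. (norm (g x))\<^sup>2 \<partial>lborel)"
proof -
  have [measurable]: "v \<in> borel_measurable borel" "g \<in> borel_measurable borel"
    using C1c_continuous[OF v] by (auto intro: borel_measurable_continuous_onI)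
  have i1: "integrable lborel v" and i2: "integrable lborel (\<lambda>x. (v x)\<^sup>2)"
    by (rule C1c_integrable[OF v], auto intro!: continuous_intros C1c_continuous[OF v])+
  have contsh: "continuous_on S (\<lambda>x. v (x + y))" for y S
    by (intro continuous_on_compose2[OF C1c_continuous(1)[OF v, of UNIV]] continuous_intros) auto
  have i3: "integrable lborel (\<lambda>x. v x * v (x + y))" for y
    by (rule C1c_integrable[OF v]) (auto intro!: continuous_intros C1c_continuous[OF v] contsh)
  have i4: "integrable lborel (\<lambda>x. \<bar>v x\<bar> * \<bar>v (x + y)\<bar>)" for y
    using integrable_norm[OF i3[of y]] by (simp add: abs_mult)
  have i5: "integrable lborel (\<lambda>x. (v (x + y))\<^sup>2)" for y
    using i2
    using integrable_distr[of "(+) y" lborel borel "\<lambda>x. (v x)\<^sup>2"] lborel_distr_plus[of y]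
    by (simp add: add.commute)
  define V where "V = (\<integral>x. (v x)\<^sup>2 \<partial>lborel)"
  define Q where "Q = (\<integral>x. (norm (g x))\<^sup>2 \<partial>lborel)"
  define W where "W = (\<integral>x. \<bar>v x\<bar> \<partial>lborel)"
  define M where "M = measure lborel (ball (0::'a) R)"
  have Q: "Q \<ge> 0" and V: "V \<ge> 0" and W: "W \<ge> 0" unfolding Q_def V_def W_def by simp_all
  have M: "M > 0" unfolding M_def using R by (simp add: content_ball_pos)
  define c where "c y = (\<integral>x. \<bar>v x\<bar> * \<bar>v (x + y)\<bar> \<partial>lborel)" for y
  have key: "2 * V - R\<^sup>2 * Q \<le> 2 * c y" if y: "y \<in> ball 0 R" for y
  proof -
    have "(\<integral>x. (v (x + y) - v x)\<^sup>2 \<partial>lborel) = (\<integral>x. (v (x + y))\<^sup>2 + (v x)\<^sup>2 - 2 * (v x * v (x + y)) \<partial>lborel)"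
      by (intro Bochner_Integration.integral_cong) (auto simp: power2_eq_square algebra_simps)
    also have "\<dots> = (\<integral>x. (v (x + y))\<^sup>2 \<partial>lborel) + V - 2 * (\<integral>x. v x * v (x + y) \<partial>lborel)"
      using i2 i3[of y] i5[of y] by (simp add: V_def)
    also have "(\<integral>x. (v (x + y))\<^sup>2 \<partial>lborel) = V"
      unfolding V_def by (rule lborel_integral_shift) simp
    finally have "2 * V = (\<integral>x. (v (x + y) - v x)\<^sup>2 \<partial>lborel) + 2 * (\<integral>x. v x * v (x + y) \<partial>lborel)" by simp
    also have "\<dots> \<le> (norm y)\<^sup>2 * Q + 2 * c y"
    proof -
      have "(\<integral>x. v x * v (x + y) \<partial>lborel) \<le> c y"
        unfolding c_def by (rule integral_mono[OF i3 i4]) (metis abs_ge_self abs_mult)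
      then show ?thesis using integral_square_increment_le[OF v, of y] by (simp add: Q_def)
    qed
    also have "(norm y)\<^sup>2 * Q \<le> R\<^sup>2 * Q"
      using y by (intro mult_right_mono power_mono Q) auto
    finally show ?thesis by simp
  qed
  have cnn: "ennreal (c y) = (\<integral>\<^sup>+x. ennreal \<bar>v x\<bar> * ennreal \<bar>v (x + y)\<bar> \<partial>lborel)" for y
    unfolding c_def by (subst nn_integral_eq_integral[OF i4, symmetric]) (auto simp: ennreal_mult)
  have Wnn: "(\<integral>\<^sup>+x. ennreal \<bar>v x\<bar> \<partial>lborel) = ennreal W"
    unfolding W_def using i1 by (intro nn_integral_eq_integral) auto
  have "ennreal (2 * V - R\<^sup>2 * Q) * ennreal M = (\<integral>\<^sup>+y. ennreal (2 * V - R\<^sup>2 * Q) * indicator (ball (0::'a) R) y \<partial>lborel)"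
    using emeasure_eq_ennreal_measure[of lborel "ball (0::'a) R"] emeasure_lborel_ball_finite[of "0::'a" R]
    by (simp add: nn_integral_cmult_indicator M_def less_top)
  also have "\<dots> \<le> (\<integral>\<^sup>+y. 2 * ennreal (c y) \<partial>lborel)"
  proof (rule nn_integral_mono)
    fix y :: 'a
    have "ennreal (2 * V - R\<^sup>2 * Q) \<le> ennreal (2 * c y)" if "y \<in> ball 0 R" 
      using key[OF that] by (rule ennreal_leI)
    then show "ennreal (2 * V - R\<^sup>2 * Q) * indicator (ball 0 R) y \<le> 2 * ennreal (c y)"
      by (auto split: split_indicator simp: ennreal_mult')
  qed
  also have "\<dots> = (\<integral>\<^sup>+y. 2 * (\<integral>\<^sup>+x. ennreal \<bar>v x\<bar> * ennreal \<bar>v (x + y)\<bar> \<partial>lborel) \<partial>lborel)"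
    by (simp add: cnn)
  also have "\<dots> = 2 * (\<integral>\<^sup>+y. (\<integral>\<^sup>+x. ennreal \<bar>v x\<bar> * ennreal \<bar>v (x + y)\<bar> \<partial>lborel) \<partial>lborel)"
    by (rule nn_integral_cmult) measurable
  also have "(\<integral>\<^sup>+y. (\<integral>\<^sup>+x. ennreal \<bar>v x\<bar> * ennreal \<bar>v (x + y)\<bar> \<partial>lborel) \<partial>lborel)
     = (\<integral>\<^sup>+x. (\<integral>\<^sup>+y. ennreal \<bar>v x\<bar> * ennreal \<bar>v (x + y)\<bar> \<partial>lborel) \<partial>lborel)"
    by (rule lborel_pair.Fubini') measurable
  also have "\<dots> = (\<integral>\<^sup>+x. ennreal \<bar>v x\<bar> * ennreal W \<partial>lborel)"
  proof (rule nn_integral_cong)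
    fix x :: 'a
    have "(\<integral>\<^sup>+y. ennreal \<bar>v (x + y)\<bar> \<partial>lborel) = ennreal W"
      using nn_integral_shift[of "\<lambda>x. ennreal \<bar>v x\<bar>" x] Wnn by (simp add: add.commute)
    then show "(\<integral>\<^sup>+y. ennreal \<bar>v x\<bar> * ennreal \<bar>v (x + y)\<bar> \<partial>lborel) = ennreal \<bar>v x\<bar> * ennreal W"
      by (subst nn_integral_cmult) auto
  qed
  also have "\<dots> = ennreal W * ennreal W"
    by (subst nn_integral_multc) (auto simp: Wnn)
  finally have *: "ennreal (2 * V - R\<^sup>2 * Q) * ennreal M \<le> 2 * (ennreal W * ennreal W)" .
  have "(2 * V - R\<^sup>2 * Q) * M \<le> 2 * W\<^sup>2"
  proof (cases "2 * V - R\<^sup>2 * Q \<ge> 0")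
    case True
    then have "ennreal ((2 * V - R\<^sup>2 * Q) * M) \<le> ennreal (2 * W\<^sup>2)"
      using * M W by (simp add: ennreal_mult' power2_eq_square)
    then show ?thesis by (subst (asm) ennreal_le_iff) auto
  next
    case False
    then have "(2 * V - R\<^sup>2 * Q) * M \<le> 0" using M by (simp add: mult_le_0_iff)
    then show ?thesis using zero_le_power2[of W] by linarith
  qed
  also have "\<dots> \<le> 2 * (measure lborel A * V)"
    using integral_abs_square_le[OF i1 i2 A] by (simp add: V_def W_def)
  also have "\<dots> \<le> M * V"
    using mult_right_mono[OF vol V] by (simp add: M_def)
  finally have "(V - R\<^sup>2 * Q) * M \<le> 0" by (simp add: algebra_simps)
  then show ?thesis using M by (simp add: mult_le_0_iff V_def Q_def)
qed

section \<open>The Sobolev inequality by truncation\<close>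

text \<open>The square of the positive part is \<open>C\<^sup>1\<close>; quadratic splines built from it serve as cut-offs.\<close>

lemma DERIV_positive_part_square:
  "((\<lambda>y::real. (max 0 y)\<^sup>2) has_real_derivative 2 * max 0 y) (at y)"
proof -
  consider "y > 0" | "y < 0" | "y = 0" by linarith
  then show ?thesis
  proof cases
    case 1
    have "((\<lambda>y::real. y\<^sup>2) has_real_derivative 2 * max 0 y) (at y)"
      using 1 by (auto intro!: derivative_eq_intros)
    then show ?thesis
      by (rule has_field_derivative_transform_within[of _ _ _ _ y]) (use 1 in \<open>auto simp: dist_real_def max_def\<close>)
  next
    case 2
    have "((\<lambda>y::real. 0) has_real_derivative 2 * max 0 y) (at y)"
      using 2 by (auto intro!: derivative_eq_intros)
    then show ?thesis
      by (rule has_field_derivative_transform_within[of _ _ _ _ "- y"]) (use 2 in \<open>auto simp: dist_real_def max_def\<close>)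
  next
    case 3
    have "((\<lambda>h::real. (max 0 h)\<^sup>2 / h) \<longlongrightarrow> 0) (at 0)"
    proof (rule tendsto_rabs_zero_cancel, rule tendsto_sandwich[of "\<lambda>_. 0" _ _ "\<lambda>h. \<bar>h\<bar>"])
      show "\<forall>\<^sub>F h in at 0. \<bar>(max 0 h)\<^sup>2 / h\<bar> \<le> \<bar>h::real\<bar>"
        by (rule always_eventually) (auto simp: max_def power2_eq_square)
      show "((\<lambda>h::real. \<bar>h\<bar>) \<longlongrightarrow> 0) (at 0)" by (intro tendsto_rabs_zero tendsto_ident_at)
    qed auto
    then show ?thesis using 3 by (simp add: DERIV_def)
  qed
qed

text \<open>The \<open>C\<^sup>1\<close> quadratic spline with knots \<open>1, 3/2, 2\<close> that rises from \<open>0\<close> to \<open>1\<close>.\<close>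

definition smooth_step :: "real \<Rightarrow> real" where
  "smooth_step s = 2 * (max 0 (s - 1))\<^sup>2 - 4 * (max 0 (s - 3/2))\<^sup>2 + 2 * (max 0 (s - 2))\<^sup>2"

definition smooth_step' :: "real \<Rightarrow> real" where
  "smooth_step' s = 4 * max 0 (s - 1) - 8 * max 0 (s - 3/2) + 4 * max 0 (s - 2)"

lemma DERIV_smooth_step: "(smooth_step has_real_derivative smooth_step' s) (at s)"
proof -
  have *: "((\<lambda>s. (max 0 (s - c))\<^sup>2) has_real_derivative 2 * max 0 (s - c)) (at s)" for c :: real
  proof -
    have "((\<lambda>s. s - c) has_real_derivative 1) (at s)" by (auto intro!: derivative_eq_intros)
    from DERIV_chain2[where f = "\<lambda>y. (max 0 y)\<^sup>2" and g = "\<lambda>s. s - c", OF DERIV_positive_part_square this]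
    show ?thesis by simp
  qed
  show ?thesis
    unfolding smooth_step_def[abs_def] smooth_step'_def
    by (rule derivative_eq_intros * | simp)+
qed

lemma continuous_on_smooth_step': "continuous_on S smooth_step'"
  unfolding smooth_step'_def[abs_def] by (intro continuous_intros)

lemma smooth_step_eq_0: "s \<le> 1 \<Longrightarrow> smooth_step s = 0"
  by (simp add: smooth_step_def max_def)

lemma smooth_step_eq_1: "s \<ge> 2 \<Longrightarrow> smooth_step s = 1"
  by (simp add: smooth_step_def max_def power2_eq_square algebra_simps)

lemma smooth_step'_eq_0: "s \<le> 1 \<or> s \<ge> 2 \<Longrightarrow> smooth_step' s = 0"
  by (auto simp: smooth_step'_def max_def)

lemma smooth_step'_bounds: "0 \<le> smooth_step' s" "smooth_step' s \<le> 2"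
  by (auto simp: smooth_step'_def max_def)

lemma smooth_step_bounds: "0 \<le> smooth_step s" "smooth_step s \<le> 1"
proof -
  have mono: "smooth_step a \<le> smooth_step b" if "a \<le> b" for a b
    using DERIV_nonneg_imp_nondecreasing[OF that] DERIV_smooth_step smooth_step'_bounds(1) by blast
  show "0 \<le> smooth_step s"
    using mono[of "min s 1" s] smooth_step_eq_0[of "min s 1"] by simp
  show "smooth_step s \<le> 1"
    using mono[of s "max s 2"] smooth_step_eq_1[of "max s 2"] by simp
qed

lemma C1c_compose:
  assumes v: "C1c U v g" and \<phi>: "\<And>t. (\<phi> has_real_derivative \<phi>' t) (at t)"
    and cont: "continuous_on UNIV \<phi>'" and 0: "\<phi> 0 = 0"
  shows "C1c U (\<lambda>x. \<phi> (v x)) (\<lambda>x. \<phi>' (v x) *\<^sub>R g x)"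
proof -
  have "((\<lambda>x. \<phi> (v x)) has_derivative (\<lambda>h. (\<phi>' (v x) *\<^sub>R g x) \<bullet> h)) (at x)" for x
    using has_derivative_compose[OF C1c_has_derivative[OF v] \<phi>[unfolded has_field_derivative_def]] by simp
  moreover have "continuous_on UNIV (\<lambda>x. \<phi>' (v x) *\<^sub>R g x)"
    by (intro continuous_intros C1c_continuous[OF v] continuous_on_compose2[OF cont C1c_continuous(1)[OF v]]) auto
  moreover obtain K where "compact K" "K \<subseteq> U" "\<forall>x. x \<notin> K \<longrightarrow> v x = 0"
    using v unfolding C1c_def by blast
  ultimately show ?thesis unfolding C1c_def using 0 by metis
qed

text \<open>Truncate \<open>v\<^sup>2\<close> between the levels \<open>l\<close> and \<open>2l\<close>: the truncation equals \<open>1\<close> where \<open>v\<^sup>2 \<ge> 2l\<close>, is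
supported where \<open>v\<^sup>2 > l\<close>, and its gradient lives between the two levels. The Faber--Krahn
inequality for the truncation is thus an estimate of one superlevel set by the next larger one.\<close>

lemma superlevel_measure_step:
  fixes v :: "'a::euclidean_space \<Rightarrow> real"
  assumes v: "C1c U v g" and l: "l > 0"
  shows "measure lborel {x. 2 * l < (v x)\<^sup>2} \<le>
    (2 * measure lborel {x. l < (v x)\<^sup>2} / unit_ball_vol DIM('a)) powr (2 / DIM('a)) * (32 / l) *
      (\<integral>x. (norm (g x))\<^sup>2 * indicator {x. l < (v x)\<^sup>2 \<and> (v x)\<^sup>2 < 2 * l} x \<partial>lborel)"
proof -
  have [measurable]: "v \<in> borel_measurable borel" "g \<in> borel_measurable borel"
    using C1c_continuous[OF v] by (auto intro: borel_measurable_continuous_onI)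
  let ?n = "DIM('a)"
  define A where "A k = {x. k < (v x)\<^sup>2}" for k
  define \<beta> where "\<beta> = unit_ball_vol ?n"
  have \<beta>: "\<beta> > 0" unfolding \<beta>_def by simp
  obtain K where K: "compact K" "\<And>x. x \<notin> K \<Longrightarrow> v x = 0"
    using C1cE[OF v] by metis
  have A_meas[measurable]: "A k \<in> sets borel" for k unfolding A_def by simp
  have A_fin: "emeasure lborel (A k) < \<infinity>" if "k > 0" for k
  proof -
    have "A k \<subseteq> K" using that K(2) unfolding A_def by force
    then have "emeasure lborel (A k) \<le> emeasure lborel K"
      using K(1) by (intro emeasure_mono) (auto simp: compact_imp_closed)
    also have "\<dots> < \<infinity>" using K(1) by (rule emeasure_compact_finite)
    finally show ?thesis .
  qed
  define \<alpha> where "\<alpha> = measure lborel (A l)"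
  define Il where "Il = (\<integral>x. (norm (g x))\<^sup>2 * indicator {x. l < (v x)\<^sup>2 \<and> (v x)\<^sup>2 < 2 * l} x \<partial>lborel)"
  have int_g: "integrable lborel (\<lambda>x. (norm (g x))\<^sup>2)"
    by (rule C1c_integrable[OF v]) (auto intro!: continuous_intros C1c_continuous[OF v])
  have int_gl: "integrable lborel (\<lambda>x. (norm (g x))\<^sup>2 * indicator {x. l < (v x)\<^sup>2 \<and> (v x)\<^sup>2 < 2 * l} x)"
    by (rule Bochner_Integration.integrable_bound[OF int_g]) (auto split: split_indicator)
  have "measure lborel (A (2 * l)) \<le> (2 * \<alpha> / \<beta>) powr (2 / ?n) * (32 / l) * Il"
  proof (cases "\<alpha> = 0")
    case True
    have "measure lborel (A (2 * l)) \<le> \<alpha>"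
      unfolding \<alpha>_def using l A_fin[OF l]
      by (intro measure_mono_fmeasurable) (auto simp: A_def fmeasurable_def)
    then show ?thesis using True by simp
  next
    case False
    then have \<alpha>: "\<alpha> > 0" unfolding \<alpha>_def using measure_nonneg[of lborel "A l"] by linarith
    \<comment> \<open>The ball of radius \<open>R\<close> has exactly twice the volume of the superlevel set.\<close>
    define R where "R = (2 * \<alpha> / \<beta>) powr (1 / ?n)"
    have R: "R > 0" unfolding R_def using \<alpha> \<beta> by simp
    have Rn: "R ^ ?n = 2 * \<alpha> / \<beta>" 
      unfolding R_def using \<alpha> \<beta> by (simp add: powr_realpow[symmetric] powr_powr)
    have R2: "R\<^sup>2 = (2 * \<alpha> / \<beta>) powr (2 / ?n)"
      unfolding R_def using \<alpha> \<beta> by (simp add: powr_realpow[symmetric] powr_powr)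
    define \<phi> where "\<phi> t = smooth_step (t\<^sup>2 / l)" for t
    define \<phi>' where "\<phi>' t = smooth_step' (t\<^sup>2 / l) * (2 * t / l)" for t
    have C: "C1c U (\<lambda>x. \<phi> (v x)) (\<lambda>x. \<phi>' (v x) *\<^sub>R g x)"
    proof (rule C1c_compose[OF v])
      show "(\<phi> has_real_derivative \<phi>' t) (at t)" for t
        unfolding \<phi>_def[abs_def] \<phi>'_def
        by (rule DERIV_chain2[OF DERIV_smooth_step]) (auto intro!: derivative_eq_intros simp: l less_imp_neq[OF l, symmetric])
      show "continuous_on UNIV \<phi>'" 
        unfolding \<phi>'_def[abs_def] using l
        by (intro continuous_intros continuous_on_compose2[OF continuous_on_smooth_step'[of UNIV]]) auto
      show "\<phi> 0 = 0" by (simp add: \<phi>_def smooth_step_eq_0)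
    qed
    have meas_le: "measure lborel (A (2 * l)) \<le> (\<integral>x. (\<phi> (v x))\<^sup>2 \<partial>lborel)"
    proof -
      have "measure lborel (A (2 * l)) = (\<integral>x. indicator (A (2 * l)) x \<partial>lborel)" by simp
      also have "\<dots> \<le> (\<integral>x. (\<phi> (v x))\<^sup>2 \<partial>lborel)"
      proof (rule integral_mono)
        show "integrable lborel (indicator (A (2 * l)) :: _ \<Rightarrow> real)"
          using A_fin[of "2 * l"] l by (intro integrable_real_indicator) auto
        show "integrable lborel (\<lambda>x. (\<phi> (v x))\<^sup>2)"
          by (rule C1c_integrable[OF C]) (auto intro!: continuous_on_power continuous_on_norm C1c_continuous[OF C])
        show "indicator (A (2 * l)) x \<le> (\<phi> (v x))\<^sup>2" for x
          using l by (auto simp: A_def \<phi>_def smooth_step_eq_1 field_simps split: split_indicator)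
      qed
      finally show ?thesis .
    qed
    also have "\<dots> \<le> R\<^sup>2 * (\<integral>x. (norm (\<phi>' (v x) *\<^sub>R g x))\<^sup>2 \<partial>lborel)"
    proof (rule Faber_Krahn[OF C R, of "A l"])
      show "\<phi> (v x) = 0" if "x \<notin> A l" for x
        using that l by (auto simp: A_def \<phi>_def intro!: smooth_step_eq_0)
      show "2 * measure lborel (A l) \<le> measure lborel (ball (0::'a) R)"
        using Rn R \<beta> by (simp add: content_ball \<alpha>_def[symmetric] \<beta>_def[symmetric])
    qed (use A_fin[OF l] in auto)
    also have "(\<integral>x. (norm (\<phi>' (v x) *\<^sub>R g x))\<^sup>2 \<partial>lborel) \<le> (\<integral>x. 32 / l * ((norm (g x))\<^sup>2 * indicator {x. l < (v x)\<^sup>2 \<and> (v x)\<^sup>2 < 2 * l} x) \<partial>lborel)"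
    proof (rule integral_mono)
      show "integrable lborel (\<lambda>x. (norm (\<phi>' (v x) *\<^sub>R g x))\<^sup>2)"
        by (rule C1c_integrable[OF C], intro continuous_on_power continuous_on_norm C1c_continuous[OF C])
           simp
      show "integrable lborel (\<lambda>x. 32 / l * ((norm (g x))\<^sup>2 * indicator {x. l < (v x)\<^sup>2 \<and> (v x)\<^sup>2 < 2 * l} x))"
        by (intro integrable_mult_right int_gl)
      fix x
      show "(norm (\<phi>' (v x) *\<^sub>R g x))\<^sup>2 \<le> 32 / l * ((norm (g x))\<^sup>2 * indicator {x. l < (v x)\<^sup>2 \<and> (v x)\<^sup>2 < 2 * l} x)"
      proof (cases "l < (v x)\<^sup>2 \<and> (v x)\<^sup>2 < 2 * l")
        case True
        have "(\<phi>' (v x))\<^sup>2 = (smooth_step' ((v x)\<^sup>2 / l))\<^sup>2 * (4 * (v x)\<^sup>2 / l\<^sup>2)"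
          by (simp add: \<phi>'_def power_mult_distrib power_divide)
        also have "\<dots> \<le> 2\<^sup>2 * (4 * (2 * l) / l\<^sup>2)"
          using True l smooth_step'_bounds by (intro mult_mono power_mono divide_right_mono) auto
        also have "\<dots> = 32 / l" using l by (simp add: power2_eq_square)
        finally have "(\<phi>' (v x))\<^sup>2 * (norm (g x))\<^sup>2 \<le> 32 / l * (norm (g x))\<^sup>2"
          by (rule mult_right_mono) simp
        then show ?thesis using True by (simp add: power_mult_distrib)
      next
        case False
        then have "(v x)\<^sup>2 / l \<le> 1 \<or> (v x)\<^sup>2 / l \<ge> 2" using l by (auto simp: field_simps)
        then have "\<phi>' (v x) = 0" by (simp add: \<phi>'_def smooth_step'_eq_0)
        then show ?thesis by (simp add: l less_imp_le)
      qed
    qed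
    also have "\<dots> = 32 / l * Il" unfolding Il_def by simp
    finally show ?thesis using R2 by (simp add: mult_left_mono mult.assoc)
  qed
  then show ?thesis unfolding A_def \<alpha>_def \<beta>_def Il_def .
qed

text \<open>Absorption: either \<open>B \<le> 2b\<close>, or the sublinear term is more than half of \<open>B\<close> and can be divided
out.\<close>

lemma powr_self_bound:
  fixes B b C Q \<theta> p :: real
  assumes "B \<ge> 0" "b \<ge> 0" "p > 0" "\<theta> + 1 / p = 1" and le: "B \<le> b + Q * B powr \<theta>"
  shows "B \<le> 2 * b + (2 * Q) powr p"
proof (cases "B \<le> 2 * b")
  case True
  then show ?thesis by (simp add: add_increasing2)
next
  case False
  then have B: "B > 0" using assms by linarith
  have "B powr \<theta> * B powr (1 / p) = B" using B assms(4) by (simp add: powr_add[symmetric])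
  moreover have "B < 2 * (Q * B powr \<theta>)" using False le by linarith
  ultimately have "B powr \<theta> * B powr (1 / p) < B powr \<theta> * (2 * Q)" by (simp add: mult_ac)
  then have "B powr (1 / p) < 2 * Q" using B by simp
  then have "(B powr (1 / p)) powr p \<le> (2 * Q) powr p"
    using assms by (intro powr_mono2) auto
  then show ?thesis using B assms by (simp add: powr_powr)
qed

lemma abs_powr_double: "\<bar>x::real\<bar> powr (2 * p) = (x\<^sup>2) powr p"
  by (cases "x = 0") (auto simp: powr_powr[symmetric])

lemma powr_double_continuous:
  assumes "C1c U v g" "p > 0"
  shows "continuous_on S (\<lambda>x. \<bar>v x\<bar> powr p)"
  using assms by (intro continuous_on_powr' continuous_intros C1c_continuous[OF assms(1)]) auto

text \<open>Maz'ya's truncation argument. With dyadic levels \<open>lev i\<close> and \<open>b i = lev i powr p * |{v\<^sup>2 > lev i}|\<close>,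
the quantity to be bounded is comparable with \<open>B = \<Sum>b i\<close>. The previous step reads
\<open>b i \<le> C b (i+1) powr (2/n) q (i+1)\<close>, where \<open>q i\<close> is the energy between two levels. The energies add
up to at most \<open>Q = \<integral>|\<nabla>v|\<^sup>2\<close>, so \<open>B \<le> b N + C B powr (2/n) Q\<close>, and \<open>1 - 2/n = 1/p\<close> gives
\<open>B \<le> 2 b N + (2 C Q) powr p\<close>. The lowest level contributes \<open>b N\<close>, which tends to \<open>0\<close> because the
support has finite measure.\<close>

theorem Sobolev:
  fixes p :: real
  assumes n3: "DIM('a::euclidean_space) \<ge> 3" and p: "p = real DIM('a) / (real DIM('a) - 2)"
  shows "\<exists>S>0. \<forall>U (v :: 'a \<Rightarrow> real) g. C1c U v g \<longrightarrow>
    (\<integral>x. \<bar>v x\<bar> powr (2 * p) \<partial>lborel) \<le> (S * (\<integral>x. (norm (g x))\<^sup>2 \<partial>lborel)) powr p"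
proof -
  let ?n = "real DIM('a)"
  have n: "?n \<ge> 3" using n3 by simp
  have p1: "p > 1" using n unfolding p by (simp add: field_simps)
  define \<theta> where "\<theta> = 2 / ?n"
  have \<theta>: "\<theta> + 1 / p = 1" "p * \<theta> = p - 1" "\<theta> > 0"
    using n unfolding p \<theta>_def by (simp_all add: field_simps)
  define \<beta> where "\<beta> = unit_ball_vol ?n"
  have \<beta>: "\<beta> > 0" unfolding \<beta>_def by simp
  define C where "C = 2 powr p * (2 / \<beta>) powr \<theta> * 32"
  have C: "C > 0" unfolding C_def using \<beta> by simp
  have "(\<integral>x. \<bar>v x\<bar> powr (2 * p) \<partial>lborel) \<le> (4 * C * (\<integral>x. (norm (g x))\<^sup>2 \<partial>lborel)) powr p"
    if v: "C1c U v g" for U and v :: "'a \<Rightarrow> real" and g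
  proof -
    have [measurable]: "v \<in> borel_measurable borel" "g \<in> borel_measurable borel"
      using C1c_continuous[OF v] by (auto intro: borel_measurable_continuous_onI)
    obtain K where K: "compact K" "\<And>x. x \<notin> K \<Longrightarrow> v x = 0"
      using C1cE[OF v] by metis
    have [measurable]: "K \<in> sets borel" using K(1) by (simp add: compact_imp_closed)
    have K_fin: "emeasure lborel K < \<infinity>" using K(1) by (rule emeasure_compact_finite)
    have "bounded ((\<lambda>x. (v x)\<^sup>2) ` K)"
      by (intro compact_imp_bounded compact_continuous_image continuous_intros C1c_continuous[OF v] K)
    then obtain L where L: "L > 0" "\<And>x. x \<in> K \<Longrightarrow> (v x)\<^sup>2 \<le> L"
      unfolding bounded_pos by auto
    have vL: "(v x)\<^sup>2 \<le> L" for x using L K(2)[of x] by (cases "x \<in> K") auto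
    \<comment> \<open>Levels descend from an upper bound of \<open>v\<^sup>2\<close>, so the top superlevel set is empty.\<close>
    define lev where "lev i = L / 2 ^ i" for i :: nat
    have lev: "lev i > 0" "lev i = 2 * lev (Suc i)" for i using L(1) by (simp_all add: lev_def)
    have lev_mono: "lev j \<le> lev i" if "i \<le> j" for i j
      using that L(1) by (auto simp: lev_def intro!: divide_left_mono power_increasing)
    define A where "A i = {x. lev i < (v x)\<^sup>2}" for i
    define E where "E i = {x. lev i < (v x)\<^sup>2 \<and> (v x)\<^sup>2 < 2 * lev i}" for i
    have [measurable]: "A i \<in> sets borel" "E i \<in> sets borel" for i unfolding A_def E_def by simp_all
    have AK: "A i \<subseteq> K" for i
    proof
      fix x assume "x \<in> A i"
      then have "v x \<noteq> 0" using lev(1)[of i] by (auto simp: A_def)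
      then show "x \<in> K" using K(2) by blast
    qed
    have fin: "emeasure lborel (A i) < \<infinity>" for i
      using emeasure_mono[OF AK[of i], of lborel] K_fin by (simp add: order.strict_trans1)
    define b where "b i = lev i powr p * measure lborel (A i)" for i
    have b0: "b i \<ge> 0" for i unfolding b_def by simp
    have b_le: "b i \<le> lev i powr p * measure lborel K" for i
      unfolding b_def using AK K_fin
      by (intro mult_left_mono measure_mono_fmeasurable) (auto simp: fmeasurable_def)
    have int_g: "integrable lborel (\<lambda>x. (norm (g x))\<^sup>2)"
      by (rule C1c_integrable[OF v]) (auto intro!: continuous_intros C1c_continuous[OF v])
    define q where "q i = (\<integral>x. (norm (g x))\<^sup>2 * indicator (E i) x \<partial>lborel)" for i
    have int_q: "integrable lborel (\<lambda>x. (norm (g x))\<^sup>2 * indicator (E i) x)" for i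
      by (rule Bochner_Integration.integrable_bound[OF int_g]) (auto split: split_indicator)
    have q0: "q i \<ge> 0" for i unfolding q_def by simp
    define Q where "Q = (\<integral>x. (norm (g x))\<^sup>2 \<partial>lborel)"
    have Q0: "Q \<ge> 0" unfolding Q_def by simp
    have sum_q: "(\<Sum>i\<in>I. q i) \<le> Q" if "finite I" for I
    proof -
      have disj: "disjoint_family_on E I"
      proof -
        have "E i \<inter> E j = {}" if "i < j" for i j
          using lev_mono[of "Suc i" j] lev(2)[of i] that unfolding E_def by auto
        then show ?thesis unfolding disjoint_family_on_def by (metis inf_commute linorder_neqE_nat)
      qed
      have "(\<Sum>i\<in>I. q i) = (\<integral>x. (\<Sum>i\<in>I. (norm (g x))\<^sup>2 * indicator (E i) x) \<partial>lborel)"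
        unfolding q_def by (rule Bochner_Integration.integral_sum[symmetric]) (rule int_q)
      also have "\<dots> \<le> Q" unfolding Q_def
      proof (rule integral_mono)
        show "integrable lborel (\<lambda>x. \<Sum>i\<in>I. (norm (g x))\<^sup>2 * indicator (E i) x)"
          by (intro Bochner_Integration.integrable_sum int_q)
        fix x
        have "(\<Sum>i\<in>I. indicator (E i) x) = (indicator (\<Union>(E ` I)) x :: real)"
          by (rule indicator_UN_disjoint[symmetric]) fact+
        also have "\<dots> \<le> 1" by (auto split: split_indicator)
        finally show "(\<Sum>i\<in>I. (norm (g x))\<^sup>2 * indicator (E i) x) \<le> (norm (g x))\<^sup>2"
          using mult_left_mono[of _ 1 "(norm (g x))\<^sup>2"] by (simp add: sum_distrib_left[symmetric])
      qed (rule int_g)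
      finally show ?thesis .
    qed
    have b_step: "b i \<le> C * (b (Suc i) powr \<theta> * q (Suc i))" for i
    proof -
      let ?l = "lev (Suc i)" and ?m = "measure lborel (A (Suc i))"
      have l: "?l > 0" by (rule lev)
      have "measure lborel (A i) \<le> (2 * ?m / \<beta>) powr \<theta> * (32 / ?l) * q (Suc i)"
        using superlevel_measure_step[OF v l] unfolding A_def \<beta>_def \<theta>_def q_def E_def lev(2)[of i] by simp
      then have "b i \<le> (2 * ?l) powr p * ((2 * ?m / \<beta>) powr \<theta> * (32 / ?l) * q (Suc i))"
        unfolding b_def lev(2)[of i] by (rule mult_left_mono) simp
      also have "(2 * ?m / \<beta>) powr \<theta> = (2 / \<beta>) powr \<theta> * ?m powr \<theta>"
        using \<beta> by (simp add: powr_mult[symmetric])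
      also have "(2 * ?l) powr p = 2 powr p * (?l powr (p * \<theta>) * ?l)"
        using l p1 by (simp add: powr_mult \<theta>(2) powr_diff)
      also have "2 powr p * (?l powr (p * \<theta>) * ?l) * ((2 / \<beta>) powr \<theta> * ?m powr \<theta> * (32 / ?l) * q (Suc i))
         = C * ((?l powr (p * \<theta>) * ?m powr \<theta>) * q (Suc i))"
        using l by (simp add: C_def)
      also have "?l powr (p * \<theta>) * ?m powr \<theta> = b (Suc i) powr \<theta>"
        using l by (simp add: b_def powr_mult powr_powr)
      finally show ?thesis .
    qed
    define w where "w x = \<bar>v x\<bar> powr (2 * p)" for x
    have int_w: "integrable lborel w"
      unfolding w_def using p1
      by (intro C1c_integrable[OF v] powr_double_continuous[OF v]) auto
    have bound: "(\<integral>x. w x \<partial>lborel) \<le> lev N powr p * measure lborel K * (1 + 2 powr p * 2) + (4 * C * Q) powr p" for N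
    proof -
      define B where "B = (\<Sum>i\<le>N. b i)"
      have B0: "B \<ge> 0" unfolding B_def by (intro sum_nonneg b0)
      have bB: "b i \<le> B" if "i \<le> N" for i
        unfolding B_def using that b0 by (intro member_le_sum) auto
      have "B = b N + (\<Sum>i<N. b i)" unfolding B_def by (simp add: lessThan_Suc_atMost[symmetric])
      also have "(\<Sum>i<N. b i) \<le> (\<Sum>i<N. C * (B powr \<theta> * q (Suc i)))"
      proof (rule sum_mono)
        fix i assume "i \<in> {..<N}"
        then have "b (Suc i) powr \<theta> \<le> B powr \<theta>" using bB b0 \<theta> by (intro powr_mono2) auto
        then have "C * (b (Suc i) powr \<theta> * q (Suc i)) \<le> C * (B powr \<theta> * q (Suc i))"
          using C q0 by (intro mult_left_mono mult_right_mono) auto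
        then show "b i \<le> C * (B powr \<theta> * q (Suc i))" using b_step[of i] by linarith
      qed
      also have "\<dots> = C * B powr \<theta> * (\<Sum>i<N. q (Suc i))"
        by (simp add: sum_distrib_left mult.assoc)
      also have "\<dots> \<le> C * B powr \<theta> * Q"
      proof (rule mult_left_mono)
        have "(\<Sum>i<N. q (Suc i)) = (\<Sum>i\<in>Suc ` {..<N}. q i)" by (simp add: sum.reindex)
        then show "(\<Sum>i<N. q (Suc i)) \<le> Q" using sum_q[of "Suc ` {..<N}"] by simp
      qed (use C in simp)
      finally have "B \<le> b N + (C * Q) * B powr \<theta>" by (simp add: mult_ac)
      then have B_le: "B \<le> 2 * b N + (2 * (C * Q)) powr p"
        using B0 b0 p1 \<theta> by (intro powr_self_bound[of B "b N" p \<theta> "C * Q"]) auto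
      have "(\<integral>x. w x \<partial>lborel) \<le> (\<integral>x. lev N powr p * indicator K x + (\<Sum>i\<le>N. 2 powr p * lev i powr p * indicator (A i) x) \<partial>lborel)"
      proof (rule integral_mono[OF int_w])
        show "integrable lborel (\<lambda>x. lev N powr p * indicator K x + (\<Sum>i\<le>N. 2 powr p * lev i powr p * indicator (A i) x))"
          using fin K_fin
          by (intro Bochner_Integration.integrable_add Bochner_Integration.integrable_sum
              integrable_mult_right integrable_real_indicator) auto
        fix x
        have w: "w x = ((v x)\<^sup>2) powr p" unfolding w_def by (rule abs_powr_double)
        have sum0: "0 \<le> (\<Sum>i\<le>N. 2 powr p * lev i powr p * indicator (A i) x)"
          by (intro sum_nonneg) auto
        show "w x \<le> lev N powr p * indicator K x + (\<Sum>i\<le>N. 2 powr p * lev i powr p * indicator (A i) x)"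
        proof (cases "(v x)\<^sup>2 \<le> lev N")
          case True
          then have "w x \<le> lev N powr p" unfolding w using p1 by (intro powr_mono2) auto
          then have "w x \<le> lev N powr p * indicator K x"
            using K(2)[of x] by (cases "x \<in> K") (auto simp: w)
          then show ?thesis using sum0 by linarith
        next
          case False
          \<comment> \<open>The first level below \<open>v\<^sup>2\<close>; the level before it is at least \<open>v\<^sup>2\<close> and twice as high.\<close>
          define i where "i = (LEAST i. lev i < (v x)\<^sup>2)"
          have i: "lev i < (v x)\<^sup>2" "i \<le> N"
            unfolding i_def using False by (auto intro: LeastI[of _ N] Least_le)
          have "i \<noteq> 0" using i(1) vL[of x] by (auto simp: lev_def intro!: gr0I)
          then obtain j where j: "i = Suc j" by (cases i) auto
          have "\<not> lev j < (v x)\<^sup>2" using not_less_Least[of j "\<lambda>i. lev i < (v x)\<^sup>2"] j unfolding i_def by simp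
          then have "w x \<le> (2 * lev i) powr p" unfolding w j using p1 lev(2)[of j] by (intro powr_mono2) auto
          also have "\<dots> = 2 powr p * lev i powr p * indicator (A i) x"
            using i(1) lev(1)[of i] by (simp add: powr_mult A_def)
          also have "\<dots> \<le> (\<Sum>i\<le>N. 2 powr p * lev i powr p * indicator (A i) x)"
            using i(2) by (intro member_le_sum) auto
          finally show ?thesis by (simp add: add_increasing)
        qed
      qed
      also have "\<dots> = lev N powr p * measure lborel K + 2 powr p * B"
      proof -
        have "integrable lborel (\<lambda>x. lev N powr p * indicator K x)"
             "\<And>i. integrable lborel (\<lambda>x. 2 powr p * lev i powr p * indicator (A i) x)"
          using fin K_fin by (auto intro!: integrable_mult_right integrable_real_indicator)
        then show ?thesis
          by (simp add: Bochner_Integration.integral_sum B_def b_def sum_distrib_left mult.assoc)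
      qed
      also have "\<dots> \<le> lev N powr p * measure lborel K + 2 powr p * (2 * (lev N powr p * measure lborel K) + (2 * (C * Q)) powr p)"
        using B_le b_le[of N] by (intro add_left_mono mult_left_mono) auto
      also have "\<dots> = lev N powr p * measure lborel K * (1 + 2 powr p * 2) + (4 * C * Q) powr p"
        using C Q0 by (simp add: powr_mult[symmetric] algebra_simps) 
      finally show ?thesis .
    qed
    have "lev \<longlonglongrightarrow> 0"
      unfolding lev_def using LIMSEQ_divide_realpow_zero[of 2 L] by simp
    then have "(\<lambda>N. lev N powr p) \<longlonglongrightarrow> 0"
      using tendsto_powr2[of lev 0 sequentially "\<lambda>_. p" p] lev(1) p1 by (simp add: less_imp_le)
    then have "(\<lambda>N. lev N powr p * measure lborel K * (1 + 2 powr p * 2) + (4 * C * Q) powr p) \<longlonglongrightarrow>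
       0 * measure lborel K * (1 + 2 powr p * 2) + (4 * C * Q) powr p"
      by (intro tendsto_intros)
    then have "(\<integral>x. w x \<partial>lborel) \<le> 0 * measure lborel K * (1 + 2 powr p * 2) + (4 * C * Q) powr p"
      by (rule LIMSEQ_le_const) (use bound in blast)
    then show ?thesis unfolding w_def Q_def by simp
  qed
  then show ?thesis using C by (intro exI[of _ "4 * C"]) auto
qed

section \<open>Ground states outside a ball\<close>

text \<open>Expand \<open>|g - v G|\<^sup>2\<close>; the cross term is \<open>G \<bullet> \<nabla>(v\<^sup>2)\<close>, which integrates by parts to
\<open>- v\<^sup>2 div G\<close>. For a combination of two radial fields, this takes one Euler identity for each
centre. If \<open>G = \<nabla>\<Phi>/\<Phi>\<close>, then \<open>- div G - |G|\<^sup>2 = - \<Delta>\<Phi>/\<Phi>\<close>.\<close>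

lemma ground_state_identity:
  fixes v :: "'a::euclidean_space \<Rightarrow> real" and A B :: "'a \<Rightarrow> real" and A' B' :: "'a \<Rightarrow> 'a" and y b :: 'a
  defines "G \<equiv> \<lambda>x. A x *\<^sub>R (x - y) + B x *\<^sub>R (x - b)"
    and "dv \<equiv> \<lambda>x. DIM('a) * A x + A' x \<bullet> (x - y) + DIM('a) * B x + B' x \<bullet> (x - b)"
  assumes U: "open U" and v: "C1c U v g"
    and A: "\<And>x. x \<in> U \<Longrightarrow> (A has_derivative (\<lambda>h. A' x \<bullet> h)) (at x)" "continuous_on U A'"
    and B: "\<And>x. x \<in> U \<Longrightarrow> (B has_derivative (\<lambda>h. B' x \<bullet> h)) (at x)" "continuous_on U B'"
  shows "(\<integral>x. (norm (g x))\<^sup>2 \<partial>lborel) = (\<integral>x. (norm (g x - v x *\<^sub>R G x))\<^sup>2 \<partial>lborel) +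
    (\<integral>x. (v x)\<^sup>2 * (- dv x - (norm (G x))\<^sup>2) \<partial>lborel)"
proof -
  have contA: "continuous_on U A" and contB: "continuous_on U B"
    using A(1) B(1) has_derivative_continuous continuous_at_imp_continuous_on by metis+
  note cont = contA contB A(2) B(2) C1c_continuous[OF v]
  have contG: "continuous_on U G" and contd: "continuous_on U dv"
    unfolding G_def dv_def by (intro continuous_intros cont)+
  have vv: "C1c U (\<lambda>x. v x * v x) (\<lambda>x. v x *\<^sub>R g x + v x *\<^sub>R g x)"
    using C1c_mult[OF U v, of v g] C1c_has_derivative[OF v] C1c_continuous[OF v] by simp
  define hA where "hA x = (A x *\<^sub>R (v x *\<^sub>R g x + v x *\<^sub>R g x) + (v x * v x) *\<^sub>R A' x) \<bullet> (x - y) + real DIM('a) * (A x * (v x * v x))" for x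
  define hB where "hB x = (B x *\<^sub>R (v x *\<^sub>R g x + v x *\<^sub>R g x) + (v x * v x) *\<^sub>R B' x) \<bullet> (x - b) + real DIM('a) * (B x * (v x * v x))" for x
  have hA: "(\<integral>x. hA x \<partial>lborel) = 0"
    unfolding hA_def by (rule integral_Euler[OF C1c_mult[OF U vv A]])
  have hB: "(\<integral>x. hB x \<partial>lborel) = 0"
    unfolding hB_def by (rule integral_Euler[OF C1c_mult[OF U vv B]])
  have ih: "integrable lborel hA" "integrable lborel hB"
    unfolding hA_def hB_def by (rule C1c_integrable[OF v]; (intro continuous_intros cont)?; simp)+
  have i1: "integrable lborel (\<lambda>x. (norm (g x - v x *\<^sub>R G x))\<^sup>2)"
    by (rule C1c_integrable[OF v]; (intro continuous_intros cont contG)?; simp)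
  have i2: "integrable lborel (\<lambda>x. (v x)\<^sup>2 * (- dv x - (norm (G x))\<^sup>2))"
    by (rule C1c_integrable[OF v]; (intro continuous_intros cont contG contd)?; simp)
  have "(norm (g x))\<^sup>2 = (norm (g x - v x *\<^sub>R G x))\<^sup>2 + (v x)\<^sup>2 * (- dv x - (norm (G x))\<^sup>2) + hA x + hB x" for x
  proof -
    have "(norm (g x - v x *\<^sub>R G x))\<^sup>2 = (norm (g x))\<^sup>2 - 2 * v x * (g x \<bullet> G x) + (v x)\<^sup>2 * (norm (G x))\<^sup>2"
      unfolding power2_norm_eq_inner
      by (simp add: inner_diff_left inner_diff_right inner_commute power2_eq_square algebra_simps)
    moreover have "hA x + hB x = 2 * v x * (g x \<bullet> G x) + (v x)\<^sup>2 * dv x"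
      unfolding hA_def hB_def G_def dv_def
      by (simp add: inner_add_left inner_add_right power2_eq_square algebra_simps)
    ultimately show ?thesis by (simp add: algebra_simps)
  qed
  then have "(\<integral>x. (norm (g x))\<^sup>2 \<partial>lborel) =
    (\<integral>x. (norm (g x - v x *\<^sub>R G x))\<^sup>2 + (v x)\<^sup>2 * (- dv x - (norm (G x))\<^sup>2) + hA x + hB x \<partial>lborel)" by simp
  also have "\<dots> = (\<integral>x. (norm (g x - v x *\<^sub>R G x))\<^sup>2 \<partial>lborel) +
    (\<integral>x. (v x)\<^sup>2 * (- dv x - (norm (G x))\<^sup>2) \<partial>lborel)"
    using i1 i2 ih hA hB by simp
  finally show ?thesis .
qed

lemma has_derivative_scalar_compose:
  assumes "(s has_derivative (\<lambda>h. s' \<bullet> h)) (at x)" "(f has_real_derivative d) (at (s x))"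
  shows "((\<lambda>x. f (s x)) has_derivative (\<lambda>h. (d *\<^sub>R s') \<bullet> h)) (at x)"
  using has_derivative_compose[OF assms(1) assms(2)[unfolded has_field_derivative_def]] by simp

text \<open>The pointwise algebra for \<open>\<Phi> = \<sigma> exp(-n\<sigma>/r) \<rho> powr (-n/2) h\<close> with \<open>q = h'/h\<close>. Here \<open>S = |x-y|\<^sup>2\<close> and
\<open>Z = (x-y) \<bullet> (x-a)\<close>, while \<open>A\<close> and \<open>B\<close> are the coefficients of \<open>x-y\<close> and \<open>x-a\<close> in \<open>\<nabla>\<Phi>/\<Phi>\<close>. The part
\<open>N\<close> that involves only \<open>A\<close> is nonnegative because \<open>\<sigma> exp(-n\<sigma>/r)\<close> is superharmonic near the
ball. The mixed part, \<open>(n + 2q)(A Z - 1)/\<rho>\<^sup>2\<close> once the radial terms are collected, would vanish if \<open>\<sigma> exp(-n\<sigma>/r)\<close> were homogeneous of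
degree one in \<open>x-a\<close>, that is if \<open>A Z = 1\<close>; the defect of homogeneity is bounded below by
\<open>- n\<sigma>/r\<close> and costs a term of order \<open>1/\<rho>\<close>. What remains is the radial part
\<open>n\<^sup>2/4 - q' - q\<^sup>2\<close>.\<close>

lemma exterior_ball_potential_bound:
  fixes n r \<sigma> \<rho> q q' :: real
  defines "S \<equiv> r\<^sup>2 + 2 * r * \<sigma>" and "A \<equiv> (1 / \<sigma> - n / r) / r" and "B \<equiv> - ((n / 2 + q) / \<rho>\<^sup>2)"
    and "Z \<equiv> \<rho>\<^sup>2 / 2 + r * \<sigma>"
  assumes n: "n \<ge> 1" and r: "r > 0" and \<sigma>: "0 < \<sigma>" "\<sigma> \<le> 2 * \<rho>" and \<rho>: "\<rho> \<le> r / (4 * n)" and q: "0 \<le> q" "q \<le> 1"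
  shows "- (n * A - S / (\<sigma>\<^sup>2 * r\<^sup>2) + n * B + (q' + n + 2 * q) / \<rho>\<^sup>2) - (A\<^sup>2 * S + 2 * A * B * Z + B\<^sup>2 * \<rho>\<^sup>2)
    - n\<^sup>2 / 4 / \<rho>\<^sup>2 \<ge> (- q' - q\<^sup>2) / \<rho>\<^sup>2 - 2 * n * (n + 2) / r / \<rho>" (is "?L \<ge> ?R")
proof -
  have \<rho>0: "\<rho> > 0" using \<sigma> by linarith
  have n\<sigma>: "n * \<sigma> / r \<le> 1 / 2"
  proof -
    have "n * \<sigma> \<le> n * (2 * (r / (4 * n)))" using n \<sigma>(2) \<rho> by (intro mult_left_mono) linarith+
    then show ?thesis using n r by (simp add: field_simps)
  qed
  define N where "N = - n * A + S / (\<sigma>\<^sup>2 * r\<^sup>2) - A\<^sup>2 * S"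
  have "N = n / (r * \<sigma>) + 4 * n / r\<^sup>2 - 2 * n\<^sup>2 * \<sigma> / r ^ 3"
    unfolding N_def A_def S_def using r \<sigma>(1) by (simp add: field_simps power2_eq_square power3_eq_cube)
  also have "\<dots> = n / (r * \<sigma>) * (1 - 2 * n * (\<sigma> / r)\<^sup>2) + 4 * n / r\<^sup>2"
    using r \<sigma>(1) by (simp add: field_simps power2_eq_square power3_eq_cube)
  also have "\<dots> \<ge> 0"
  proof -
    have "n * (n * (\<sigma> / r)\<^sup>2) = (n * \<sigma> / r)\<^sup>2" by (simp add: power2_eq_square)
    also have "\<dots> \<le> (1 / 2)\<^sup>2" using n\<sigma> n \<sigma> r by (intro power_mono) auto
    finally have *: "n * (n * (\<sigma> / r)\<^sup>2) \<le> 1 / 4" by (simp add: power2_eq_square)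
    have "n * (\<sigma> / r)\<^sup>2 \<le> n * (n * (\<sigma> / r)\<^sup>2)" using n by (intro mult_right_mono[of 1 n, simplified]) auto
    then have "1 - 2 * n * (\<sigma> / r)\<^sup>2 \<ge> 0" using * by linarith
    then show ?thesis using n r \<sigma> by simp
  qed
  finally have N: "N \<ge> 0" .
  have AZ: "A * Z - 1 \<ge> - (n * \<sigma> / r)"
  proof -
    have "A * Z = 1 - n * \<sigma> / r + (1 / \<sigma> - n / r) / r * (\<rho>\<^sup>2 / 2)"
      unfolding A_def Z_def using r \<sigma>(1) by (simp add: field_simps power2_eq_square)
    moreover have "1 / \<sigma> - n / r \<ge> 0" using n\<sigma> r \<sigma>(1) by (simp add: field_simps)
    ultimately show ?thesis using r by simp
  qed
  have "?L = N + (n + 2 * q) * (A * Z - 1) / \<rho>\<^sup>2 + (- q' - q\<^sup>2) / \<rho>\<^sup>2"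
    unfolding N_def B_def using \<rho>0 by (simp add: field_simps power2_eq_square)
  moreover have "(n + 2 * q) * (A * Z - 1) / \<rho>\<^sup>2 \<ge> - (2 * n * (n + 2) / r / \<rho>)"
  proof -
    have "(n + 2 * q) * (n * \<sigma> / r) \<le> (n + 2) * (n * (2 * \<rho>) / r)"
      using n q r \<sigma> by (intro mult_mono divide_right_mono mult_left_mono) auto
    moreover have "(n + 2 * q) * (A * Z - 1) \<ge> (n + 2 * q) * (- (n * \<sigma> / r))"
      using AZ n q by (intro mult_left_mono) auto
    ultimately have "(n + 2 * q) * (A * Z - 1) \<ge> - ((n + 2) * (n * (2 * \<rho>) / r))" by linarith
    then have "(n + 2 * q) * (A * Z - 1) / \<rho>\<^sup>2 \<ge> - ((n + 2) * (n * (2 * \<rho>) / r)) / \<rho>\<^sup>2"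
      by (intro divide_right_mono) auto
    also have "- ((n + 2) * (n * (2 * \<rho>) / r)) / \<rho>\<^sup>2 = - (2 * n * (n + 2) / r / \<rho>)"
      using \<rho>0 r by (simp add: field_simps power2_eq_square)
    finally show ?thesis .
  qed
  ultimately show ?thesis using N by linarith
qed

abbreviation exterior_cap :: "'a::metric_space \<Rightarrow> 'a \<Rightarrow> real \<Rightarrow> 'a set" where
  "exterior_cap a y \<delta> \<equiv> {x. dist a y < dist x y} \<inter> ball a \<delta>"

text \<open>The vector field is \<open>G = \<nabla>\<Phi>/\<Phi>\<close> for \<open>\<Phi> = \<sigma> exp(-n\<sigma>/r) \<rho> powr (-n/2) h(t)\<close>, \<open>t = ln (D/\<rho>)\<close>, and it enters
only through \<open>q = h'/h\<close>, for which \<open>- q' - q\<^sup>2 = - h''/h\<close>. Leaving \<open>q\<close> free allows one computation to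
serve for all the remainder terms.\<close>

lemma exterior_ball_Hardy:
  fixes a y :: "'a::euclidean_space" and q q' :: "real \<Rightarrow> real" and \<delta> D :: real
  defines "n \<equiv> real DIM('a)" and "r \<equiv> dist a y"
  defines "U \<equiv> exterior_cap a y \<delta>"
  assumes r: "a \<noteq> y" and \<delta>: "\<delta> \<le> r / (4 * n)" "\<delta> \<le> D" and D: "D > 0"
    and q: "\<And>t. t > 0 \<Longrightarrow> (q has_real_derivative q' t) (at t)" "continuous_on {0<..} q'"
      "\<And>t. t > 0 \<Longrightarrow> 0 \<le> q t \<and> q t \<le> 1"
  shows "\<exists>G P. continuous_on U G \<and> continuous_on U P \<and>
    (\<forall>x\<in>U. P x \<ge> (- q' (ln (D / norm (x - a))) - (q (ln (D / norm (x - a))))\<^sup>2) / (norm (x - a))\<^sup>2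
        - 2 * n * (n + 2) / r / norm (x - a)) \<and>
    (\<forall>v g. C1c U v g \<longrightarrow> (\<integral>x. (norm (g x))\<^sup>2 \<partial>lborel) =
       (\<integral>x. (norm (g x - v x *\<^sub>R G x))\<^sup>2 \<partial>lborel) + n\<^sup>2 / 4 * (\<integral>x. (v x)\<^sup>2 / (norm (x - a))\<^sup>2 \<partial>lborel)
       + (\<integral>x. (v x)\<^sup>2 * P x \<partial>lborel))"
proof -
  have r0: "r > 0" unfolding r_def using r by simp
  have n1: "n \<ge> 1" unfolding n_def using DIM_positive[where 'a='a] by linarith
  have openU: "open U" unfolding U_def by (intro open_Int open_Collect_less continuous_intros) auto
  define \<sigma> where "\<sigma> x = ((x - y) \<bullet> (x - y) - r\<^sup>2) / (2 * r)" for x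
  define R where "R x = (x - a) \<bullet> (x - a)" for x
  define t where "t x = ln D - ln (R x) / 2" for x
  have yU: "(x - y) \<bullet> (x - y) = r\<^sup>2 + 2 * r * \<sigma> x" for x
    unfolding \<sigma>_def using r0 by (simp add: field_simps)
  have inU: "\<sigma> x > 0" "norm (x - a) > 0" "R x > 0" "R x = (norm (x - a))\<^sup>2" "norm (x - a) < \<delta>"
     "t x = ln (D / norm (x - a))" "t x > 0" "\<sigma> x \<le> 2 * norm (x - a)" if "x \<in> U" for x
  proof -
    have rx: "r < norm (x - y)" using that by (simp add: U_def r_def dist_norm)
    have "r\<^sup>2 < (x - y) \<bullet> (x - y)"
      using power_strict_mono[OF rx, of 2] r0 by (simp add: power2_norm_eq_inner)
    then show "\<sigma> x > 0" unfolding \<sigma>_def using r0 by simp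
    have "x \<noteq> a" using rx by (auto simp: r_def dist_norm)
    then show xa: "norm (x - a) > 0" by simp
    show R2: "R x = (norm (x - a))\<^sup>2" by (simp add: R_def power2_norm_eq_inner)
    then show "R x > 0" using xa by simp
    show xd: "norm (x - a) < \<delta>" using that by (simp add: U_def dist_norm norm_minus_commute)
    show t: "t x = ln (D / norm (x - a))"
      unfolding t_def R2 using xa D by (simp add: ln_div ln_realpow)
    then show "t x > 0" using xa xd \<delta>(2) D by (simp add: ln_gt_zero)
    have "norm (x - y) \<le> norm (x - a) + r"
      using norm_triangle_ineq[of "x - a" "a - y"] by (simp add: r_def dist_norm)
    then have "(norm (x - y))\<^sup>2 \<le> (norm (x - a) + r)\<^sup>2" by (intro power_mono) auto
    then have "2 * r * \<sigma> x \<le> norm (x - a) * (norm (x - a) + 2 * r)"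
      using yU[of x] by (simp add: power2_norm_eq_inner[symmetric] power2_eq_square algebra_simps)
    also have "\<dots> \<le> norm (x - a) * (4 * r)"
    proof (rule mult_left_mono)
      have "r / (4 * n) \<le> r / 1" using n1 r0 by (intro divide_left_mono) auto
      then show "norm (x - a) + 2 * r \<le> 4 * r" using xd \<delta>(1) r0 by linarith
    qed simp
    finally show "\<sigma> x \<le> 2 * norm (x - a)" using r0 by (simp add: mult.commute)
  qed
  \<comment> \<open>\<open>A x *\<^sub>R (x - y)\<close> is the logarithmic gradient of \<open>\<sigma> exp(-n\<sigma>/r)\<close>, and \<open>B x *\<^sub>R (x - a)\<close> that of
    \<open>\<rho> powr (-n/2) h(t)\<close>.\<close>
  define A where "A x = (1 / \<sigma> x - n / r) / r" for x
  define A' where "A' x = (- (1 / (\<sigma> x)\<^sup>2) / r) *\<^sub>R ((1 / r) *\<^sub>R (x - y))" for x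
  define B where "B x = - ((n / 2 + q (t x)) / R x)" for x
  define B' where "B' x = ((q' (t x) / 2 + n / 2 + q (t x)) / (R x)\<^sup>2) *\<^sub>R (2 *\<^sub>R (x - a))" for x
  have dA: "(A has_derivative (\<lambda>h. A' x \<bullet> h)) (at x)" if "x \<in> U" for x
    unfolding A_def[abs_def] A'_def
  proof (rule has_derivative_scalar_compose[where f = "\<lambda>s. (1 / s - n / r) / r"])
    show "(\<sigma> has_derivative (\<lambda>h. ((1 / r) *\<^sub>R (x - y)) \<bullet> h)) (at x)"
    proof -
      have "(\<sigma> has_derivative (\<lambda>h. ((x - y) \<bullet> h) / r)) (at x)"
        unfolding \<sigma>_def[abs_def] using r0
        by (auto intro!: derivative_eq_intros simp: inner_commute)
      then show ?thesis by simp
    qed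
    show "((\<lambda>s. (1 / s - n / r) / r) has_real_derivative - (1 / (\<sigma> x)\<^sup>2) / r) (at (\<sigma> x))"
      using inU(1)[OF that] r0 by (auto intro!: derivative_eq_intros simp: power2_eq_square)
  qed
  have dB: "(B has_derivative (\<lambda>h. B' x \<bullet> h)) (at x)" if "x \<in> U" for x
    unfolding B_def[abs_def] B'_def t_def
  proof (rule has_derivative_scalar_compose[where f = "\<lambda>s. - ((n / 2 + q (ln D - ln s / 2)) / s)"])
    show "(R has_derivative (\<lambda>h. (2 *\<^sub>R (x - a)) \<bullet> h)) (at x)"
      unfolding R_def[abs_def] by (auto intro!: derivative_eq_intros simp: inner_commute)
    have Rx: "R x > 0" using inU(3)[OF that] .
    have tx: "ln D - ln (R x) / 2 > 0" using inU(7)[OF that] by (simp add: t_def)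
    have "((\<lambda>s. ln D - ln s / 2) has_real_derivative - (1 / (2 * R x))) (at (R x))"
      using Rx by (auto intro!: derivative_eq_intros)
    from DERIV_chain2[OF q(1)[OF tx] this]
    have "((\<lambda>s. - ((n / 2 + q (ln D - ln s / 2)) / s)) has_real_derivative
       - (((q' (ln D - ln (R x) / 2) * - (1 / (2 * R x))) * R x - (n / 2 + q (ln D - ln (R x) / 2)) * 1) / (R x * R x))) (at (R x))"
      using Rx by (intro DERIV_minus DERIV_divide derivative_eq_intros) auto
    moreover have "- (((q' (ln D - ln (R x) / 2) * - (1 / (2 * R x))) * R x - (n / 2 + q (ln D - ln (R x) / 2)) * 1) / (R x * R x))
      = (q' (ln D - ln (R x) / 2) / 2 + n / 2 + q (ln D - ln (R x) / 2)) / (R x)\<^sup>2"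
      using Rx by (simp add: field_simps power2_eq_square)
    ultimately show "((\<lambda>s. - ((n / 2 + q (ln D - ln s / 2)) / s)) has_real_derivative
       (q' (ln D - ln (R x) / 2) / 2 + n / 2 + q (ln D - ln (R x) / 2)) / (R x)\<^sup>2) (at (R x))" by simp
  qed
  have nz: "\<forall>x\<in>U. \<sigma> x \<noteq> 0" "\<forall>x\<in>U. R x \<noteq> 0" "\<forall>x\<in>U. norm (x - a) \<noteq> 0" "r \<noteq> 0"
    using inU(1,2,3) r0 by (metis less_irrefl)+
  have cs: "continuous_on U \<sigma>" "continuous_on U R"
    unfolding \<sigma>_def[abs_def] R_def[abs_def] using r0 by (auto intro!: continuous_intros)
  have ct: "continuous_on U t"
    unfolding t_def[abs_def] using inU(3) by (auto intro!: continuous_intros cs simp: less_imp_neq[symmetric])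
  have cq: "continuous_on U (\<lambda>x. q (t x))" "continuous_on U (\<lambda>x. q' (t x))"
  proof -
    have "continuous_on {0<..} q"
      using q(1) DERIV_isCont continuous_at_imp_continuous_on by (metis greaterThan_iff)
    then show "continuous_on U (\<lambda>x. q (t x))"
      by (rule continuous_on_compose2[OF _ ct]) (use inU(7) in auto)
    show "continuous_on U (\<lambda>x. q' (t x))"
      by (rule continuous_on_compose2[OF q(2) ct]) (use inU(7) in auto)
  qed
  have cA: "continuous_on U A" "continuous_on U A'" "continuous_on U B" "continuous_on U B'"
    unfolding A_def[abs_def] A'_def[abs_def] B_def[abs_def] B'_def[abs_def] using nz
    by (intro continuous_intros cs cq; simp)+
  define G where "G x = A x *\<^sub>R (x - y) + B x *\<^sub>R (x - a)" for x
  define dv where "dv x = n * A x + A' x \<bullet> (x - y) + n * B x + B' x \<bullet> (x - a)" for x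
  define P where "P x = - dv x - (norm (G x))\<^sup>2 - n\<^sup>2 / 4 / (norm (x - a))\<^sup>2" for x
  have cG: "continuous_on U G" unfolding G_def[abs_def] by (intro continuous_intros cA)
  have cd: "continuous_on U dv" unfolding dv_def[abs_def] by (intro continuous_intros cA)
  have cP: "continuous_on U P"
    unfolding P_def[abs_def] using nz by (intro continuous_intros cG cd) auto
  have bound: "P x \<ge> (- q' (ln (D / norm (x - a))) - (q (ln (D / norm (x - a))))\<^sup>2) / (norm (x - a))\<^sup>2
        - 2 * n * (n + 2) / r / norm (x - a)" if x: "x \<in> U" for x
  proof -
    note I = inU[OF x]
    let ?\<rho> = "norm (x - a)"
    have Z: "(x - y) \<bullet> (x - a) = ?\<rho>\<^sup>2 / 2 + r * \<sigma> x"
    proof -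
      have "(a - y) \<bullet> (a - y) = r\<^sup>2" by (simp add: r_def dist_norm power2_norm_eq_inner)
      moreover have "a - y = (x - y) - (x - a)" by simp
      ultimately have "(x - y) \<bullet> (x - y) - 2 * ((x - y) \<bullet> (x - a)) + (x - a) \<bullet> (x - a) = r\<^sup>2"
        by (simp only: inner_diff_left inner_diff_right inner_commute) (simp add: inner_commute algebra_simps)
      then show ?thesis using yU[of x] by (simp add: power2_norm_eq_inner)
    qed
    have "A' x \<bullet> (x - y) = - ((r\<^sup>2 + 2 * r * \<sigma> x) / ((\<sigma> x)\<^sup>2 * r\<^sup>2))"
      unfolding A'_def by (simp add: yU power2_eq_square)
    moreover have "B' x \<bullet> (x - a) = (q' (t x) + n + 2 * q (t x)) / ?\<rho>\<^sup>2"
    proof -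
      have "B' x \<bullet> (x - a) = (q' (t x) / 2 + n / 2 + q (t x)) / (R x)\<^sup>2 * (2 * R x)"
        unfolding B'_def R_def by (simp only: inner_scaleR_left)
      also have "\<dots> = (q' (t x) + n + 2 * q (t x)) / R x"
        using I(3) by (simp add: field_simps power2_eq_square)
      finally show ?thesis using I(4) by simp
    qed
    moreover have "(norm (G x))\<^sup>2 = (A x)\<^sup>2 * (r\<^sup>2 + 2 * r * \<sigma> x) + 2 * A x * B x * (?\<rho>\<^sup>2 / 2 + r * \<sigma> x) + (B x)\<^sup>2 * ?\<rho>\<^sup>2"
    proof -
      have "(norm (\<alpha> *\<^sub>R u + \<beta> *\<^sub>R w))\<^sup>2 = \<alpha>\<^sup>2 * (u \<bullet> u) + 2 * \<alpha> * \<beta> * (u \<bullet> w) + \<beta>\<^sup>2 * (norm w)\<^sup>2"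
        for \<alpha> \<beta> and u w :: 'a
        unfolding power2_norm_eq_inner
        by (simp add: inner_add_left inner_add_right inner_commute[of w u] power2_eq_square algebra_simps)
      then show ?thesis unfolding G_def by (simp only: yU Z)
    qed
    ultimately have "P x = - (n * A x - (r\<^sup>2 + 2 * r * \<sigma> x) / ((\<sigma> x)\<^sup>2 * r\<^sup>2) + n * B x + (q' (t x) + n + 2 * q (t x)) / ?\<rho>\<^sup>2)
       - ((A x)\<^sup>2 * (r\<^sup>2 + 2 * r * \<sigma> x) + 2 * A x * B x * (?\<rho>\<^sup>2 / 2 + r * \<sigma> x) + (B x)\<^sup>2 * ?\<rho>\<^sup>2) - n\<^sup>2 / 4 / ?\<rho>\<^sup>2"
      unfolding P_def dv_def by simp
    also have "\<dots> \<ge> (- q' (t x) - (q (t x))\<^sup>2) / ?\<rho>\<^sup>2 - 2 * n * (n + 2) / r / ?\<rho>"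
      unfolding A_def B_def I(4)
      by (rule exterior_ball_potential_bound[OF n1 r0 I(1) I(8)]) (use I \<delta>(1) q(3) in auto)
    finally show ?thesis using I(6) by simp
  qed
  have ident: "(\<integral>x. (norm (g x))\<^sup>2 \<partial>lborel) =
       (\<integral>x. (norm (g x - v x *\<^sub>R G x))\<^sup>2 \<partial>lborel) + n\<^sup>2 / 4 * (\<integral>x. (v x)\<^sup>2 / (norm (x - a))\<^sup>2 \<partial>lborel)
       + (\<integral>x. (v x)\<^sup>2 * P x \<partial>lborel)" if v: "C1c U v g" for v g
  proof -
    have "(\<integral>x. (norm (g x))\<^sup>2 \<partial>lborel) = (\<integral>x. (norm (g x - v x *\<^sub>R G x))\<^sup>2 \<partial>lborel) +
      (\<integral>x. (v x)\<^sup>2 * (- dv x - (norm (G x))\<^sup>2) \<partial>lborel)"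
      using ground_state_identity[OF openU v dA cA(2) dB cA(4)]
      unfolding G_def[abs_def] dv_def[abs_def] n_def by simp
    also have "(\<integral>x. (v x)\<^sup>2 * (- dv x - (norm (G x))\<^sup>2) \<partial>lborel) =
      (\<integral>x. n\<^sup>2 / 4 * ((v x)\<^sup>2 / (norm (x - a))\<^sup>2) + (v x)\<^sup>2 * P x \<partial>lborel)"
      unfolding P_def by (intro Bochner_Integration.integral_cong) (auto simp: algebra_simps)
    also have "\<dots> = n\<^sup>2 / 4 * (\<integral>x. (v x)\<^sup>2 / (norm (x - a))\<^sup>2 \<partial>lborel) + (\<integral>x. (v x)\<^sup>2 * P x \<partial>lborel)"
    proof -
      have i: "integrable lborel (\<lambda>x. (v x)\<^sup>2 / (norm (x - a))\<^sup>2)" "integrable lborel (\<lambda>x. (v x)\<^sup>2 * P x)"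
        using nz by (auto intro!: C1c_integrable[OF v] continuous_intros C1c_continuous[OF v] cP)
      have "integrable lborel (\<lambda>x. n\<^sup>2 / 4 * ((v x)\<^sup>2 / (norm (x - a))\<^sup>2))"
        by (intro integrable_mult_right i)
      from Bochner_Integration.integral_add[OF this i(2)] show ?thesis
        by (simp only: integral_mult_right_zero)
    qed
    finally show ?thesis by simp
  qed
  show ?thesis using cG cP bound ident by blast
qed

section \<open>Hardy inequalities with logarithmic remainder\<close>

text \<open>Near the point the curvature error \<open>C/\<rho>\<close> is dominated by the logarithmic remainder. With
\<open>s = 1 + ln (D/\<rho>)\<close>, the bound \<open>exp s \<ge> (s/3)\<^sup>3\<close> gives \<open>s\<^sup>3 \<rho> \<le> 81 D\<close>, and the
radius is chosen so that \<open>s \<ge> 648 C D\<close>.\<close>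

lemma log_square_times_small:
  fixes C D \<rho> :: real
  assumes C: "C > 0" and D: "D > 0" and \<rho>: "0 < \<rho>" "\<rho> \<le> D * exp (- (648 * C * D))"
  shows "C / \<rho> \<le> 1 / (1 + ln (D / \<rho>))\<^sup>2 / (8 * \<rho>\<^sup>2)"
proof -
  define s where "s = 1 + ln (D / \<rho>)"
  have "exp (648 * C * D) \<le> D / \<rho>"
    using \<rho> by (simp add: exp_minus field_simps)
  then have "648 * C * D \<le> ln (D / \<rho>)"
    using \<rho>(1) D by (metis divide_pos_pos ln_ge_iff)
  moreover have "0 \<le> 648 * C * D" using C D by simp
  ultimately have s1: "s \<ge> 1" "648 * C * D \<le> s" unfolding s_def by linarith+
  have "(s / 3) ^ 3 \<le> exp (s / 3) ^ 3"
  proof (rule power_mono)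
    show "s / 3 \<le> exp (s / 3)" using exp_ge_add_one_self[of "s / 3"] by linarith
  qed (use s1 in simp)
  also have "\<dots> = exp s" by (simp add: exp_of_nat_mult[symmetric])
  also have "\<dots> = exp 1 * (D / \<rho>)" unfolding s_def using \<rho>(1) D by (simp add: exp_add)
  also have "\<dots> \<le> 3 * (D / \<rho>)" using exp_le \<rho>(1) D by (intro mult_right_mono) auto
  finally have "s ^ 3 * \<rho> \<le> 81 * D" using \<rho>(1) by (simp add: field_simps power3_eq_cube)
  then have "8 * C * (s ^ 3 * \<rho>) \<le> 8 * C * (81 * D)" using C by (intro mult_left_mono) auto
  moreover have "8 * C * (s ^ 3 * \<rho>) = (8 * C * \<rho> * s\<^sup>2) * s" by (simp add: power2_eq_square power3_eq_cube)
  ultimately have "(8 * C * \<rho> * s\<^sup>2) * s \<le> 1 * s" using s1 by linarith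
  then have "8 * C * \<rho> * s\<^sup>2 \<le> 1" using s1 by (intro mult_right_le_imp_le[of _ s 1]) auto
  then have "C / \<rho> \<le> 1 / s\<^sup>2 / (8 * \<rho>\<^sup>2)"
    using s1 \<rho>(1) by (simp add: field_simps power2_eq_square)
  then show ?thesis unfolding s_def .
qed

text \<open>Take \<open>h\<close> positive and concave with slope falling from about \<open>1\<close> to about \<open>0\<close> around \<open>t = \<tau>\<close>, a
smooth version of \<open>min t \<tau>\<close> plus a constant, and \<open>q = h'/h\<close>. On the unit slab the curvature is bounded below, while
\<open>h\<close> is of size \<open>1 + \<tau>\<close>; hence the linear growth in \<open>\<tau>\<close>.\<close>

lemma slab_profile:
  fixes \<tau> :: real
  assumes \<tau>: "\<tau> \<ge> 0"
  shows "\<exists>q q'. (\<forall>t>0. (q has_real_derivative q' t) (at t)) \<and> continuous_on {0<..} q' \<and>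
    (\<forall>t>0. 0 \<le> q t \<and> q t \<le> 1) \<and>
    (\<forall>t>0. indicator {-1..1} (t - \<tau>) / (9 * (1 + \<tau>)) \<le> - q' t - (q t)\<^sup>2)"
proof -
  define w where "w t = sqrt (1 + (t - \<tau>)\<^sup>2)" for t
  define h where "h t = (2 * \<tau> + 3 + (t - \<tau>) - w t) / 2" for t
  define h' where "h' t = (1 - (t - \<tau>) / w t) / 2" for t
  define h'' where "h'' t = - (1 / (2 * w t ^ 3))" for t
  have pos: "1 + (t - \<tau>)\<^sup>2 > 0" for t by (simp add: add_pos_nonneg)
  have w0: "w t > 0" for t unfolding w_def using pos by simp
  have w2: "(w t)\<^sup>2 = 1 + (t - \<tau>)\<^sup>2" for t unfolding w_def using pos[of t] by simp
  have wabs: "\<bar>t - \<tau>\<bar> \<le> w t" for t unfolding w_def by (rule real_le_rsqrt) simp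
  have wle: "w t \<le> 1 + \<bar>t - \<tau>\<bar>" for t
    unfolding w_def by (rule real_le_lsqrt) (auto simp: power2_eq_square algebra_simps)
  have h1: "h t \<ge> 1" if "t > 0" for t
    using wle[of t] that \<tau> unfolding h_def by (auto simp: abs_if split: if_splits)
  have h2: "h t \<le> (2 * \<tau> + 3) / 2" for t using wabs[of t] unfolding h_def by simp
  have h'b: "0 \<le> h' t" "h' t \<le> 1" for t
  proof -
    define X where "X = (t - \<tau>) / w t"
    have "\<bar>X\<bar> \<le> 1" using wabs[of t] w0[of t] by (simp add: X_def)
    moreover have "h' t = (1 - X) / 2" by (simp add: h'_def X_def)
    ultimately have "0 \<le> h' t" and "h' t \<le> 1" by (simp_all add: abs_le_iff)
    then show "0 \<le> h' t" "h' t \<le> 1" by auto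
  qed
  have dw: "(w has_real_derivative (t - \<tau>) / w t) (at t)" for t
    unfolding w_def[abs_def] using pos[of t]
    by (auto intro!: derivative_eq_intros simp: field_simps)
  have dh: "(h has_real_derivative h' t) (at t)" for t
    unfolding h_def[abs_def] h'_def by (auto intro!: derivative_eq_intros dw)
  have dh': "(h' has_real_derivative h'' t) (at t)" for t
  proof -
    have "((\<lambda>t. (t - \<tau>) / w t) has_real_derivative (1 * w t - (t - \<tau>) * ((t - \<tau>) / w t)) / (w t * w t)) (at t)"
      using w0[of t] by (intro DERIV_divide dw) (auto intro!: derivative_eq_intros)
    from DERIV_cdivide[OF DERIV_diff[OF DERIV_const this], of 1 2]
    have "(h' has_real_derivative - ((1 * w t - (t - \<tau>) * ((t - \<tau>) / w t)) / (w t * w t)) / 2) (at t)"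
      unfolding h'_def[abs_def] by simp
    moreover have "1 * w t - (t - \<tau>) * ((t - \<tau>) / w t) = 1 / w t"
      using w0[of t] w2[of t] by (simp add: field_simps power2_eq_square)
    ultimately show ?thesis unfolding h''_def by (simp add: power3_eq_cube mult_ac)
  qed
  define q where "q t = h' t / h t" for t
  define q' where "q' t = h'' t / h t - (h' t / h t)\<^sup>2" for t
  have cw: "continuous_on S w" and ch: "continuous_on S h" for S
    unfolding h_def[abs_def] w_def[abs_def] by (intro continuous_intros)+ auto
  have ch': "continuous_on S h'" "continuous_on S h''" for S
    unfolding h'_def[abs_def] h''_def[abs_def] using w0 by (auto intro!: continuous_intros cw simp: less_imp_neq[symmetric])
  have "(q has_real_derivative q' t) (at t)" if "t > 0" for t
    unfolding q_def[abs_def] q'_def using h1[OF that]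
    by (auto intro!: derivative_eq_intros dh dh' simp: field_simps power2_eq_square)
  moreover have "continuous_on {0<..} q'"
    unfolding q'_def[abs_def] using h1 by (intro continuous_intros ch ch') force+
  moreover have "0 \<le> q t \<and> q t \<le> 1" if "t > 0" for t
    unfolding q_def using h1[OF that] h'b[of t] by (simp add: field_simps)
  moreover have "indicator {-1..1} (t - \<tau>) / (9 * (1 + \<tau>)) \<le> - q' t - (q t)\<^sup>2" if "t > 0" for t
  proof -
    have eq: "- q' t - (q t)\<^sup>2 = 1 / (2 * w t ^ 3 * h t)"
      unfolding q'_def q_def h''_def by simp
    show ?thesis
    proof (cases "t - \<tau> \<in> {-1..1}")
      case True
      then have "(t - \<tau>)\<^sup>2 \<le> 1" by (simp add: abs_square_le_1 abs_le_iff)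
      then have "w t \<le> sqrt 2" unfolding w_def by (intro real_sqrt_le_mono) simp
      then have "w t ^ 3 \<le> sqrt 2 ^ 3" using w0[of t] by (intro power_mono) auto
      also have "\<dots> = 2 * sqrt 2" by (simp add: power3_eq_cube)
      also have "\<dots> \<le> 3"
      proof -
        have "sqrt 2 \<le> 3 / 2" by (rule real_le_lsqrt) (auto simp: power2_eq_square)
        then show ?thesis by simp
      qed
      finally have "2 * w t ^ 3 * h t \<le> 2 * 3 * ((2 * \<tau> + 3) / 2)"
        using h2[of t] h1[OF that] less_imp_le[OF w0[of t]] by (intro mult_mono) auto
      also have "\<dots> \<le> 9 * (1 + \<tau>)" using \<tau> by simp
      finally have "1 / (9 * (1 + \<tau>)) \<le> 1 / (2 * w t ^ 3 * h t)"
        using w0[of t] h1[OF that] \<tau> by (intro divide_left_mono mult_pos_pos) auto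
      then show ?thesis using True eq by simp
    next
      case False
      then show ?thesis unfolding eq using w0[of t] h1[OF that] by simp
    qed
  qed
  ultimately show ?thesis by blast
qed

text \<open>Two instances of the Hardy inequality outside a ball. The profile \<open>q = 1/(2(1+t))\<close>, that is
\<open>h = sqrt (1+t)\<close>, has \<open>- q' - q\<^sup>2 = 1/(4(1+t)\<^sup>2)\<close>; half of it absorbs the curvature error and the other
half is the stated bound on \<open>P\<close>. For the slab estimate the curvature error of the second instance
is absorbed by the potential of the first one, so that the energy is spent twice.\<close>

lemma exterior_ball_log_Hardy:
  fixes a y :: "'a::euclidean_space" and D :: real
  defines "n \<equiv> real DIM('a)" and "r \<equiv> dist a y"
  assumes ay: "a \<noteq> y" and D: "D > 0"
  obtains \<delta> G P where "0 < \<delta>" "\<delta> \<le> D"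
    "continuous_on (exterior_cap a y \<delta>) G"
    "continuous_on (exterior_cap a y \<delta>) P"
    "\<And>x. x \<in> exterior_cap a y \<delta> \<Longrightarrow>
       P x \<ge> 1 / (1 + ln (D / norm (x - a)))\<^sup>2 / (8 * (norm (x - a))\<^sup>2)"
    "\<And>v g. C1c (exterior_cap a y \<delta>) v g \<Longrightarrow> (\<integral>x. (norm (g x))\<^sup>2 \<partial>lborel) =
       (\<integral>x. (norm (g x - v x *\<^sub>R G x))\<^sup>2 \<partial>lborel) + n\<^sup>2 / 4 * (\<integral>x. (v x)\<^sup>2 / (norm (x - a))\<^sup>2 \<partial>lborel)
       + (\<integral>x. (v x)\<^sup>2 * P x \<partial>lborel)"
    "\<And>v g \<tau>. C1c (exterior_cap a y \<delta>) v g \<Longrightarrow> \<tau> \<ge> 0 \<Longrightarrow>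
       (\<integral>x. (v x)\<^sup>2 / (norm (x - a))\<^sup>2 * indicator {-1..1} (ln (D / norm (x - a)) - \<tau>) \<partial>lborel) \<le>
       18 * (1 + \<tau>) * ((\<integral>x. (norm (g x))\<^sup>2 \<partial>lborel) - n\<^sup>2 / 4 * (\<integral>x. (v x)\<^sup>2 / (norm (x - a))\<^sup>2 \<partial>lborel))"
proof -
  have r0: "r > 0" unfolding r_def using ay by simp
  have n1: "n \<ge> 1" unfolding n_def using DIM_positive[where 'a='a] by linarith
  define C where "C = 2 * n * (n + 2) / r"
  have C: "C > 0" unfolding C_def using n1 r0 by simp
  define \<delta> where "\<delta> = min (r / (4 * n)) (D * exp (- (648 * C * D)))"
  have \<delta>: "\<delta> > 0" "\<delta> \<le> r / (4 * n)" "\<delta> \<le> D * exp (- (648 * C * D))"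
    unfolding \<delta>_def using n1 r0 D by auto
  have "D * exp (- (648 * C * D)) \<le> D * 1" using D C by (intro mult_left_mono) auto
  then have \<delta>D: "\<delta> \<le> D" using \<delta>(3) by linarith
  let ?U = "exterior_cap a y \<delta>"
  let ?t = "\<lambda>x. ln (D / norm (x - a))"
  have xU: "norm (x - a) > 0" "?t x > 0" "C / norm (x - a) \<le> 1 / (1 + ?t x)\<^sup>2 / (8 * (norm (x - a))\<^sup>2)" if "x \<in> ?U" for x
  proof -
    show xa: "norm (x - a) > 0" using that by (auto simp: r_def)
    have xd: "norm (x - a) < \<delta>" using that by (simp add: dist_norm norm_minus_commute)
    then show "?t x > 0" using xa \<delta>D by (simp add: ln_gt_zero)
    show "C / norm (x - a) \<le> 1 / (1 + ?t x)\<^sup>2 / (8 * (norm (x - a))\<^sup>2)"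
      by (rule log_square_times_small[OF C D xa]) (use xd \<delta>(3) in linarith)
  qed
  have "\<exists>G P. continuous_on ?U G \<and> continuous_on ?U P \<and>
    (\<forall>x\<in>?U. P x \<ge> (- (- (1 / (2 * (1 + ?t x)\<^sup>2))) - (1 / (2 * (1 + ?t x)))\<^sup>2) / (norm (x - a))\<^sup>2
        - 2 * n * (n + 2) / r / norm (x - a)) \<and>
    (\<forall>v g. C1c ?U v g \<longrightarrow> (\<integral>x. (norm (g x))\<^sup>2 \<partial>lborel) =
       (\<integral>x. (norm (g x - v x *\<^sub>R G x))\<^sup>2 \<partial>lborel) + n\<^sup>2 / 4 * (\<integral>x. (v x)\<^sup>2 / (norm (x - a))\<^sup>2 \<partial>lborel)
       + (\<integral>x. (v x)\<^sup>2 * P x \<partial>lborel))"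
    unfolding n_def r_def
  proof (rule exterior_ball_Hardy[OF ay, of \<delta> D "\<lambda>t. 1 / (2 * (1 + t))" "\<lambda>t. - (1 / (2 * (1 + t)\<^sup>2))"])
    fix t :: real assume t: "t > 0"
    show "((\<lambda>t. 1 / (2 * (1 + t))) has_real_derivative - (1 / (2 * (1 + t)\<^sup>2))) (at t)"
    proof -
      have "((\<lambda>t. 1 / (2 * (1 + t))) has_real_derivative
          (0 * (2 * (1 + t)) - 1 * 2) / ((2 * (1 + t)) * (2 * (1 + t)))) (at t)"
        using t by (intro DERIV_divide derivative_eq_intros) auto
      moreover have "(0 * (2 * s) - 1 * 2) / ((2 * s) * (2 * s)) = - (1 / (2 * s\<^sup>2))" for s :: real
        by (simp add: power2_eq_square)
      ultimately show ?thesis by metis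
    qed
    show "0 \<le> 1 / (2 * (1 + t)) \<and> 1 / (2 * (1 + t)) \<le> 1" using t by simp
  qed (use \<delta> \<delta>D D in \<open>auto intro!: continuous_intros simp: n_def r_def\<close>)
  then obtain G P where G: "continuous_on ?U G" and P: "continuous_on ?U P"
    and P1: "\<And>x. x \<in> ?U \<Longrightarrow> P x \<ge> (- (- (1 / (2 * (1 + ?t x)\<^sup>2))) - (1 / (2 * (1 + ?t x)))\<^sup>2) / (norm (x - a))\<^sup>2
        - C / norm (x - a)"
    and ident: "\<And>v g. C1c ?U v g \<Longrightarrow> (\<integral>x. (norm (g x))\<^sup>2 \<partial>lborel) =
       (\<integral>x. (norm (g x - v x *\<^sub>R G x))\<^sup>2 \<partial>lborel) + n\<^sup>2 / 4 * (\<integral>x. (v x)\<^sup>2 / (norm (x - a))\<^sup>2 \<partial>lborel)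
       + (\<integral>x. (v x)\<^sup>2 * P x \<partial>lborel)"
    unfolding C_def by blast
  have Pge: "P x \<ge> 1 / (1 + ?t x)\<^sup>2 / (8 * (norm (x - a))\<^sup>2)" if "x \<in> ?U" for x
  proof -
    have "(- (- (1 / (2 * (1 + ?t x)\<^sup>2))) - (1 / (2 * (1 + ?t x)))\<^sup>2) = 2 * (1 / (1 + ?t x)\<^sup>2 / 8)"
    proof -
      have "- (- (1 / (2 * s\<^sup>2))) - (1 / (2 * s))\<^sup>2 = 2 * (1 / s\<^sup>2 / 8)" for s :: real
        by (simp add: power2_eq_square)
      then show ?thesis .
    qed
    then have "P x \<ge> 2 * (1 / (1 + ?t x)\<^sup>2 / 8) / (norm (x - a))\<^sup>2 - C / norm (x - a)"
      using P1[OF that] by metis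
    moreover have "2 * (1 / (1 + ?t x)\<^sup>2 / 8) / (norm (x - a))\<^sup>2 = 2 * (1 / (1 + ?t x)\<^sup>2 / (8 * (norm (x - a))\<^sup>2))"
      by simp
    ultimately have *: "2 * (1 / (1 + ?t x)\<^sup>2 / (8 * (norm (x - a))\<^sup>2)) - C / norm (x - a) \<le> P x"
      by (simp only:)
    have absorb: "Z \<le> Y \<Longrightarrow> 2 * Y - Z \<le> p \<Longrightarrow> Y \<le> p" for Y Z p :: real by linarith
    show ?thesis by (rule absorb[OF xU(3)[OF that] *])
  qed
  have slab: "(\<integral>x. (v x)\<^sup>2 / (norm (x - a))\<^sup>2 * indicator {-1..1} (?t x - \<tau>) \<partial>lborel) \<le>
       18 * (1 + \<tau>) * ((\<integral>x. (norm (g x))\<^sup>2 \<partial>lborel) - n\<^sup>2 / 4 * (\<integral>x. (v x)\<^sup>2 / (norm (x - a))\<^sup>2 \<partial>lborel))"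
    if v: "C1c ?U v g" and \<tau>: "\<tau> \<ge> 0" for v g \<tau>
  proof -
    obtain q q' where q: "\<And>t. t > 0 \<Longrightarrow> (q has_real_derivative q' t) (at t)" "continuous_on {0<..} q'"
      "\<And>t. t > 0 \<Longrightarrow> 0 \<le> q t \<and> q t \<le> 1"
      "\<And>t. t > 0 \<Longrightarrow> indicator {-1..1} (t - \<tau>) / (9 * (1 + \<tau>)) \<le> - q' t - (q t)\<^sup>2"
      using slab_profile[OF \<tau>] by blast
    obtain G2 P2 where G2: "continuous_on ?U P2"
      and P2: "\<And>x. x \<in> ?U \<Longrightarrow> P2 x \<ge> (- q' (?t x) - (q (?t x))\<^sup>2) / (norm (x - a))\<^sup>2 - C / norm (x - a)"
      and ident2: "(\<integral>x. (norm (g x))\<^sup>2 \<partial>lborel) =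
       (\<integral>x. (norm (g x - v x *\<^sub>R G2 x))\<^sup>2 \<partial>lborel) + n\<^sup>2 / 4 * (\<integral>x. (v x)\<^sup>2 / (norm (x - a))\<^sup>2 \<partial>lborel)
       + (\<integral>x. (v x)\<^sup>2 * P2 x \<partial>lborel)"
      using exterior_ball_Hardy[OF ay, of \<delta> D q q'] \<delta>(2) \<delta>D D q(1-3) v
      unfolding C_def n_def r_def by blast
    define E where "E = (\<integral>x. (norm (g x))\<^sup>2 \<partial>lborel) - n\<^sup>2 / 4 * (\<integral>x. (v x)\<^sup>2 / (norm (x - a))\<^sup>2 \<partial>lborel)"
    have E1: "(\<integral>x. (v x)\<^sup>2 * P x \<partial>lborel) \<le> E"
      unfolding E_def ident[OF v] by simp
    have E2: "(\<integral>x. (v x)\<^sup>2 * P2 x \<partial>lborel) \<le> E"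
      unfolding E_def ident2 by simp
    have nz: "\<forall>x\<in>?U. norm (x - a) \<noteq> 0" using xU(1) by (metis less_irrefl)
    have [measurable]: "v \<in> borel_measurable borel"
      using C1c_continuous[OF v] by (auto intro: borel_measurable_continuous_onI)
    have i0: "integrable lborel (\<lambda>x. (v x)\<^sup>2 / (norm (x - a))\<^sup>2)"
      using nz by (auto intro!: C1c_integrable[OF v] continuous_intros C1c_continuous[OF v])
    have i1: "integrable lborel (\<lambda>x. (v x)\<^sup>2 / (norm (x - a))\<^sup>2 * indicator {-1..1} (?t x - \<tau>))"
      by (rule Bochner_Integration.integrable_bound[OF i0]) (auto split: split_indicator)
    have i2: "integrable lborel (\<lambda>x. (v x)\<^sup>2 * P x)" "integrable lborel (\<lambda>x. (v x)\<^sup>2 * P2 x)"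
      by (auto intro!: C1c_integrable[OF v] continuous_intros C1c_continuous[OF v] P G2)
    have "(\<integral>x. (v x)\<^sup>2 / (norm (x - a))\<^sup>2 * indicator {-1..1} (?t x - \<tau>) \<partial>lborel) \<le>
      (\<integral>x. 9 * (1 + \<tau>) * ((v x)\<^sup>2 * P x + (v x)\<^sup>2 * P2 x) \<partial>lborel)"
    proof (rule integral_mono[OF i1])
      show "integrable lborel (\<lambda>x. 9 * (1 + \<tau>) * ((v x)\<^sup>2 * P x + (v x)\<^sup>2 * P2 x))"
        by (intro integrable_mult_right Bochner_Integration.integrable_add i2)
      fix x
      show "(v x)\<^sup>2 / (norm (x - a))\<^sup>2 * indicator {-1..1} (?t x - \<tau>) \<le> 9 * (1 + \<tau>) * ((v x)\<^sup>2 * P x + (v x)\<^sup>2 * P2 x)"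
      proof (cases "x \<in> ?U")
        case False
        then have "v x = 0" by (rule C1c_zero_outside[OF v])
        then show ?thesis by simp
      next
        case True
        let ?i = "indicator {-1..1} (?t x - \<tau>) :: real"
        have "?i / (9 * (1 + \<tau>)) / (norm (x - a))\<^sup>2 \<le> (- q' (?t x) - (q (?t x))\<^sup>2) / (norm (x - a))\<^sup>2"
          using q(4)[OF xU(2)[OF True]] by (intro divide_right_mono) auto
        then have "?i / (9 * (1 + \<tau>)) / (norm (x - a))\<^sup>2 \<le> P x + P2 x"
          using P2[OF True] Pge[OF True] xU(3)[OF True] by linarith
        then have "9 * (1 + \<tau>) * (v x)\<^sup>2 * (?i / (9 * (1 + \<tau>)) / (norm (x - a))\<^sup>2) \<le> 9 * (1 + \<tau>) * (v x)\<^sup>2 * (P x + P2 x)"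
          using \<tau> by (intro mult_left_mono) auto
        moreover have "9 * (1 + \<tau>) * (v x)\<^sup>2 * (?i / (9 * (1 + \<tau>)) / (norm (x - a))\<^sup>2) = (v x)\<^sup>2 / (norm (x - a))\<^sup>2 * ?i"
          using \<tau> by simp
        ultimately show ?thesis by (simp add: algebra_simps)
      qed
    qed
    also have "\<dots> = 9 * (1 + \<tau>) * ((\<integral>x. (v x)\<^sup>2 * P x \<partial>lborel) + (\<integral>x. (v x)\<^sup>2 * P2 x \<partial>lborel))"
      using i2 by simp
    also have "\<dots> \<le> 9 * (1 + \<tau>) * (E + E)" using E1 E2 \<tau> by (intro mult_left_mono add_mono) auto
    also have "\<dots> = 18 * (1 + \<tau>) * E" by simp
    finally show ?thesis unfolding E_def .
  qed
  show ?thesis by (rule that[OF \<delta>(1) \<delta>D G P Pge ident slab])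
qed

section \<open>The Hardy--Sobolev inequality at one boundary point\<close>

text \<open>Bounded overlap of the slabs.\<close>

lemma sum_unit_indicators_le:
  fixes t :: real
  shows "(\<Sum>j<N. indicator {-1..1} (t - real j)) \<le> (3 :: real)"
proof -
  define k where "k = nat \<lceil>t - 1\<rceil>"
  let ?J = "{j \<in> {..<N}. t - real j \<in> {-1..1}}"
  have "?J \<subseteq> {k..k + 2}"
  proof
    fix j assume "j \<in> ?J"
    then have j: "t - 1 \<le> real j" "real j \<le> t + 1" by auto
    have "\<lceil>t - 1\<rceil> \<le> int j" using j(1) by linarith
    moreover have "int j \<le> \<lceil>t - 1\<rceil> + 2" using j(2) by linarith
    ultimately show "j \<in> {k..k + 2}" unfolding k_def by auto
  qed
  then have "card ?J \<le> 3" using card_mono[of "{k..k + 2}" ?J] by simp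
  moreover have "(\<Sum>j<N. indicator {-1..1} (t - real j)) = (real (card ?J) :: real)"
  proof -
    have "(\<Sum>j<N. indicator {-1..1} (t - real j)) = (\<Sum>j\<in>?J. (1::real))"
      by (intro sum.mono_neutral_cong_right) (auto simp: indicator_def)
    then show ?thesis by simp
  qed
  ultimately show ?thesis by simp
qed

definition bump :: "real \<Rightarrow> real" where "bump s = 1 - smooth_step (2 * s\<^sup>2)"

definition bump' :: "real \<Rightarrow> real" where "bump' s = - (smooth_step' (2 * s\<^sup>2) * (4 * s))"

lemma DERIV_bump: "(bump has_real_derivative bump' s) (at s)"
proof -
  have "((\<lambda>s. 2 * s\<^sup>2) has_real_derivative 4 * s) (at s)"
    by (auto intro!: derivative_eq_intros)
  from DERIV_chain2[OF DERIV_smooth_step this]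
  show ?thesis unfolding bump_def[abs_def] bump'_def by (auto intro!: derivative_eq_intros)
qed

lemma continuous_on_bump': "continuous_on S bump'"
  unfolding bump'_def[abs_def]
  by (intro continuous_intros continuous_on_compose2[OF continuous_on_smooth_step'[of UNIV]]) auto

lemma bump_square_le: "(bump s)\<^sup>2 \<le> indicator {-1..1} s"
proof (cases "s \<in> {-1..1}")
  case True
  then show ?thesis
    using smooth_step_bounds[of "2 * s\<^sup>2"] by (simp add: bump_def abs_square_le_1)
next
  case False
  then have "1 \<le> s\<^sup>2" using abs_le_square_iff[of 1 s] by auto
  then show ?thesis using False by (simp add: bump_def smooth_step_eq_1)
qed

lemma bump'_square_le: "(bump' s)\<^sup>2 \<le> 64 * indicator {-1..1} s"
proof (cases "s \<in> {-1..1}")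
  case True
  have "(bump' s)\<^sup>2 = (smooth_step' (2 * s\<^sup>2))\<^sup>2 * (16 * s\<^sup>2)"
    by (simp add: bump'_def power_mult_distrib)
  also have "\<dots> \<le> 2\<^sup>2 * (16 * 1)"
    using smooth_step'_bounds[of "2 * s\<^sup>2"] True abs_square_le_1[of s]
    by (intro mult_mono power_mono) auto
  finally show ?thesis using True by simp
next
  case False
  then have "1 \<le> s\<^sup>2" using abs_le_square_iff[of 1 s] by auto
  then show ?thesis using False by (simp add: bump'_def smooth_step'_eq_0)
qed

lemma bump_eq_1:
  assumes "\<bar>s\<bar> \<le> 1 / 2" shows "bump s = 1"
proof -
  have "s\<^sup>2 \<le> (1 / 2)\<^sup>2" using assms abs_le_square_iff[of s "1 / 2"] by simp
  then show ?thesis unfolding bump_def by (simp add: smooth_step_eq_0 power2_eq_square)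
qed

text \<open>The density \<open>f = |\<nabla>v - vG|\<^sup>2 + P v\<^sup>2\<close> of the remainder energy \<open>E\<close> is nonnegative, so it may be
localised: cutting \<open>v\<close> off to the slab \<open>|t-j| \<le> 1\<close> produces energy at most \<open>F\<^sub>j\<close>, the integral of
\<open>2f + \<kappa> v\<^sup>2/\<rho>\<^sup>2\<close> over that slab. The logarithmic Hardy inequality alone would allow \<open>F\<^sub>j\<close> to grow
like \<open>(1+j)\<^sup>2 E\<close> and lose a power of the weight; the slab estimate improves this to \<open>(1+j) E\<close>,
while the former makes \<open>F\<^sub>j/(1+j)\<^sup>2\<close> summable. Interpolating between the two bounds
sums the local Sobolev inequalities. The constants come from \<open>n\<close> alone; \<open>a\<close>, \<open>y\<close> and \<open>D\<close> only
determine \<open>\<delta>\<close>.\<close>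

theorem exterior_ball_Hardy_Sobolev:
  fixes p :: real
  assumes n3: "DIM('a::euclidean_space) \<ge> 3" and p: "p = real DIM('a) / (real DIM('a) - 2)"
  shows "\<exists>c>0. \<forall>(a::'a) y D. a \<noteq> y \<and> D > 0 \<longrightarrow> (\<exists>\<delta>>0. \<forall>v g.
    C1c (exterior_cap a y \<delta>) v g \<longrightarrow>
      (real DIM('a))\<^sup>2 / 4 * (\<integral>x. (v x)\<^sup>2 / (norm (x - a))\<^sup>2 \<partial>lborel)
      + c * (\<integral>x. \<bar>v x\<bar> powr (2 * p) * X1 (norm (x - a) / D) powr (1 + p) \<partial>lborel) powr (1 / p)
      \<le> (\<integral>x. (norm (g x))\<^sup>2 \<partial>lborel))"
proof -
  define n where "n = real DIM('a)"
  have n: "n \<ge> 3" using n3 by (simp add: n_def)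
  have p1: "p > 1" using n unfolding p n_def[symmetric] by (simp add: field_simps)
  obtain S where S: "S > 0" and Sob: "\<And>U (v :: 'a \<Rightarrow> real) g. C1c U v g \<Longrightarrow>
    (\<integral>x. \<bar>v x\<bar> powr (2 * p) \<partial>lborel) \<le> (S * (\<integral>x. (norm (g x))\<^sup>2 \<partial>lborel)) powr p"
    using Sobolev[OF n3 p] by blast
  \<comment> \<open>\<open>128 = 2 * 64\<close> pays for the gradient of the cut-off, \<open>n\<^sup>2/4\<close> for the Hardy term of the piece.\<close>
  define \<kappa> where "\<kappa> = 128 + n\<^sup>2 / 4"
  have \<kappa>: "\<kappa> > 0" unfolding \<kappa>_def by (simp add: add_pos_nonneg)
  define Ca where "Ca = 2 + 18 * \<kappa>"
  define Cb where "Cb = 3 * (2 + 32 * \<kappa>)"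
  have CC: "Ca > 0" "Cb > 0" unfolding Ca_def Cb_def using \<kappa> by simp_all
  define M where "M = 2 powr (1 + p) * S powr p * Ca powr (p - 1) * Cb"
  have M: "M > 0" unfolding M_def using S CC by simp
  have main: "\<exists>\<delta>>0. \<forall>v g. C1c (exterior_cap a y \<delta>) v g \<longrightarrow>
      n\<^sup>2 / 4 * (\<integral>x. (v x)\<^sup>2 / (norm (x - a))\<^sup>2 \<partial>lborel)
      + 1 / M powr (1 / p) * (\<integral>x. \<bar>v x\<bar> powr (2 * p) * X1 (norm (x - a) / D) powr (1 + p) \<partial>lborel) powr (1 / p)
      \<le> (\<integral>x. (norm (g x))\<^sup>2 \<partial>lborel)" if ay: "a \<noteq> y" and D: "D > 0" for a y :: 'a and D
  proof -
    obtain \<delta> G P where \<delta>: "0 < \<delta>" "\<delta> \<le> D" and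
      G: "continuous_on (exterior_cap a y \<delta>) G" and
      P: "continuous_on (exterior_cap a y \<delta>) P" and
      Pge: "\<And>x. x \<in> exterior_cap a y \<delta> \<Longrightarrow>
         P x \<ge> 1 / (1 + ln (D / norm (x - a)))\<^sup>2 / (8 * (norm (x - a))\<^sup>2)" and
      ident: "\<And>v g. C1c (exterior_cap a y \<delta>) v g \<Longrightarrow> (\<integral>x. (norm (g x))\<^sup>2 \<partial>lborel) =
         (\<integral>x. (norm (g x - v x *\<^sub>R G x))\<^sup>2 \<partial>lborel) + n\<^sup>2 / 4 * (\<integral>x. (v x)\<^sup>2 / (norm (x - a))\<^sup>2 \<partial>lborel)
         + (\<integral>x. (v x)\<^sup>2 * P x \<partial>lborel)" and
      slab: "\<And>v g \<tau>. C1c (exterior_cap a y \<delta>) v g \<Longrightarrow> \<tau> \<ge> 0 \<Longrightarrow>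
         (\<integral>x. (v x)\<^sup>2 / (norm (x - a))\<^sup>2 * indicator {-1..1} (ln (D / norm (x - a)) - \<tau>) \<partial>lborel) \<le>
         18 * (1 + \<tau>) * ((\<integral>x. (norm (g x))\<^sup>2 \<partial>lborel) - n\<^sup>2 / 4 * (\<integral>x. (v x)\<^sup>2 / (norm (x - a))\<^sup>2 \<partial>lborel))"
      by (rule exterior_ball_log_Hardy[OF ay D, folded n_def]) (assumption | blast)+
    define U where "U = exterior_cap a y \<delta>"
    note G = G[folded U_def] and P = P[folded U_def] and Pge = Pge[folded U_def]
      and ident = ident[folded U_def] and slab = slab[folded U_def]
    have openU: "open U" unfolding U_def by (intro open_Int open_Collect_less continuous_intros) auto
    define t where "t x = ln D - ln ((x - a) \<bullet> (x - a)) / 2" for x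
    have inU: "norm (x - a) > 0" "t x > 0" "t x = ln (D / norm (x - a))" "X1 (norm (x - a) / D) = 1 / (1 + t x)" if "x \<in> U" for x
    proof -
      show xa: "norm (x - a) > 0" using that by (auto simp: U_def)
      have xd: "norm (x - a) < \<delta>" using that by (simp add: U_def dist_norm norm_minus_commute)
      have "(x - a) \<bullet> (x - a) = (norm (x - a))\<^sup>2" by (simp add: power2_norm_eq_inner)
      then show t: "t x = ln (D / norm (x - a))"
        unfolding t_def using xa D by (simp add: ln_div ln_realpow)
      then show "t x > 0" using xa xd \<delta>(2) by (simp add: ln_gt_zero)
      show "X1 (norm (x - a) / D) = 1 / (1 + t x)"
        unfolding X1_def t using xa D by (simp add: ln_div)
    qed
    have nz: "\<forall>x\<in>U. norm (x - a) \<noteq> 0" using inU(1) by (metis less_irrefl)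
    define tg where "tg x = - (1 / (norm (x - a))\<^sup>2) *\<^sub>R (x - a)" for x
    have dt: "(t has_derivative (\<lambda>h. tg x \<bullet> h)) (at x)" if "x \<in> U" for x
    proof -
      have pos: "(x - a) \<bullet> (x - a) > 0" using inU(1)[OF that] by simp
      have "((\<lambda>x. (x - a) \<bullet> (x - a)) has_derivative (\<lambda>h. (2 *\<^sub>R (x - a)) \<bullet> h)) (at x)"
        by (auto intro!: derivative_eq_intros simp: inner_commute)
      moreover have "((\<lambda>s. ln D - ln s / 2) has_real_derivative - (1 / (2 * ((x - a) \<bullet> (x - a))))) (at ((x - a) \<bullet> (x - a)))"
        using pos by (auto intro!: derivative_eq_intros)
      ultimately have "(t has_derivative (\<lambda>h. (- (1 / (2 * ((x - a) \<bullet> (x - a)))) *\<^sub>R (2 *\<^sub>R (x - a))) \<bullet> h)) (at x)"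
        unfolding t_def[abs_def] by (rule has_derivative_scalar_compose)
      moreover have "- (1 / (2 * ((x - a) \<bullet> (x - a)))) *\<^sub>R (2 *\<^sub>R (x - a)) = tg x"
        unfolding tg_def power2_norm_eq_inner by simp
      ultimately show ?thesis by (simp only:)
    qed
    have ct: "continuous_on U t"
      using dt has_derivative_continuous continuous_at_imp_continuous_on by metis
    have ctg: "continuous_on U tg"
      unfolding tg_def[abs_def] using nz by (intro continuous_intros) auto
    have norm_tg: "(norm (tg x))\<^sup>2 = 1 / (norm (x - a))\<^sup>2" if "x \<in> U" for x
      using inU(1)[OF that] by (simp add: tg_def power2_eq_square)
    have "n\<^sup>2 / 4 * (\<integral>x. (v x)\<^sup>2 / (norm (x - a))\<^sup>2 \<partial>lborel)
      + 1 / M powr (1 / p) * (\<integral>x. \<bar>v x\<bar> powr (2 * p) * X1 (norm (x - a) / D) powr (1 + p) \<partial>lborel) powr (1 / p)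
      \<le> (\<integral>x. (norm (g x))\<^sup>2 \<partial>lborel)" if v: "C1c U v g" for v g
    proof -
      define E where "E = (\<integral>x. (norm (g x))\<^sup>2 \<partial>lborel) - n\<^sup>2 / 4 * (\<integral>x. (v x)\<^sup>2 / (norm (x - a))\<^sup>2 \<partial>lborel)"
      define ind :: "nat \<Rightarrow> 'a \<Rightarrow> real" where "ind j x = indicator {-1..1} (t x - real j)" for j x
      have [measurable]: "v \<in> borel_measurable borel" "g \<in> borel_measurable borel" "t \<in> borel_measurable borel"
        using C1c_continuous[OF v] by (auto intro: borel_measurable_continuous_onI simp: t_def[abs_def])
      have ind_meas[measurable]: "ind j \<in> borel_measurable borel" for j unfolding ind_def by measurable
      have ind01: "0 \<le> ind j x" "ind j x \<le> 1" for j x unfolding ind_def by (auto split: split_indicator)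
      have Ppos: "P x \<ge> 0" if "x \<in> U" for x
      proof -
        have "0 \<le> 1 / (1 + ln (D / norm (x - a)))\<^sup>2 / (8 * (norm (x - a))\<^sup>2)" by simp
        then show ?thesis using Pge[OF that] by (rule order_trans)
      qed
      \<comment> \<open>\<open>f\<close> is the density of \<open>E\<close>, and \<open>m\<close> that of the Hardy term.\<close>
      define f where "f x = (norm (g x - v x *\<^sub>R G x))\<^sup>2 + (v x)\<^sup>2 * P x" for x
      define m where "m x = (v x)\<^sup>2 / (norm (x - a))\<^sup>2" for x
      have out: "v x = 0" "g x = 0" if "x \<notin> U" for x using C1c_zero_outside[OF v that] by auto
      have f0: "f x \<ge> 0" for x
        using Ppos[of x] out[of x] unfolding f_def by (cases "x \<in> U") auto
      have m0: "m x \<ge> 0" for x unfolding m_def by simp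
      have if1: "integrable lborel (\<lambda>x. (norm (g x - v x *\<^sub>R G x))\<^sup>2)" "integrable lborel (\<lambda>x. (v x)\<^sup>2 * P x)"
        by (auto intro!: C1c_integrable[OF v] continuous_intros C1c_continuous[OF v] G P)
      have i_f: "integrable lborel f" unfolding f_def[abs_def] by (intro Bochner_Integration.integrable_add if1)
      have i_m: "integrable lborel m"
        unfolding m_def[abs_def] using nz by (auto intro!: C1c_integrable[OF v] continuous_intros C1c_continuous[OF v])
      have int_f: "(\<integral>x. f x \<partial>lborel) = E"
        unfolding E_def f_def using ident[of v g] v if1 by simp
      have E0: "E \<ge> 0" unfolding int_f[symmetric] using f0 by simp
      have i_ind: "integrable lborel (\<lambda>x. ind j x * h x)" if "integrable lborel h" for h j
        using that ind01 by (intro Bochner_Integration.integrable_bound[OF that]) (auto simp: abs_mult mult_left_le_one_le)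
      define F where "F j = (\<integral>x. ind j x * (2 * f x + \<kappa> * m x) \<partial>lborel)" for j
      have i_F: "integrable lborel (\<lambda>x. ind j x * (2 * f x + \<kappa> * m x))" for j
        by (intro i_ind Bochner_Integration.integrable_add integrable_mult_right i_f i_m)
      have F0: "F j \<ge> 0" for j
        unfolding F_def using ind01 f0 m0 \<kappa> by simp
      have Fa: "F j \<le> Ca * (1 + real j) * E" for j
      proof -
        have "F j = 2 * (\<integral>x. ind j x * f x \<partial>lborel) + \<kappa> * (\<integral>x. ind j x * m x \<partial>lborel)"
          unfolding F_def using i_ind[OF i_f] i_ind[OF i_m]
          by (simp add: distrib_left mult.left_commute[of _ 2] mult.left_commute[of _ \<kappa>])
        also have "(\<integral>x. ind j x * f x \<partial>lborel) \<le> (\<integral>x. f x \<partial>lborel)"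
          using ind01 f0 by (intro integral_mono i_ind i_f) (auto simp: mult_left_le_one_le)
        also have "(\<integral>x. ind j x * m x \<partial>lborel) =
           (\<integral>x. (v x)\<^sup>2 / (norm (x - a))\<^sup>2 * indicator {-1..1} (ln (D / norm (x - a)) - real j) \<partial>lborel)"
        proof (intro Bochner_Integration.integral_cong refl)
          fix x show "ind j x * m x = (v x)\<^sup>2 / (norm (x - a))\<^sup>2 * indicator {-1..1} (ln (D / norm (x - a)) - real j)"
            using inU(3)[of x] out[of x] by (cases "x \<in> U") (auto simp: ind_def m_def)
        qed
        also have "\<dots> \<le> 18 * (1 + real j) * E"
          unfolding E_def using slab[of v g "real j"] v by simp
        finally have "F j \<le> 2 * E + \<kappa> * (18 * (1 + real j) * E)"
          using \<kappa> int_f by simp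
        moreover have "2 * E \<le> 2 * ((1 + real j) * E)" using E0 by (simp add: mult_left_le algebra_simps)
        ultimately show ?thesis unfolding Ca_def by (simp add: algebra_simps)
      qed
      have Fb: "(\<Sum>j<N. F j / (1 + real j)\<^sup>2) \<le> Cb * E" for N
      proof -
        have "(\<Sum>j<N. F j / (1 + real j)\<^sup>2) = (\<integral>x. (\<Sum>j<N. ind j x * (2 * f x + \<kappa> * m x) / (1 + real j)\<^sup>2) \<partial>lborel)"
          unfolding F_def using i_F by (subst Bochner_Integration.integral_sum) auto
        also have "\<dots> \<le> (\<integral>x. Cb * f x \<partial>lborel)"
        proof (rule integral_mono)
          show "integrable lborel (\<lambda>x. \<Sum>j<N. ind j x * (2 * f x + \<kappa> * m x) / (1 + real j)\<^sup>2)"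
            using i_F by (intro Bochner_Integration.integrable_sum) auto
          show "integrable lborel (\<lambda>x. Cb * f x)" using i_f by (rule integrable_mult_right)
          fix x
          have "ind j x * (2 * f x + \<kappa> * m x) / (1 + real j)\<^sup>2 \<le> ind j x * ((2 + 32 * \<kappa>) * f x)" for j
          proof (cases "x \<in> U \<and> t x - real j \<in> {-1..1}")
            case False
            then show ?thesis
              using out[of x] by (auto simp: ind_def f_def m_def)
          next
            case True
            then have x: "x \<in> U" and tj: "t x \<le> 1 + real j" by auto
            have t0: "t x > 0" using inU(2)[OF x] .
            have "m x = 8 * ((1 + t x)\<^sup>2 * ((v x)\<^sup>2 * (1 / (1 + t x)\<^sup>2 / (8 * (norm (x - a))\<^sup>2))))"
              unfolding m_def using t0 by simp
            also have "\<dots> \<le> 8 * ((1 + t x)\<^sup>2 * ((v x)\<^sup>2 * P x))"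
              using Pge[of x] x inU(3)[OF x] by (intro mult_left_mono) auto
            also have "\<dots> \<le> 8 * ((2 * (1 + real j))\<^sup>2 * f x)"
              using tj t0 Ppos[OF x] unfolding f_def by (intro mult_left_mono mult_mono power_mono) auto
            also have "(2 * (1 + real j))\<^sup>2 = 4 * (1 + real j)\<^sup>2" by (simp only: power_mult_distrib) simp
            finally have "m x \<le> 32 * f x * (1 + real j)\<^sup>2" by (simp add: mult_ac)
            then have "m x / (1 + real j)\<^sup>2 \<le> 32 * f x" by (simp add: divide_le_eq)
            moreover have "f x / (1 + real j)\<^sup>2 \<le> f x"
              using f0[of x] by (simp add: divide_le_eq mult_le_cancel_left1 one_le_power)
            ultimately have "2 * (f x / (1 + real j)\<^sup>2) + \<kappa> * (m x / (1 + real j)\<^sup>2) \<le> 2 * f x + \<kappa> * (32 * f x)"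
              using \<kappa> by (intro add_mono mult_left_mono) auto
            then show ?thesis using True by (simp add: ind_def add_divide_distrib algebra_simps)
          qed
          then have "(\<Sum>j<N. ind j x * (2 * f x + \<kappa> * m x) / (1 + real j)\<^sup>2) \<le> (\<Sum>j<N. ind j x * ((2 + 32 * \<kappa>) * f x))"
            by (intro sum_mono)
          also have "\<dots> = (\<Sum>j<N. ind j x) * ((2 + 32 * \<kappa>) * f x)" by (simp add: sum_distrib_right)
          also have "\<dots> \<le> 3 * ((2 + 32 * \<kappa>) * f x)"
            using sum_unit_indicators_le[where N = N and t = "t x"] f0[of x] \<kappa>
            unfolding ind_def by (intro mult_right_mono) auto
          finally show "(\<Sum>j<N. ind j x * (2 * f x + \<kappa> * m x) / (1 + real j)\<^sup>2) \<le> Cb * f x"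
            by (simp only: Cb_def mult.assoc)
        qed
        also have "\<dots> = Cb * E" using int_f by simp
        finally show ?thesis .
      qed
      define vj where "vj j x = bump (t x - real j) * v x" for j x
      define gj where "gj j x = bump (t x - real j) *\<^sub>R g x + v x *\<^sub>R (bump' (t x - real j) *\<^sub>R tg x)" for j x
      have C: "C1c U (vj j) (gj j)" for j
        unfolding vj_def[abs_def] gj_def[abs_def]
      proof (rule C1c_mult[OF openU v])
        fix x assume x: "x \<in> U"
        have "((\<lambda>s. bump (s - real j)) has_real_derivative bump' (t x - real j)) (at (t x))"
          using DERIV_shift[of bump "bump' (t x - real j)" "t x" "- real j"] DERIV_bump by simp
        then show "((\<lambda>x. bump (t x - real j)) has_derivative (\<lambda>h. (bump' (t x - real j) *\<^sub>R tg x) \<bullet> h)) (at x)"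
          by (rule has_derivative_scalar_compose[OF dt[OF x]])
      next
        show "continuous_on U (\<lambda>x. bump' (t x - real j) *\<^sub>R tg x)"
          by (intro continuous_intros ctg ct continuous_on_compose2[OF continuous_on_bump'[of UNIV]]) auto
      qed
      have energy: "(\<integral>x. (norm (gj j x))\<^sup>2 \<partial>lborel) \<le> F j" for j
      proof -
        have i: "integrable lborel (\<lambda>x. (norm (gj j x - vj j x *\<^sub>R G x))\<^sup>2)" "integrable lborel (\<lambda>x. (vj j x)\<^sup>2 * P x)"
          "integrable lborel (\<lambda>x. (vj j x)\<^sup>2 / (norm (x - a))\<^sup>2)"
          using nz by (auto intro!: C1c_integrable[OF C[of j]] continuous_intros C1c_continuous[OF C[of j]] G P)
        have i3: "integrable lborel (\<lambda>x. n\<^sup>2 / 4 * ((vj j x)\<^sup>2 / (norm (x - a))\<^sup>2))"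
          by (intro integrable_mult_right i)
        have "(\<integral>x. (norm (gj j x))\<^sup>2 \<partial>lborel) = (\<integral>x. (norm (gj j x - vj j x *\<^sub>R G x))\<^sup>2 \<partial>lborel)
           + (\<integral>x. n\<^sup>2 / 4 * ((vj j x)\<^sup>2 / (norm (x - a))\<^sup>2) \<partial>lborel) + (\<integral>x. (vj j x)\<^sup>2 * P x \<partial>lborel)"
          using ident[of "vj j" "gj j"] C by (simp only: integral_mult_right_zero)
        also have "\<dots> = (\<integral>x. (norm (gj j x - vj j x *\<^sub>R G x))\<^sup>2 + n\<^sup>2 / 4 * ((vj j x)\<^sup>2 / (norm (x - a))\<^sup>2)
            + (vj j x)\<^sup>2 * P x \<partial>lborel)"
          using Bochner_Integration.integral_add[OF Bochner_Integration.integrable_add[OF i(1) i3] i(2)]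
            Bochner_Integration.integral_add[OF i(1) i3] by metis
        also have "\<dots> \<le> F j" unfolding F_def
        proof (rule integral_mono[OF _ i_F])
          show "integrable lborel (\<lambda>x. (norm (gj j x - vj j x *\<^sub>R G x))\<^sup>2 + n\<^sup>2 / 4 * ((vj j x)\<^sup>2 / (norm (x - a))\<^sup>2)
            + (vj j x)\<^sup>2 * P x)" by (intro Bochner_Integration.integrable_add i i3)
          fix x
          show "(norm (gj j x - vj j x *\<^sub>R G x))\<^sup>2 + n\<^sup>2 / 4 * ((vj j x)\<^sup>2 / (norm (x - a))\<^sup>2) + (vj j x)\<^sup>2 * P x
            \<le> ind j x * (2 * f x + \<kappa> * m x)"
          proof (cases "x \<in> U")
            case False
            then show ?thesis using out[of x] by (simp add: gj_def vj_def f_def m_def)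
          next
            case x: True
            define b where "b = bump (t x - real j)"
            define b' where "b' = bump' (t x - real j)"
            define w where "w = g x - v x *\<^sub>R G x"
            have b: "b\<^sup>2 \<le> ind j x" "b'\<^sup>2 \<le> 64 * ind j x"
              unfolding b_def b'_def ind_def by (rule bump_square_le bump'_square_le)+
            have "gj j x - vj j x *\<^sub>R G x = b *\<^sub>R w + (v x * b') *\<^sub>R tg x"
              unfolding gj_def vj_def w_def b_def b'_def by (simp add: algebra_simps)
            also have "(norm \<dots>)\<^sup>2 \<le> 2 * (norm (b *\<^sub>R w))\<^sup>2 + 2 * (norm ((v x * b') *\<^sub>R tg x))\<^sup>2"
            proof -
              have "(norm (u + w))\<^sup>2 \<le> 2 * (norm u)\<^sup>2 + 2 * (norm w)\<^sup>2" for u w :: 'a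
              proof -
                have "(norm (u + w))\<^sup>2 \<le> (norm u + norm w)\<^sup>2" by (intro power_mono norm_triangle_ineq) auto
                also have "\<dots> \<le> 2 * (norm u)\<^sup>2 + 2 * (norm w)\<^sup>2"
                  using zero_le_power2[of "norm u - norm w"] by (simp add: power2_eq_square algebra_simps)
                finally show ?thesis .
              qed
              then show ?thesis .
            qed
            also have "\<dots> = 2 * (b\<^sup>2 * (norm w)\<^sup>2) + 2 * (b'\<^sup>2 * m x)"
              using norm_tg[OF x] by (simp add: power_mult_distrib m_def)
            finally have "(norm (gj j x - vj j x *\<^sub>R G x))\<^sup>2 + n\<^sup>2 / 4 * ((vj j x)\<^sup>2 / (norm (x - a))\<^sup>2) + (vj j x)\<^sup>2 * P x
              \<le> 2 * (b\<^sup>2 * (norm w)\<^sup>2) + 2 * (b'\<^sup>2 * m x) + n\<^sup>2 / 4 * (b\<^sup>2 * m x) + b\<^sup>2 * ((v x)\<^sup>2 * P x)"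
              by (simp add: vj_def b_def m_def power_mult_distrib mult.assoc)
            also have "\<dots> \<le> 2 * (ind j x * (norm w)\<^sup>2) + 2 * (64 * ind j x * m x) + n\<^sup>2 / 4 * (ind j x * m x) + ind j x * (2 * ((v x)\<^sup>2 * P x))"
            proof -
              have "b\<^sup>2 * z \<le> ind j x * (2 * z)" if "z \<ge> 0" for z
                by (rule mult_mono[OF b(1)]) (use that ind01 in auto)
              then have "b\<^sup>2 * ((v x)\<^sup>2 * P x) \<le> ind j x * (2 * ((v x)\<^sup>2 * P x))"
                using Ppos[OF x] by simp
              then show ?thesis
                using b m0[of x] by (intro add_mono mult_left_mono mult_right_mono) auto
            qed
            also have "\<dots> = ind j x * (2 * f x + \<kappa> * m x)"
              unfolding f_def w_def[symmetric] \<kappa>_def by (simp add: algebra_simps)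
            finally show ?thesis .
          qed
        qed
        finally show ?thesis .
      qed
      obtain K where K: "compact K" "K \<subseteq> U" "\<And>x. x \<notin> K \<Longrightarrow> v x = 0"
        using C1cE[OF v] by metis
      have "bounded (t ` K)"
        using K continuous_on_subset[OF ct] by (intro compact_imp_bounded compact_continuous_image) auto
      then obtain T where T: "\<And>x. x \<in> K \<Longrightarrow> t x \<le> T"
        unfolding bounded_pos by (metis abs_ge_self image_eqI order_trans real_norm_def)
      \<comment> \<open>The support stays away from \<open>a\<close>, so finitely many slabs cover it.\<close>
      obtain N where N: "T + 1 < real N" using reals_Archimedean2 by blast
      have i_vj: "integrable lborel (\<lambda>x. \<bar>vj j x\<bar> powr (2 * p))" for j
        using p1 by (intro C1c_integrable[OF C[of j]] powr_double_continuous[OF C[of j]]) auto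
      have "(\<integral>x. \<bar>v x\<bar> powr (2 * p) * X1 (norm (x - a) / D) powr (1 + p) \<partial>lborel)
        \<le> (\<integral>x. (\<Sum>j<N. 2 powr (1 + p) * (1 + real j) powr (- (1 + p)) * \<bar>vj j x\<bar> powr (2 * p)) \<partial>lborel)"
      proof (rule integral_mono)
        show "integrable lborel (\<lambda>x. \<Sum>j<N. 2 powr (1 + p) * (1 + real j) powr (- (1 + p)) * \<bar>vj j x\<bar> powr (2 * p))"
          by (intro Bochner_Integration.integrable_sum integrable_mult_right i_vj)
        have "integrable lborel (\<lambda>x. \<bar>v x\<bar> powr (2 * p) * (1 / (1 + t x)) powr (1 + p))"
        proof (rule C1c_integrable[OF v])
          have "\<forall>x\<in>U. 1 + t x \<noteq> 0" using inU(2) by force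
          then show "continuous_on U (\<lambda>x. \<bar>v x\<bar> powr (2 * p) * (1 / (1 + t x)) powr (1 + p))"
            using p1 inU(2) by (intro continuous_intros powr_double_continuous[OF v] continuous_on_powr' ct) (auto simp: less_imp_le)
        qed simp
        moreover have "(\<lambda>x. \<bar>v x\<bar> powr (2 * p) * (1 / (1 + t x)) powr (1 + p)) = (\<lambda>x. \<bar>v x\<bar> powr (2 * p) * X1 (norm (x - a) / D) powr (1 + p))"
        proof
          fix x show "\<bar>v x\<bar> powr (2 * p) * (1 / (1 + t x)) powr (1 + p) = \<bar>v x\<bar> powr (2 * p) * X1 (norm (x - a) / D) powr (1 + p)"
            using inU(4)[of x] out[of x] by (cases "x \<in> U") auto
        qed
        ultimately show "integrable lborel (\<lambda>x. \<bar>v x\<bar> powr (2 * p) * X1 (norm (x - a) / D) powr (1 + p))" by simp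
        fix x
        have nonneg: "0 \<le> 2 powr (1 + p) * (1 + real j) powr (- (1 + p)) * \<bar>vj j x\<bar> powr (2 * p)" for j by simp
        show "\<bar>v x\<bar> powr (2 * p) * X1 (norm (x - a) / D) powr (1 + p) \<le>
          (\<Sum>j<N. 2 powr (1 + p) * (1 + real j) powr (- (1 + p)) * \<bar>vj j x\<bar> powr (2 * p))"
        proof (cases "x \<in> K")
          case False
          then show ?thesis using K(3) nonneg by (simp add: sum_nonneg)
        next
          case True
          then have x: "x \<in> U" using K by auto
          have t0: "t x > 0" using inU(2)[OF x] .
          \<comment> \<open>The integer nearest to \<open>t x\<close>: the cut-off number \<open>j\<close> equals \<open>1\<close> there.\<close>
          define j where "j = nat \<lfloor>t x + 1 / 2\<rfloor>"
          have "real j = of_int \<lfloor>t x + 1 / 2\<rfloor>" unfolding j_def using t0 by simp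
          then have j: "real j \<le> t x + 1 / 2" "t x - 1 / 2 \<le> real j" by linarith+
          have jN: "j < N" using j(1) T[OF True] N by linarith
          have "\<bar>t x - real j\<bar> \<le> 1 / 2" using j by linarith
          then have vj: "vj j x = v x" unfolding vj_def by (simp add: bump_eq_1)
          have "X1 (norm (x - a) / D) \<le> 2 * (1 / (1 + real j))"
            unfolding inU(4)[OF x] using t0 j by (simp add: field_simps)
          then have "X1 (norm (x - a) / D) powr (1 + p) \<le> (2 * (1 / (1 + real j))) powr (1 + p)"
            unfolding inU(4)[OF x] using t0 p1 by (intro powr_mono2) auto
          also have "\<dots> = 2 powr (1 + p) * (1 + real j) powr (- (1 + p))"
            by (simp only: powr_mult powr_minus_divide powr_divide powr_one_eq_one)
          finally have "\<bar>v x\<bar> powr (2 * p) * X1 (norm (x - a) / D) powr (1 + p) \<le> 2 powr (1 + p) * (1 + real j) powr (- (1 + p)) * \<bar>vj j x\<bar> powr (2 * p)"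
            unfolding vj by (subst mult.commute) (intro mult_right_mono, auto)
          also have "\<dots> \<le> (\<Sum>j<N. 2 powr (1 + p) * (1 + real j) powr (- (1 + p)) * \<bar>vj j x\<bar> powr (2 * p))"
            using jN nonneg by (intro member_le_sum) auto
          finally show ?thesis .
        qed
      qed
      also have "\<dots> = (\<Sum>j<N. 2 powr (1 + p) * (1 + real j) powr (- (1 + p)) * (\<integral>x. \<bar>vj j x\<bar> powr (2 * p) \<partial>lborel))"
        using i_vj by (subst Bochner_Integration.integral_sum) (auto intro!: integrable_mult_right)
      also have "\<dots> \<le> (\<Sum>j<N. 2 powr (1 + p) * S powr p * (Ca * E) powr (p - 1) * (F j / (1 + real j)\<^sup>2))"
      proof (rule sum_mono)
        fix j
        let ?J = "1 + real j"
        have "(\<integral>x. \<bar>vj j x\<bar> powr (2 * p) \<partial>lborel) \<le> (S * F j) powr p"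
          using Sob[OF C[of j]] powr_mono2[of p "S * (\<integral>x. (norm (gj j x))\<^sup>2 \<partial>lborel)" "S * F j"] energy[of j] S p1
          by (simp add: mult_left_mono)
        also have "\<dots> = S powr p * F j powr p" using S F0 by (simp add: powr_mult)
        also have "F j powr p = F j powr (p - 1) * F j"
          using F0[of j] by (cases "F j = 0") (auto simp: powr_diff)
        \<comment> \<open>The power \<open>p - 1\<close> takes the pointwise bound; the remaining factor is kept for the summation.\<close>
        also have "F j powr (p - 1) \<le> (Ca * ?J * E) powr (p - 1)"
          using Fa F0 p1 by (intro powr_mono2) auto
        also have "(Ca * ?J * E) powr (p - 1) = (Ca * E) powr (p - 1) * ?J powr (p - 1)"
          using CC E0 by (simp add: powr_mult mult_ac)
        finally have "(\<integral>x. \<bar>vj j x\<bar> powr (2 * p) \<partial>lborel) \<le> S powr p * ((Ca * E) powr (p - 1) * ?J powr (p - 1) * F j)"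
          using S F0 by (simp add: mult_left_mono mult_right_mono)
        then have "2 powr (1 + p) * ?J powr (- (1 + p)) * (\<integral>x. \<bar>vj j x\<bar> powr (2 * p) \<partial>lborel)
          \<le> 2 powr (1 + p) * ?J powr (- (1 + p)) * (S powr p * ((Ca * E) powr (p - 1) * ?J powr (p - 1) * F j))"
          by (intro mult_left_mono) auto
        also have "\<dots> = 2 powr (1 + p) * S powr p * (Ca * E) powr (p - 1) * ((?J powr (- (1 + p)) * ?J powr (p - 1)) * F j)"
          by (simp add: mult_ac)
        also have "?J powr (- (1 + p)) * ?J powr (p - 1) = 1 / ?J\<^sup>2"
        proof -
          have "?J powr (- (1 + p)) * ?J powr (p - 1) = ?J powr (- 2)"
            by (simp add: powr_add[symmetric])
          also have "\<dots> = 1 / ?J\<^sup>2" by (simp add: powr_minus_divide)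
          finally show ?thesis .
        qed
        finally show "2 powr (1 + p) * ?J powr (- (1 + p)) * (\<integral>x. \<bar>vj j x\<bar> powr (2 * p) \<partial>lborel)
          \<le> 2 powr (1 + p) * S powr p * (Ca * E) powr (p - 1) * (F j / ?J\<^sup>2)" by simp
      qed
      also have "\<dots> = 2 powr (1 + p) * S powr p * (Ca * E) powr (p - 1) * (\<Sum>j<N. F j / (1 + real j)\<^sup>2)"
        by (simp add: sum_distrib_left)
      also have "\<dots> \<le> 2 powr (1 + p) * S powr p * (Ca * E) powr (p - 1) * (Cb * E)"
        by (intro mult_left_mono Fb) auto
      also have "\<dots> = M * (E powr (p - 1) * E)"
        using CC E0 by (simp add: M_def powr_mult mult_ac)
      also have "E powr (p - 1) * E = E powr p"
        using E0 by (cases "E = 0") (auto simp: powr_diff)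
      finally have I: "(\<integral>x. \<bar>v x\<bar> powr (2 * p) * X1 (norm (x - a) / D) powr (1 + p) \<partial>lborel) \<le> M * E powr p" (is "?I \<le> _") .
      have "?I \<ge> 0" by simp
      then have "?I powr (1 / p) \<le> (M * E powr p) powr (1 / p)"
        using I p1 by (intro powr_mono2) auto
      also have "\<dots> = M powr (1 / p) * E"
        using M E0 p1 by (simp add: powr_mult powr_powr)
      finally have "1 / M powr (1 / p) * ?I powr (1 / p) \<le> E"
        using M by (simp add: field_simps)
      then show ?thesis unfolding E_def by linarith
    qed
    then show ?thesis using \<delta>(1) unfolding U_def by blast
  qed
  show ?thesis
    using main M unfolding n_def by (intro exI[of _ "1 / M powr (1 / p)"]) auto
qed

section \<open>Several boundary points\<close>

lemma powr_superadditive: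
  fixes \<alpha> \<beta> p :: real
  assumes "\<alpha> \<ge> 0" "\<beta> \<ge> 0" "p \<ge> 1"
  shows "\<alpha> powr p + \<beta> powr p \<le> (\<alpha> + \<beta>) powr p"
proof -
  have split: "x powr p = x * x powr (p - 1)" if "x \<ge> 0" for x :: real
    using that by (cases "x = 0") (auto simp: powr_diff)
  have "\<alpha> powr p + \<beta> powr p = \<alpha> * \<alpha> powr (p - 1) + \<beta> * \<beta> powr (p - 1)"
    using split assms by simp
  also have "\<dots> \<le> \<alpha> * (\<alpha> + \<beta>) powr (p - 1) + \<beta> * (\<alpha> + \<beta>) powr (p - 1)"
    using assms by (intro add_mono mult_left_mono powr_mono2) auto
  also have "\<dots> = (\<alpha> + \<beta>) powr p" using split[of "\<alpha> + \<beta>"] assms by (simp add: distrib_right)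
  finally show ?thesis .
qed

lemma X1_bounds:
  assumes "0 < t" "t \<le> 1"
  shows "0 < X1 t" "X1 t \<le> 1"
proof -
  have "ln t \<le> 0" using assms by simp
  then show "0 < X1 t" "X1 t \<le> 1" unfolding X1_def by simp_all
qed

lemma continuous_on_X1_weight:
  assumes "\<And>x. x \<in> U \<Longrightarrow> x \<noteq> a \<and> dist x a \<le> D" "D > 0" "e > 0"
  shows "continuous_on U (\<lambda>x. X1 (norm (x - a) / D) powr e)"
proof -
  have pos: "norm (x - a) / D > 0" "norm (x - a) / D \<le> 1" if "x \<in> U" for x
    using assms(1)[OF that] assms(2) by (auto simp: dist_norm)
  have "1 - ln (norm (x - a) / D) \<noteq> 0" if "x \<in> U" for x
    using pos[OF that] ln_le_zero_iff[of "norm (x - a) / D"] by linarith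
  moreover have "\<forall>x\<in>U. norm (x - a) \<noteq> 0" using assms(1) by auto
  ultimately have "continuous_on U (\<lambda>x. X1 (norm (x - a) / D))"
    unfolding X1_def using assms(2) by (intro continuous_intros) auto
  then show ?thesis
    using X1_bounds(1)[OF pos] assms(3) by (intro continuous_on_powr' continuous_intros) (auto simp: less_imp_le)
qed

lemma powr_double_of_sum_squares_le:
  fixes v a b p :: real
  assumes "v\<^sup>2 = a\<^sup>2 + b\<^sup>2" "p > 0"
  shows "\<bar>v\<bar> powr (2 * p) \<le> 2 powr p * (\<bar>a\<bar> powr (2 * p) + \<bar>b\<bar> powr (2 * p))"
proof -
  have "\<bar>v\<bar> powr (2 * p) = (a\<^sup>2 + b\<^sup>2) powr p" using abs_powr_double assms(1) by metis
  also have "\<dots> \<le> (2 * max (a\<^sup>2) (b\<^sup>2)) powr p" using assms(2) by (intro powr_mono2) auto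
  also have "\<dots> = 2 powr p * max (a\<^sup>2) (b\<^sup>2) powr p" by (simp add: powr_mult)
  also have "\<dots> \<le> 2 powr p * ((a\<^sup>2) powr p + (b\<^sup>2) powr p)"
    by (intro mult_left_mono) (auto simp: max_def)
  finally show ?thesis by (simp add: abs_powr_double)
qed

text \<open>The inequality only sees that each point lies on a sphere whose closed ball misses \<open>\<Omega>\<close>, and that
\<open>D\<close> bounds the distances.\<close>

abbreviation exterior_configuration ::
    "nat \<Rightarrow> 'a::euclidean_space set \<Rightarrow> (nat \<Rightarrow> 'a) \<Rightarrow> real \<Rightarrow> bool" where
  "exterior_configuration m \<Omega> a D \<equiv> open \<Omega> \<and> inj_on a {1..m} \<and> D > 0 \<and>
     (\<forall>k\<in>{1..m}. \<exists>y. a k \<noteq> y \<and> (\<forall>x\<in>\<Omega>. dist (a k) y < dist x y)) \<and>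
     (\<forall>k\<in>{1..m}. \<forall>x\<in>\<Omega>. dist x (a k) \<le> D)"

text \<open>Induction on the number of points. For the new point \<open>b\<close> let \<open>\<theta>\<close> rise from \<open>0\<close> to \<open>\<pi>/2\<close> across a small
annulus around \<open>b\<close>. Then \<open>|\<nabla>(v cos \<theta>)|\<^sup>2 + |\<nabla>(v sin \<theta>)|\<^sup>2 = |\<nabla>v|\<^sup>2 + v\<^sup>2|\<nabla>\<theta>|\<^sup>2\<close> exactly. The part
near \<open>b\<close> satisfies the one-point inequality and is bounded away from the old points; the other part
satisfies the induction hypothesis and is bounded away from \<open>b\<close>. Each weight is at most \<open>1\<close>, so the full
product is bounded by the part of it that each inequality supplies. The admissible \<open>l\<close> is uniform in
\<open>v\<close> but depends on the configuration; \<open>c\<close> does not.\<close>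

theorem multipolar_Hardy_Sobolev:
  fixes p :: real and m :: nat
  assumes n3: "DIM('a::euclidean_space) \<ge> 3" and p: "p = real DIM('a) / (real DIM('a) - 2)"
  shows "\<exists>c>0. \<forall>(\<Omega>::'a set) a D. exterior_configuration m \<Omega> a D \<longrightarrow>
    (\<exists>l\<ge>0. \<forall>v g. C1c \<Omega> v g \<longrightarrow>
      (real DIM('a))\<^sup>2 / 4 * (\<Sum>k=1..m. \<integral>x. (v x)\<^sup>2 / (norm (x - a k))\<^sup>2 \<partial>lborel)
      + c * (\<integral>x. \<bar>v x\<bar> powr (2 * p) * (\<Prod>k=1..m. X1 (norm (x - a k) / D) powr (1 + p)) \<partial>lborel) powr (1 / p)
      \<le> l * (\<integral>x. (v x)\<^sup>2 \<partial>lborel) + (\<integral>x. (norm (g x))\<^sup>2 \<partial>lborel))"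
proof (induction m)
  case 0
  have p0: "p > 0" using n3 unfolding p by simp
  obtain S where S: "S > 0" and Sob: "\<And>U (v :: 'a \<Rightarrow> real) g. C1c U v g \<Longrightarrow>
    (\<integral>x. \<bar>v x\<bar> powr (2 * p) \<partial>lborel) \<le> (S * (\<integral>x. (norm (g x))\<^sup>2 \<partial>lborel)) powr p"
    using Sobolev[OF n3 p] by blast
  have "1 / S * (\<integral>x. \<bar>v x\<bar> powr (2 * p) \<partial>lborel) powr (1 / p) \<le> (\<integral>x. (norm (g x))\<^sup>2 \<partial>lborel)"
    if "C1c U v g" for U and v :: "'a \<Rightarrow> real" and g
  proof -
    let ?Q = "\<integral>x. (norm (g x))\<^sup>2 \<partial>lborel"
    have "?Q \<ge> 0" by simp
    have "(\<integral>x. \<bar>v x\<bar> powr (2 * p) \<partial>lborel) powr (1 / p) \<le> ((S * ?Q) powr p) powr (1 / p)"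
      using Sob[OF that] p0 by (intro powr_mono2) auto
    also have "\<dots> = S * ?Q" using p0 S \<open>?Q \<ge> 0\<close> by (simp add: powr_powr)
    finally show ?thesis using S by (simp add: field_simps)
  qed
  then show ?case using S by (intro exI[of _ "1 / S"] conjI allI impI exI[of _ 0]) auto
next
  case (Suc m)
  define n where "n = real DIM('a)"
  have n: "n \<ge> 3" using n3 by (simp add: n_def)
  have p1: "p > 1" using n unfolding p n_def[symmetric] by (simp add: field_simps)
  obtain c0 where c0: "c0 > 0" and IH: "\<forall>(\<Omega>::'a set) a D. exterior_configuration m \<Omega> a D \<longrightarrow>
    (\<exists>l\<ge>0. \<forall>v g. C1c \<Omega> v g \<longrightarrow>
      n\<^sup>2 / 4 * (\<Sum>k=1..m. \<integral>x. (v x)\<^sup>2 / (norm (x - a k))\<^sup>2 \<partial>lborel)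
      + c0 * (\<integral>x. \<bar>v x\<bar> powr (2 * p) * (\<Prod>k=1..m. X1 (norm (x - a k) / D) powr (1 + p)) \<partial>lborel) powr (1 / p)
      \<le> l * (\<integral>x. (v x)\<^sup>2 \<partial>lborel) + (\<integral>x. (norm (g x))\<^sup>2 \<partial>lborel))"
    using Suc unfolding n_def[symmetric] by (elim exE conjE) (rule that; assumption)
  obtain c1 where c1: "c1 > 0" and single: "\<forall>(a::'a) y D. a \<noteq> y \<and> D > 0 \<longrightarrow> (\<exists>\<delta>>0. \<forall>v g.
    C1c (exterior_cap a y \<delta>) v g \<longrightarrow>
      n\<^sup>2 / 4 * (\<integral>x. (v x)\<^sup>2 / (norm (x - a))\<^sup>2 \<partial>lborel)
      + c1 * (\<integral>x. \<bar>v x\<bar> powr (2 * p) * X1 (norm (x - a) / D) powr (1 + p) \<partial>lborel) powr (1 / p)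
      \<le> (\<integral>x. (norm (g x))\<^sup>2 \<partial>lborel))"
    using exterior_ball_Hardy_Sobolev[OF n3 p] unfolding n_def[symmetric] by (elim exE conjE) (rule that; assumption)
  \<comment> \<open>The factor \<open>2\<close> is the loss in recombining the two parts in the weighted Lebesgue norm.\<close>
  define c where "c = min c0 c1 / 2"
  have c: "c > 0" "2 * c \<le> c0" "2 * c \<le> c1" unfolding c_def using c0 c1 by auto
  have "\<exists>l\<ge>0. \<forall>v g. C1c \<Omega> v g \<longrightarrow>
      n\<^sup>2 / 4 * (\<Sum>k=1..Suc m. \<integral>x. (v x)\<^sup>2 / (norm (x - a k))\<^sup>2 \<partial>lborel)
      + c * (\<integral>x. \<bar>v x\<bar> powr (2 * p) * (\<Prod>k=1..Suc m. X1 (norm (x - a k) / D) powr (1 + p)) \<partial>lborel) powr (1 / p)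
      \<le> l * (\<integral>x. (v x)\<^sup>2 \<partial>lborel) + (\<integral>x. (norm (g x))\<^sup>2 \<partial>lborel)"
    if op: "open \<Omega>" and inj: "inj_on a {1..Suc m}" and D: "D > 0"
      and ext: "\<forall>k\<in>{1..Suc m}. \<exists>y. a k \<noteq> y \<and> (\<forall>x\<in>\<Omega>. dist (a k) y < dist x y)"
      and dD: "\<forall>k\<in>{1..Suc m}. \<forall>x\<in>\<Omega>. dist x (a k) \<le> D" for \<Omega> :: "'a set" and a D
  proof -
    have notin: "x \<noteq> a k" if "x \<in> \<Omega>" "k \<in> {1..Suc m}" for x k
      using ext that by fastforce
    define b where "b = a (Suc m)"
    obtain y where y: "b \<noteq> y" "\<And>x. x \<in> \<Omega> \<Longrightarrow> dist b y < dist x y"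
      using ext unfolding b_def by (metis atLeastAtMost_iff le_add1 order_refl plus_1_eq_Suc)
    obtain l0 where l0: "l0 \<ge> 0" and far: "\<And>v g. C1c \<Omega> v g \<Longrightarrow>
      n\<^sup>2 / 4 * (\<Sum>k=1..m. \<integral>x. (v x)\<^sup>2 / (norm (x - a k))\<^sup>2 \<partial>lborel)
      + c0 * (\<integral>x. \<bar>v x\<bar> powr (2 * p) * (\<Prod>k=1..m. X1 (norm (x - a k) / D) powr (1 + p)) \<partial>lborel) powr (1 / p)
      \<le> l0 * (\<integral>x. (v x)\<^sup>2 \<partial>lborel) + (\<integral>x. (norm (g x))\<^sup>2 \<partial>lborel)"
    proof -
      have "inj_on a {1..m}" using inj by (rule inj_on_subset) auto
      then have "exterior_configuration m \<Omega> a D"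
        using op D ext dD by auto
      from IH[THEN spec, THEN spec, THEN spec, THEN mp, OF this] obtain l0 where "l0 \<ge> 0" and
        *: "\<forall>v g. C1c \<Omega> v g \<longrightarrow>
      n\<^sup>2 / 4 * (\<Sum>k=1..m. \<integral>x. (v x)\<^sup>2 / (norm (x - a k))\<^sup>2 \<partial>lborel)
      + c0 * (\<integral>x. \<bar>v x\<bar> powr (2 * p) * (\<Prod>k=1..m. X1 (norm (x - a k) / D) powr (1 + p)) \<partial>lborel) powr (1 / p)
      \<le> l0 * (\<integral>x. (v x)\<^sup>2 \<partial>lborel) + (\<integral>x. (norm (g x))\<^sup>2 \<partial>lborel)"
        by (elim exE conjE) (rule that; assumption)
      show ?thesis by (rule that[OF \<open>l0 \<ge> 0\<close> *[rule_format]])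
    qed
    obtain \<delta> where \<delta>: "\<delta> > 0" and near: "\<And>v g.
      C1c (exterior_cap b y \<delta>) v g \<Longrightarrow>
        n\<^sup>2 / 4 * (\<integral>x. (v x)\<^sup>2 / (norm (x - b))\<^sup>2 \<partial>lborel)
        + c1 * (\<integral>x. \<bar>v x\<bar> powr (2 * p) * X1 (norm (x - b) / D) powr (1 + p) \<partial>lborel) powr (1 / p)
        \<le> (\<integral>x. (norm (g x))\<^sup>2 \<partial>lborel)"
    proof -
      have "b \<noteq> y \<and> D > 0" using y(1) D by simp
      from single[THEN spec, THEN spec, THEN spec, THEN mp, OF this] obtain \<delta> where "\<delta> > 0" and
        *: "\<forall>v g. C1c (exterior_cap b y \<delta>) v g \<longrightarrow>
        n\<^sup>2 / 4 * (\<integral>x. (v x)\<^sup>2 / (norm (x - b))\<^sup>2 \<partial>lborel)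
        + c1 * (\<integral>x. \<bar>v x\<bar> powr (2 * p) * X1 (norm (x - b) / D) powr (1 + p) \<partial>lborel) powr (1 / p)
        \<le> (\<integral>x. (norm (g x))\<^sup>2 \<partial>lborel)"
        by (elim exE conjE) (rule that; assumption)
      show ?thesis by (rule that[OF \<open>\<delta> > 0\<close> *[rule_format]])
    qed
    \<comment> \<open>The ball of radius \<open>\<epsilon>\<close> lies in the region of the one-point inequality and keeps distance at
      least \<open>\<epsilon>\<close> from the other points.\<close>
    define \<epsilon> where "\<epsilon> = Min (insert (\<delta> / 2) ((\<lambda>k. dist b (a k) / 2) ` {1..m}))"
    have ab: "dist b (a k) > 0" if "k \<in> {1..m}" for k
      using inj_onD[OF inj, of "Suc m" k] that unfolding b_def by auto
    have \<epsilon>: "\<epsilon> > 0" "\<epsilon> < \<delta>" "\<And>k. k \<in> {1..m} \<Longrightarrow> 2 * \<epsilon> \<le> dist b (a k)"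
    proof -
      show "\<epsilon> > 0" unfolding \<epsilon>_def using \<delta> ab by (subst Min_gr_iff) auto
      have "\<epsilon> \<le> \<delta> / 2" unfolding \<epsilon>_def by (intro Min_le) auto
      then show "\<epsilon> < \<delta>" using \<delta> by linarith
      show "2 * \<epsilon> \<le> dist b (a k)" if "k \<in> {1..m}" for k
      proof -
        have "\<epsilon> \<le> dist b (a k) / 2" unfolding \<epsilon>_def using that by (intro Min_le) auto
        then show ?thesis by simp
      qed
    qed
    define \<theta> where "\<theta> x = pi / 2 * smooth_step (2 / \<epsilon>\<^sup>2 * ((x - b) \<bullet> (x - b)))" for x
    define \<theta>' where "\<theta>' x = (pi / 2 * (smooth_step' (2 / \<epsilon>\<^sup>2 * ((x - b) \<bullet> (x - b))) * (2 / \<epsilon>\<^sup>2))) *\<^sub>R (2 *\<^sub>R (x - b))" for x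
    have d\<theta>: "(\<theta> has_derivative (\<lambda>h. \<theta>' x \<bullet> h)) (at x)" for x
      unfolding \<theta>_def[abs_def] \<theta>'_def
    proof (rule has_derivative_scalar_compose[where f = "\<lambda>s. pi / 2 * smooth_step (2 / \<epsilon>\<^sup>2 * s)"])
      show "((\<lambda>x. (x - b) \<bullet> (x - b)) has_derivative (\<lambda>h. (2 *\<^sub>R (x - b)) \<bullet> h)) (at x)"
        by (auto intro!: derivative_eq_intros simp: inner_commute)
      have "((\<lambda>s. 2 / \<epsilon>\<^sup>2 * s) has_real_derivative 2 / \<epsilon>\<^sup>2) (at s)" for s
        by (rule DERIV_cmult_Id)
      from DERIV_cmult[OF DERIV_chain2[OF DERIV_smooth_step this]]
      show "((\<lambda>s. pi / 2 * smooth_step (2 / \<epsilon>\<^sup>2 * s)) has_real_derivative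
         pi / 2 * (smooth_step' (2 / \<epsilon>\<^sup>2 * ((x - b) \<bullet> (x - b))) * (2 / \<epsilon>\<^sup>2))) (at ((x - b) \<bullet> (x - b)))" .
    qed
    have c\<theta>: "continuous_on S \<theta>" "continuous_on S \<theta>'" for S
    proof -
      show "continuous_on S \<theta>"
        using d\<theta> has_derivative_continuous continuous_at_imp_continuous_on by metis
      show "continuous_on S \<theta>'"
        unfolding \<theta>'_def[abs_def]
        by (intro continuous_intros continuous_on_compose2[OF continuous_on_smooth_step'[of UNIV]]) auto
    qed
    have xb: "(x - b) \<bullet> (x - b) = (norm (x - b))\<^sup>2" for x by (simp add: power2_norm_eq_inner)
    define L where "L = (4 * pi / \<epsilon>)\<^sup>2"
    have \<theta>'L: "(norm (\<theta>' x))\<^sup>2 \<le> L" for x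
    proof (cases "norm (x - b) \<le> \<epsilon>")
      case True
      have "norm (\<theta>' x) = pi / 2 * (smooth_step' (2 / \<epsilon>\<^sup>2 * ((x - b) \<bullet> (x - b))) * (2 / \<epsilon>\<^sup>2)) * (2 * norm (x - b))"
        unfolding \<theta>'_def using smooth_step'_bounds(1) by (simp add: abs_mult)
      also have "\<dots> \<le> pi / 2 * (2 * (2 / \<epsilon>\<^sup>2)) * (2 * \<epsilon>)"
        using True smooth_step'_bounds by (intro mult_mono mult_left_mono mult_right_mono) auto
      also have "\<dots> = 4 * pi / \<epsilon>" using \<epsilon>(1) by (simp add: power2_eq_square)
      finally show ?thesis unfolding L_def by (intro power_mono) auto
    next
      case False
      then have "\<epsilon>\<^sup>2 \<le> (norm (x - b))\<^sup>2" using \<epsilon>(1) by (intro power_mono) auto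
      then have "2 / \<epsilon>\<^sup>2 * ((x - b) \<bullet> (x - b)) \<ge> 2" unfolding xb using \<epsilon>(1) by (simp add: field_simps)
      then show ?thesis unfolding \<theta>'_def by (simp add: smooth_step'_eq_0 L_def)
    qed
    have cos0: "cos (\<theta> x) = 0" if "norm (x - b) > \<epsilon>" for x
    proof -
      have "\<epsilon>\<^sup>2 \<le> (norm (x - b))\<^sup>2" using that \<epsilon>(1) by (intro power_mono) auto
      then have "2 / \<epsilon>\<^sup>2 * ((x - b) \<bullet> (x - b)) \<ge> 2" unfolding xb using \<epsilon>(1) by (simp add: field_simps)
      then show ?thesis unfolding \<theta>_def by (simp add: smooth_step_eq_1)
    qed
    have sin0: "sin (\<theta> x) = 0" if "2 * (norm (x - b))\<^sup>2 \<le> \<epsilon>\<^sup>2" for x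
    proof -
      have "2 / \<epsilon>\<^sup>2 * ((x - b) \<bullet> (x - b)) \<le> 1" unfolding xb using that \<epsilon>(1) by (simp add: field_simps)
      then show ?thesis unfolding \<theta>_def by (simp add: smooth_step_eq_0)
    qed
    define W where "W j x = (\<Prod>k=1..j. X1 (norm (x - a k) / D) powr (1 + p))" for j x
    have wk: "0 \<le> X1 (norm (x - a k) / D) powr (1 + p)" "X1 (norm (x - a k) / D) powr (1 + p) \<le> 1"
      if "x \<in> \<Omega>" "k \<in> {1..Suc m}" for x k
    proof -
      have "norm (x - a k) / D > 0" "norm (x - a k) / D \<le> 1"
        using notin[OF that] dD that D by (auto simp: dist_norm)
      from X1_bounds[OF this] show "0 \<le> X1 (norm (x - a k) / D) powr (1 + p)" "X1 (norm (x - a k) / D) powr (1 + p) \<le> 1"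
        using powr_mono2[of "1 + p" "X1 (norm (x - a k) / D)" 1] p1 by auto
    qed
    have cw: "continuous_on \<Omega> (\<lambda>x. X1 (norm (x - a k) / D) powr (1 + p))" if "k \<in> {1..Suc m}" for k
      using notin that dD D p1 by (intro continuous_on_X1_weight) auto
    have W01: "0 \<le> W m x" "W m x \<le> 1" if "x \<in> \<Omega>" for x
      unfolding W_def using wk[OF that] by (auto intro!: prod_nonneg prod_le_1)
    have WSuc: "W (Suc m) x = W m x * X1 (norm (x - b) / D) powr (1 + p)" for x
      unfolding W_def b_def by simp
    have cW: "continuous_on \<Omega> (W m)" "continuous_on \<Omega> (W (Suc m))"
      unfolding W_def[abs_def] using cw by (intro continuous_on_prod; auto)+
    have cwb: "continuous_on \<Omega> (\<lambda>x. X1 (norm (x - b) / D) powr (1 + p))"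
      using cw[of "Suc m"] by (simp add: b_def)
    define l where "l = l0 + L + n\<^sup>2 / 4 * ((real m + 2) / \<epsilon>\<^sup>2)"
    have "n\<^sup>2 / 4 * (\<Sum>k=1..Suc m. \<integral>x. (v x)\<^sup>2 / (norm (x - a k))\<^sup>2 \<partial>lborel)
      + c * (\<integral>x. \<bar>v x\<bar> powr (2 * p) * W (Suc m) x \<partial>lborel) powr (1 / p)
      \<le> l * (\<integral>x. (v x)\<^sup>2 \<partial>lborel) + (\<integral>x. (norm (g x))\<^sup>2 \<partial>lborel)" if v: "C1c \<Omega> v g" for v g
    proof -
      define v1 where "v1 x = cos (\<theta> x) * v x" for x
      define v0 where "v0 x = sin (\<theta> x) * v x" for x
      define g1 where "g1 x = cos (\<theta> x) *\<^sub>R g x + v x *\<^sub>R (- sin (\<theta> x) *\<^sub>R \<theta>' x)" for x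
      define g0 where "g0 x = sin (\<theta> x) *\<^sub>R g x + v x *\<^sub>R (cos (\<theta> x) *\<^sub>R \<theta>' x)" for x
      have C1: "C1c \<Omega> v1 g1"
        unfolding v1_def[abs_def] g1_def[abs_def]
      proof (rule C1c_mult[OF op v has_derivative_scalar_compose[OF d\<theta> DERIV_cos]])
        show "continuous_on \<Omega> (\<lambda>x. - sin (\<theta> x) *\<^sub>R \<theta>' x)" by (intro continuous_intros c\<theta>)
      qed
      have C0: "C1c \<Omega> v0 g0"
        unfolding v0_def[abs_def] g0_def[abs_def]
      proof (rule C1c_mult[OF op v has_derivative_scalar_compose[OF d\<theta> DERIV_sin]])
        show "continuous_on \<Omega> (\<lambda>x. cos (\<theta> x) *\<^sub>R \<theta>' x)" by (intro continuous_intros c\<theta>)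
      qed
      have v1_far: "v1 x = 0" if "norm (x - b) > \<epsilon>" for x unfolding v1_def using cos0[OF that] by simp
      have v0_near: "v0 x = 0" if "2 * (norm (x - b))\<^sup>2 \<le> \<epsilon>\<^sup>2" for x unfolding v0_def using sin0[OF that] by simp
      have C1': "C1c (exterior_cap b y \<delta>) v1 g1"
      proof (rule C1c_restrict[OF C1, of "cball b \<epsilon>"])
        show "v1 x = 0" if "x \<notin> cball b \<epsilon>" for x
          using that v1_far[of x] by (simp add: dist_norm norm_minus_commute)
        show "\<Omega> \<inter> cball b \<epsilon> \<subseteq> exterior_cap b y \<delta>"
          using y(2) \<epsilon>(2) by auto
      qed simp
      have sq: "(v x)\<^sup>2 = (v1 x)\<^sup>2 + (v0 x)\<^sup>2" for x
      proof -
        have "(v1 x)\<^sup>2 + (v0 x)\<^sup>2 = ((sin (\<theta> x))\<^sup>2 + (cos (\<theta> x))\<^sup>2) * (v x)\<^sup>2"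
          unfolding v1_def v0_def by (simp only: power_mult_distrib distrib_right add.commute)
        then show ?thesis by simp
      qed
      have sqg: "(norm (g1 x))\<^sup>2 + (norm (g0 x))\<^sup>2 = (norm (g x))\<^sup>2 + (v x)\<^sup>2 * (norm (\<theta>' x))\<^sup>2" for x
      proof -
        have "(norm (C *\<^sub>R u + t *\<^sub>R (- S *\<^sub>R w)))\<^sup>2 + (norm (S *\<^sub>R u + t *\<^sub>R (C *\<^sub>R w)))\<^sup>2
          = (S\<^sup>2 + C\<^sup>2) * ((norm u)\<^sup>2 + t\<^sup>2 * (norm w)\<^sup>2)" for C S t and u w :: 'a
          unfolding power2_norm_eq_inner
          by (simp add: inner_add_left inner_add_right inner_diff_left inner_diff_right inner_commute[of w u] power2_eq_square algebra_simps)
        then show ?thesis unfolding g1_def g0_def by simp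
      qed
      define V where "V = (\<integral>x. (v x)\<^sup>2 \<partial>lborel)"
      have V0: "V \<ge> 0" unfolding V_def by simp
      have iV: "integrable lborel (\<lambda>x. (w x)\<^sup>2)" "integrable lborel (\<lambda>x. (norm (h x))\<^sup>2)" if "C1c \<Omega> w h" for w h
        by (rule C1c_integrable[OF that]; (intro continuous_intros C1c_continuous[OF that])?; simp)+
      have i_sing: "integrable lborel (\<lambda>x. (w x)\<^sup>2 / (norm (x - a k))\<^sup>2)" if "C1c \<Omega> w h" "k \<in> {1..Suc m}" for w h k
      proof -
        have "\<forall>x\<in>\<Omega>. (norm (x - a k))\<^sup>2 \<noteq> 0" using notin that(2) by auto
        then show ?thesis
          by (intro C1c_integrable[OF that(1)] continuous_intros C1c_continuous[OF that(1)]) auto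
      qed
      have i_pow: "integrable lborel (\<lambda>x. \<bar>w x\<bar> powr (2 * p) * H x)" if "C1c \<Omega> w h" "continuous_on \<Omega> H" for w h H
        using p1 by (intro C1c_integrable[OF that(1)] continuous_intros powr_double_continuous[OF that(1)] that(2)) auto
      have out: "w x = 0" if "C1c \<Omega> w h" "x \<notin> \<Omega>" for w h x using C1c_zero_outside[OF that] by simp
      have grad: "(\<integral>x. (norm (g1 x))\<^sup>2 \<partial>lborel) + (\<integral>x. (norm (g0 x))\<^sup>2 \<partial>lborel) \<le> (\<integral>x. (norm (g x))\<^sup>2 \<partial>lborel) + L * V"
      proof -
        have "(\<integral>x. (norm (g1 x))\<^sup>2 \<partial>lborel) + (\<integral>x. (norm (g0 x))\<^sup>2 \<partial>lborel) = (\<integral>x. (norm (g1 x))\<^sup>2 + (norm (g0 x))\<^sup>2 \<partial>lborel)"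
          using iV(2)[OF C1] iV(2)[OF C0] by simp
        also have "\<dots> \<le> (\<integral>x. (norm (g x))\<^sup>2 + L * (v x)\<^sup>2 \<partial>lborel)"
        proof (rule integral_mono)
          show "(norm (g1 x))\<^sup>2 + (norm (g0 x))\<^sup>2 \<le> (norm (g x))\<^sup>2 + L * (v x)\<^sup>2" for x
            unfolding sqg using mult_left_mono[OF \<theta>'L[of x], of "(v x)\<^sup>2"] by (simp add: mult.commute)
        qed (intro Bochner_Integration.integrable_add integrable_mult_right iV[OF C1] iV[OF C0] iV[OF v])+
        also have "\<dots> = (\<integral>x. (norm (g x))\<^sup>2 \<partial>lborel) + L * V"
          using iV[OF v] by (simp add: V_def)
        finally show ?thesis .
      qed
      have split: "(\<integral>x. (v x)\<^sup>2 / (norm (x - a k))\<^sup>2 \<partial>lborel) =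
         (\<integral>x. (v1 x)\<^sup>2 / (norm (x - a k))\<^sup>2 \<partial>lborel) + (\<integral>x. (v0 x)\<^sup>2 / (norm (x - a k))\<^sup>2 \<partial>lborel)"
        if "k \<in> {1..Suc m}" for k
        unfolding sq add_divide_distrib using i_sing[OF C1 that] i_sing[OF C0 that] by simp
      have v10: "(v1 x)\<^sup>2 \<le> (v x)\<^sup>2" "(v0 x)\<^sup>2 \<le> (v x)\<^sup>2" for x using sq[of x] by simp_all
      have near_other: "(\<integral>x. (v1 x)\<^sup>2 / (norm (x - a k))\<^sup>2 \<partial>lborel) \<le> V / \<epsilon>\<^sup>2" if k: "k \<in> {1..m}" for k
      proof -
        have "(\<integral>x. (v1 x)\<^sup>2 / (norm (x - a k))\<^sup>2 \<partial>lborel) \<le> (\<integral>x. (v x)\<^sup>2 / \<epsilon>\<^sup>2 \<partial>lborel)"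
        proof (rule integral_mono)
          show "integrable lborel (\<lambda>x. (v1 x)\<^sup>2 / (norm (x - a k))\<^sup>2)" using i_sing[OF C1] k by simp
          show "integrable lborel (\<lambda>x. (v x)\<^sup>2 / \<epsilon>\<^sup>2)" using iV[OF v] by simp
          fix x
          show "(v1 x)\<^sup>2 / (norm (x - a k))\<^sup>2 \<le> (v x)\<^sup>2 / \<epsilon>\<^sup>2"
          proof (cases "norm (x - b) \<le> \<epsilon>")
            case True
            have "2 * \<epsilon> \<le> norm (b - a k)" using \<epsilon>(3)[OF k] by (simp add: dist_norm)
            also have "\<dots> \<le> norm (x - b) + norm (x - a k)"
              using norm_triangle_ineq4[of "x - a k" "x - b"] by (simp add: add.commute)
            finally have "\<epsilon> \<le> norm (x - a k)" using True by linarith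
            then have "\<epsilon>\<^sup>2 \<le> (norm (x - a k))\<^sup>2" using \<epsilon>(1) by (intro power_mono) auto
            then show ?thesis using v10(1)[of x] \<epsilon>(1) by (intro frac_le) auto
          next
            case False
            then show ?thesis using v1_far[of x] by simp
          qed
        qed
        then show ?thesis by (simp add: V_def)
      qed
      have far_b: "(\<integral>x. (v0 x)\<^sup>2 / (norm (x - b))\<^sup>2 \<partial>lborel) \<le> 2 * V / \<epsilon>\<^sup>2"
      proof -
        have "(\<integral>x. (v0 x)\<^sup>2 / (norm (x - b))\<^sup>2 \<partial>lborel) \<le> (\<integral>x. (v x)\<^sup>2 / (\<epsilon>\<^sup>2 / 2) \<partial>lborel)"
        proof (rule integral_mono)
          show "integrable lborel (\<lambda>x. (v0 x)\<^sup>2 / (norm (x - b))\<^sup>2)" using i_sing[OF C0, of "Suc m"] by (simp add: b_def)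
          show "integrable lborel (\<lambda>x. (v x)\<^sup>2 / (\<epsilon>\<^sup>2 / 2))" using iV[OF v] by simp
          fix x
          show "(v0 x)\<^sup>2 / (norm (x - b))\<^sup>2 \<le> (v x)\<^sup>2 / (\<epsilon>\<^sup>2 / 2)"
          proof (cases "2 * (norm (x - b))\<^sup>2 \<le> \<epsilon>\<^sup>2")
            case True
            then show ?thesis using v0_near[of x] by simp
          next
            case False
            then show ?thesis using v10(2)[of x] \<epsilon>(1) by (intro frac_le) auto
          qed
        qed
        then show ?thesis by (simp add: V_def mult.commute)
      qed
      define A1 where "A1 = (\<integral>x. \<bar>v1 x\<bar> powr (2 * p) * X1 (norm (x - b) / D) powr (1 + p) \<partial>lborel)"
      define A0 where "A0 = (\<integral>x. \<bar>v0 x\<bar> powr (2 * p) * W m x \<partial>lborel)"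
      define A where "A = (\<integral>x. \<bar>v x\<bar> powr (2 * p) * W (Suc m) x \<partial>lborel)"
      have A_nonneg: "A0 \<ge> 0" "A1 \<ge> 0" "A \<ge> 0"
        unfolding A1_def A0_def A_def W_def by (simp_all add: prod_nonneg)
      have A_le: "A \<le> 2 powr p * (A1 + A0)"
      proof -
        have "A \<le> (\<integral>x. 2 powr p * (\<bar>v1 x\<bar> powr (2 * p) * X1 (norm (x - b) / D) powr (1 + p) + \<bar>v0 x\<bar> powr (2 * p) * W m x) \<partial>lborel)"
          unfolding A_def
        proof (rule integral_mono)
          show "integrable lborel (\<lambda>x. \<bar>v x\<bar> powr (2 * p) * W (Suc m) x)"
            by (rule i_pow[OF v cW(2)])
          show "integrable lborel (\<lambda>x. 2 powr p * (\<bar>v1 x\<bar> powr (2 * p) * X1 (norm (x - b) / D) powr (1 + p) + \<bar>v0 x\<bar> powr (2 * p) * W m x))"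
            by (intro integrable_mult_right Bochner_Integration.integrable_add i_pow[OF C1 cwb] i_pow[OF C0 cW(1)])
          fix x
          show "\<bar>v x\<bar> powr (2 * p) * W (Suc m) x \<le> 2 powr p * (\<bar>v1 x\<bar> powr (2 * p) * X1 (norm (x - b) / D) powr (1 + p) + \<bar>v0 x\<bar> powr (2 * p) * W m x)"
          proof (cases "x \<in> \<Omega>")
            case False
            then show ?thesis using out[OF v] out[OF C1] out[OF C0] by simp
          next
            case True
            let ?X = "X1 (norm (x - b) / D) powr (1 + p)"
            have X: "0 \<le> ?X" "?X \<le> 1" using wk[OF True, of "Suc m"] by (auto simp: b_def)
            have W: "W (Suc m) x \<le> ?X" "W (Suc m) x \<le> W m x" "0 \<le> W (Suc m) x"
              unfolding WSuc using W01[OF True] X by (auto simp: mult_left_le_one_le mult_left_le)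
            have "\<bar>v x\<bar> powr (2 * p) * W (Suc m) x \<le> 2 powr p * (\<bar>v1 x\<bar> powr (2 * p) + \<bar>v0 x\<bar> powr (2 * p)) * W (Suc m) x"
              using powr_double_of_sum_squares_le[OF sq[of x]] p1 W(3) by (intro mult_right_mono) auto
            also have "\<dots> = 2 powr p * (\<bar>v1 x\<bar> powr (2 * p) * W (Suc m) x + \<bar>v0 x\<bar> powr (2 * p) * W (Suc m) x)"
              by (simp add: algebra_simps)
            also have "\<dots> \<le> 2 powr p * (\<bar>v1 x\<bar> powr (2 * p) * ?X + \<bar>v0 x\<bar> powr (2 * p) * W m x)"
              using W by (intro mult_left_mono add_mono) auto
            finally show ?thesis .
          qed
        qed
        also have "\<dots> = 2 powr p * (A1 + A0)"
          unfolding A1_def A0_def using i_pow[OF C1 cwb] i_pow[OF C0 cW(1)] by simp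
        finally show ?thesis .
      qed
      have A_root: "A powr (1 / p) \<le> 2 * (A1 powr (1 / p) + A0 powr (1 / p))"
      proof -
        have "A1 + A0 = (A1 powr (1 / p)) powr p + (A0 powr (1 / p)) powr p"
          using A_nonneg p1 by (simp add: powr_powr)
        also have "\<dots> \<le> (A1 powr (1 / p) + A0 powr (1 / p)) powr p"
          using p1 by (intro powr_superadditive) auto
        finally have "A \<le> 2 powr p * (A1 powr (1 / p) + A0 powr (1 / p)) powr p"
          using A_le by (meson mult_left_mono order_trans powr_ge_zero)
        also have "\<dots> = (2 * (A1 powr (1 / p) + A0 powr (1 / p))) powr p"
          by (rule powr_mult[symmetric])
        finally have "A powr (1 / p) \<le> ((2 * (A1 powr (1 / p) + A0 powr (1 / p))) powr p) powr (1 / p)"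
          using A_nonneg p1 by (intro powr_mono2) auto
        also have "\<dots> = 2 * (A1 powr (1 / p) + A0 powr (1 / p))"
          using p1 by (simp add: powr_powr)
        finally show ?thesis .
      qed
      have cA: "c * A powr (1 / p) \<le> c1 * A1 powr (1 / p) + c0 * A0 powr (1 / p)"
      proof -
        have "c * A powr (1 / p) \<le> c * (2 * (A1 powr (1 / p) + A0 powr (1 / p)))"
          using A_root c(1) by (intro mult_left_mono) auto
        also have "\<dots> = 2 * c * A1 powr (1 / p) + 2 * c * A0 powr (1 / p)" by (simp add: algebra_simps)
        also have "\<dots> \<le> c1 * A1 powr (1 / p) + c0 * A0 powr (1 / p)"
          using c by (intro add_mono mult_right_mono) auto
        finally show ?thesis .
      qed
      define H1 where "H1 = (\<integral>x. (v1 x)\<^sup>2 / (norm (x - b))\<^sup>2 \<partial>lborel)"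
      define H0 where "H0 = (\<Sum>k=1..m. \<integral>x. (v0 x)\<^sup>2 / (norm (x - a k))\<^sup>2 \<partial>lborel)"
      have hardy: "(\<Sum>k=1..Suc m. \<integral>x. (v x)\<^sup>2 / (norm (x - a k))\<^sup>2 \<partial>lborel) \<le> H1 + H0 + (real m + 2) / \<epsilon>\<^sup>2 * V"
      proof -
        have "(\<Sum>k=1..Suc m. \<integral>x. (v x)\<^sup>2 / (norm (x - a k))\<^sup>2 \<partial>lborel) =
          (\<Sum>k=1..m. \<integral>x. (v x)\<^sup>2 / (norm (x - a k))\<^sup>2 \<partial>lborel) + (\<integral>x. (v x)\<^sup>2 / (norm (x - b))\<^sup>2 \<partial>lborel)"
          by (simp add: b_def)
        also have "(\<integral>x. (v x)\<^sup>2 / (norm (x - b))\<^sup>2 \<partial>lborel) \<le> H1 + 2 * V / \<epsilon>\<^sup>2"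
          using split[of "Suc m"] far_b unfolding H1_def b_def[symmetric] by simp
        also have "(\<Sum>k=1..m. \<integral>x. (v x)\<^sup>2 / (norm (x - a k))\<^sup>2 \<partial>lborel)
          \<le> (\<Sum>k=1..m. V / \<epsilon>\<^sup>2 + (\<integral>x. (v0 x)\<^sup>2 / (norm (x - a k))\<^sup>2 \<partial>lborel))"
        proof (rule sum_mono)
          fix k assume k: "k \<in> {1..m}"
          then show "(\<integral>x. (v x)\<^sup>2 / (norm (x - a k))\<^sup>2 \<partial>lborel) \<le> V / \<epsilon>\<^sup>2 + (\<integral>x. (v0 x)\<^sup>2 / (norm (x - a k))\<^sup>2 \<partial>lborel)"
            using split[of k] near_other[OF k] by simp
        qed
        also have "\<dots> = real m * (V / \<epsilon>\<^sup>2) + H0" unfolding H0_def by (simp add: sum.distrib)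
        finally show ?thesis by (simp add: algebra_simps add_divide_distrib)
      qed
      have "n\<^sup>2 / 4 * H0 + c0 * A0 powr (1 / p) \<le> l0 * (\<integral>x. (v0 x)\<^sup>2 \<partial>lborel) + (\<integral>x. (norm (g0 x))\<^sup>2 \<partial>lborel)"
        using far[OF C0] unfolding H0_def A0_def W_def .
      moreover have "l0 * (\<integral>x. (v0 x)\<^sup>2 \<partial>lborel) \<le> l0 * V"
        unfolding V_def using v10 l0 iV[OF C0] iV[OF v] by (intro mult_left_mono integral_mono) auto
      moreover have "n\<^sup>2 / 4 * H1 + c1 * A1 powr (1 / p) \<le> (\<integral>x. (norm (g1 x))\<^sup>2 \<partial>lborel)"
        using near[OF C1'] unfolding H1_def A1_def .
      moreover have "n\<^sup>2 / 4 * (\<Sum>k=1..Suc m. \<integral>x. (v x)\<^sup>2 / (norm (x - a k))\<^sup>2 \<partial>lborel)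
         \<le> n\<^sup>2 / 4 * H1 + n\<^sup>2 / 4 * H0 + n\<^sup>2 / 4 * ((real m + 2) / \<epsilon>\<^sup>2) * V"
        using mult_left_mono[OF hardy, of "n\<^sup>2 / 4"] by (simp add: algebra_simps)
      moreover have "l * V = l0 * V + L * V + n\<^sup>2 / 4 * ((real m + 2) / \<epsilon>\<^sup>2) * V"
        unfolding l_def by (simp only: distrib_right)
      ultimately show ?thesis
        using cA grad unfolding A_def[symmetric] V_def[symmetric] by linarith
    qed
    moreover have "l \<ge> 0" unfolding l_def L_def using l0 by simp
    ultimately show ?thesis unfolding W_def by blast
  qed
  then show ?case using c(1) unfolding n_def by (intro exI[of _ c]) blast
qed

section \<open>Test functions on a domain with exterior balls\<close>

lemma test_function_C1c:
  fixes u :: "real ^ 'n::finite \<Rightarrow> real"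
  assumes "test_function \<Omega> u"
  shows "C1c \<Omega> u (gradient u)"
proof -
  have "C_k (Suc 0) u" using assms unfolding test_function_def by blast
  then have diff: "u differentiable (at x)" and cont: "continuous_on UNIV (partial_deriv i u)" for x i
    by simp_all
  have "(u has_derivative (\<lambda>h. gradient u x \<bullet> h)) (at x)" for x
  proof -
    let ?f = "frechet_derivative u (at x)"
    have f: "(u has_derivative ?f) (at x)" using diff frechet_derivative_works by blast
    have lin: "linear ?f" using f has_derivative_linear by blast
    have "?f h = gradient u x \<bullet> h" for h
    proof -
      have "?f h = ?f (\<Sum>i\<in>UNIV. (h $ i) *\<^sub>R axis i 1)"
        by (simp add: basis_expansion scalar_mult_eq_scaleR[symmetric])
      also have "\<dots> = (\<Sum>i\<in>UNIV. h $ i * ?f (axis i 1))"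
        using lin by (simp add: linear_sum linear_cmul)
      finally show ?thesis
        by (simp add: gradient_def partial_deriv_def inner_vec_def mult.commute)
    qed
    then have "?f = (\<lambda>h. gradient u x \<bullet> h)" by (rule ext)
    with f show ?thesis by metis
  qed
  moreover have "continuous_on UNIV (gradient u)"
    unfolding gradient_def[abs_def] by (intro continuous_on_vec_lambda cont)
  moreover have "\<exists>K. compact K \<and> K \<subseteq> \<Omega> \<and> (\<forall>x. x \<notin> K \<longrightarrow> u x = 0)"
  proof (intro exI conjI allI impI)
    show "compact (closure {x. u x \<noteq> 0})" "closure {x. u x \<noteq> 0} \<subseteq> \<Omega>"
      using assms by (auto simp only: test_function_def)
    show "u x = 0" if "x \<notin> closure {x. u x \<noteq> 0}" for x
      using that subsetD[OF closure_subset, of x "{x. u x \<noteq> 0}"] by blast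
  qed
  ultimately show ?thesis unfolding C1c_def by simp
qed

text \<open>The exterior ball is disjoint from the open set \<open>\<Omega>\<close>, hence so is its closure; the resulting
strict inequality makes the ground state positive on all of \<open>\<Omega>\<close>.\<close>

lemma exterior_ball_atD:
  fixes \<Omega> :: "'a::euclidean_space set"
  assumes "open \<Omega>" "exterior_ball_at \<Omega> a"
  obtains y where "a \<noteq> y" "\<And>x. x \<in> \<Omega> \<Longrightarrow> dist a y < dist x y"
proof -
  obtain y r where r: "r > 0" "ball y r \<subseteq> - closure \<Omega>" "a \<in> frontier (ball y r)"
    using assms(2) unfolding exterior_ball_at_def by blast
  have ay: "dist a y = r" using r by (simp add: frontier_ball dist_commute)
  have "\<Omega> \<inter> ball y r = {}" using r(2) closure_subset by blast
  then have "\<Omega> \<inter> closure (ball y r) = {}" using open_Int_closure_eq_empty[OF assms(1)] by blast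
  then have "\<Omega> \<inter> cball y r = {}" using r(1) by simp
  have "dist a y < dist x y" if "x \<in> \<Omega>" for x
  proof -
    have "x \<notin> cball y r" using \<open>\<Omega> \<inter> cball y r = {}\<close> that by blast
    then show ?thesis using ay by (simp add: dist_commute)
  qed
  moreover have "a \<noteq> y" using ay r(1) by auto
  ultimately show ?thesis using that by blast
qed

lemma dist_le_max_dist:
  assumes "bounded \<Omega>" "x \<in> \<Omega>" "k \<in> {1..m}"
  shows "dist x (a k) \<le> max_dist m a \<Omega>"
proof -
  have "bdd_above ((\<lambda>x. dist x (a k)) ` \<Omega>)"
    using assms(1) by (auto simp: bounded_any_center[where a = "a k"] bdd_above_def dist_commute)
  then have "dist x (a k) \<le> (SUP x\<in>\<Omega>. dist x (a k))" using assms(2) by (rule cSUP_upper2) simp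
  also have "\<dots> \<le> max_dist m a \<Omega>"
    unfolding max_dist_def using assms(3) by (intro Max_ge) auto
  finally show ?thesis .
qed

text \<open>Functions in the final inequality vanish off \<open>\<Omega>\<close>, so they are integrated over the whole space
with respect to the Borel version of the measure.\<close>

lemma set_integral_lebesgue_eq_lborel:
  fixes f :: "'a::euclidean_space \<Rightarrow> real"
  assumes "f \<in> borel_measurable borel" "\<And>x. x \<notin> \<Omega> \<Longrightarrow> f x = 0"
  shows "(LINT x:\<Omega>|lebesgue. f x) = (\<integral>x. f x \<partial>lborel)"
proof -
  have "(\<lambda>x. indicator \<Omega> x *\<^sub>R f x) = f"
  proof
    show "indicator \<Omega> x *\<^sub>R f x = f x" for x
      using assms(2)[of x] by (cases "x \<in> \<Omega>") auto
  qed
  then show ?thesis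
    unfolding set_lebesgue_integral_def using integral_completion[of f lborel] assms(1) by simp
qed

theorem theorem20:
  fixes m :: nat
  assumes "CARD('n::finite) \<ge> 3" and "m \<ge> 1"
  shows "\<exists>c::real. c > 0 \<and>
    (\<forall>(\<Omega> :: (real ^ 'n) set) (a :: nat \<Rightarrow> real ^ 'n).
      bounded_domain \<Omega> \<and> inj_on a {1..m} \<and>
      (\<forall>k\<in>{1..m}. a k \<in> frontier \<Omega> \<and> exterior_ball_at \<Omega> (a k)) \<longrightarrow>
      (\<exists>l::real. l > 0 \<and>
        (\<forall>u. test_function \<Omega> u \<longrightarrow>
          l * (LINT x:\<Omega>|lebesgue. (u x)\<^sup>2) + (LINT x:\<Omega>|lebesgue. (norm (gradient u x))\<^sup>2)
          \<ge> (real CARD('n))\<^sup>2 / 4 *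
              (\<Sum>k=1..m. LINT x:\<Omega>|lebesgue. (u x)\<^sup>2 / (norm (x - a k))\<^sup>2)
            + c * (LINT x:\<Omega>|lebesgue.
                     \<bar>u x\<bar> powr (2 * real CARD('n) / (real CARD('n) - 2)) * log_weight m a \<Omega> x)
                  powr ((real CARD('n) - 2) / real CARD('n)))))"
proof -
  define n where "n = real CARD('n)"
  have n: "n \<ge> 3" using assms(1) by (simp add: n_def)
  have dim: "DIM(real ^ 'n) = CARD('n)" by simp
  define p where "p = n / (n - 2)"
  have p: "2 * n / (n - 2) = 2 * p" "(n - 2) / n = 1 / p" "(2 * n - 2) / (n - 2) = 1 + p"
    using n unfolding p_def by (auto simp: field_simps)
  obtain c where c: "c > 0" and main: "\<forall>(\<Omega>::(real ^ 'n) set) a D. exterior_configuration m \<Omega> a D \<longrightarrow>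
    (\<exists>l\<ge>0. \<forall>v g. C1c \<Omega> v g \<longrightarrow>
      n\<^sup>2 / 4 * (\<Sum>k=1..m. \<integral>x. (v x)\<^sup>2 / (norm (x - a k))\<^sup>2 \<partial>lborel)
      + c * (\<integral>x. \<bar>v x\<bar> powr (2 * p) * (\<Prod>k=1..m. X1 (norm (x - a k) / D) powr (1 + p)) \<partial>lborel) powr (1 / p)
      \<le> l * (\<integral>x. (v x)\<^sup>2 \<partial>lborel) + (\<integral>x. (norm (g x))\<^sup>2 \<partial>lborel))"
  proof -
    have "DIM(real ^ 'n) \<ge> 3" "p = real DIM(real ^ 'n) / (real DIM(real ^ 'n) - 2)"
      using assms(1) unfolding p_def n_def by simp_all
    from multipolar_Hardy_Sobolev[OF this, of m, unfolded dim, folded n_def]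
    show ?thesis by (elim exE conjE) (rule that; assumption)
  qed
  have "\<exists>l>0. \<forall>u. test_function \<Omega> u \<longrightarrow>
          l * (LINT x:\<Omega>|lebesgue. (u x)\<^sup>2) + (LINT x:\<Omega>|lebesgue. (norm (gradient u x))\<^sup>2)
          \<ge> n\<^sup>2 / 4 * (\<Sum>k=1..m. LINT x:\<Omega>|lebesgue. (u x)\<^sup>2 / (norm (x - a k))\<^sup>2)
            + c * (LINT x:\<Omega>|lebesgue. \<bar>u x\<bar> powr (2 * p) * log_weight m a \<Omega> x) powr (1 / p)"
    if dom: "bounded_domain \<Omega>" and inj: "inj_on a {1..m}"
      and ext: "\<And>k. k \<in> {1..m} \<Longrightarrow> a k \<in> frontier \<Omega> \<and> exterior_ball_at \<Omega> (a k)"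
    for \<Omega> :: "(real ^ 'n) set" and a
  proof -
    define D where "D = max_dist m a \<Omega>"
    have op: "open \<Omega>" and bd: "bounded \<Omega>" and ne: "\<Omega> \<noteq> {}" using dom by (auto simp: bounded_domain_def)
    have dD: "dist x (a k) \<le> D" if "k \<in> {1..m}" "x \<in> \<Omega>" for k x
      unfolding D_def by (rule dist_le_max_dist[OF bd that(2,1)])
    have ball: "\<exists>y. a k \<noteq> y \<and> (\<forall>x\<in>\<Omega>. dist (a k) y < dist x y)" if k: "k \<in> {1..m}" for k
    proof -
      obtain y where "a k \<noteq> y" "\<And>x. x \<in> \<Omega> \<Longrightarrow> dist (a k) y < dist x y"
        using ext[OF k] by (blast intro: exterior_ball_atD[OF op])
      then show ?thesis by blast
    qed
    have "D > 0"
    proof -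
      obtain x where x: "x \<in> \<Omega>" using ne by blast
      have one: "1 \<in> {1..m}" using assms(2) by simp
      obtain y where "dist (a 1) y < dist x y" using ball[OF one] x by blast
      then have "x \<noteq> a 1" by auto
      then show ?thesis using dD[OF one x] zero_less_dist_iff[of x "a 1"] by linarith
    qed
    then have "exterior_configuration m \<Omega> a D" using op inj ball dD by auto
    from main[THEN spec, THEN spec, THEN spec, THEN mp, OF this] obtain l where l: "l \<ge> 0" and
      ineq: "\<forall>v g. C1c \<Omega> v g \<longrightarrow>
      n\<^sup>2 / 4 * (\<Sum>k=1..m. \<integral>x. (v x)\<^sup>2 / (norm (x - a k))\<^sup>2 \<partial>lborel)
      + c * (\<integral>x. \<bar>v x\<bar> powr (2 * p) * (\<Prod>k=1..m. X1 (norm (x - a k) / D) powr (1 + p)) \<partial>lborel) powr (1 / p)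
      \<le> l * (\<integral>x. (v x)\<^sup>2 \<partial>lborel) + (\<integral>x. (norm (g x))\<^sup>2 \<partial>lborel)"
      by (elim exE conjE) (rule that; assumption)
    \<comment> \<open>The induction supplies \<open>l \<ge> 0\<close>; adding \<open>1\<close> makes the coefficient positive.\<close>
    have "(l + 1) * (LINT x:\<Omega>|lebesgue. (u x)\<^sup>2) + (LINT x:\<Omega>|lebesgue. (norm (gradient u x))\<^sup>2)
          \<ge> n\<^sup>2 / 4 * (\<Sum>k=1..m. LINT x:\<Omega>|lebesgue. (u x)\<^sup>2 / (norm (x - a k))\<^sup>2)
            + c * (LINT x:\<Omega>|lebesgue. \<bar>u x\<bar> powr (2 * p) * log_weight m a \<Omega> x) powr (1 / p)"
      if "test_function \<Omega> u" for u
    proof -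
      have C: "C1c \<Omega> u (gradient u)" by (rule test_function_C1c[OF that])
      have [measurable]: "u \<in> borel_measurable borel" "gradient u \<in> borel_measurable borel"
        using C1c_continuous[OF C] by (auto intro: borel_measurable_continuous_onI)
      have out: "u x = 0" "gradient u x = 0" if "x \<notin> \<Omega>" for x
        using C1c_zero_outside[OF C that] by auto
      have log_weight: "log_weight m a \<Omega> x = (\<Prod>k=1..m. X1 (norm (x - a k) / D) powr (1 + p))" for x
        unfolding log_weight_def D_def n_def[symmetric] p(3) ..
      have eqs: "(LINT x:\<Omega>|lebesgue. (u x)\<^sup>2) = (\<integral>x. (u x)\<^sup>2 \<partial>lborel)"
        "(LINT x:\<Omega>|lebesgue. (norm (gradient u x))\<^sup>2) = (\<integral>x. (norm (gradient u x))\<^sup>2 \<partial>lborel)"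
        "(LINT x:\<Omega>|lebesgue. (u x)\<^sup>2 / (norm (x - a k))\<^sup>2) = (\<integral>x. (u x)\<^sup>2 / (norm (x - a k))\<^sup>2 \<partial>lborel)"
        "(LINT x:\<Omega>|lebesgue. \<bar>u x\<bar> powr (2 * p) * log_weight m a \<Omega> x) =
           (\<integral>x. \<bar>u x\<bar> powr (2 * p) * (\<Prod>k=1..m. X1 (norm (x - a k) / D) powr (1 + p)) \<partial>lborel)" for k
        unfolding log_weight X1_def using out by (subst set_integral_lebesgue_eq_lborel; simp)+
      have "0 \<le> (\<integral>x. (u x)\<^sup>2 \<partial>lborel)" by simp
      then show ?thesis
        unfolding eqs distrib_right using ineq[rule_format, OF C] by linarith
    qed
    then show ?thesis using l by (intro exI[of _ "l + 1"]) auto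
  qed
  then show ?thesis
    using c unfolding n_def[symmetric] p(1,2) by (intro exI[of _ c]) auto
qed

end
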